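(* Let $g\in C^{\omega}(\mathbb{R})$ be a real-analytic function such that $$g(v)>0,\qquad \frac{d g}{d v}(v)\ge 0,\qquad \frac{d^2}{dv^2}\big(v^2 g(v^2)\big)>0\qquad\text{for all } v>0,\qquad \lim_{v\to\infty} v\,g(v^2)=\infty .$$ Then there exists $\beta>0$ such that the toy model with this $g$ and this $\beta$ has a unique toy steady tip growth solution.
   Context: Toy model: for a real-analytic $g:\mathbb{R}\to\mathbb{R}$ with $g(v)>0$ for $v>0$ and a parameter $\beta$, the toy model is the planar ODE (independent variable $s$, prime denotes $d/ds$) $$\rho'=\frac32\,\frac{1-\rho^2}{r}\left(-1+\frac{\sqrt{1-\rho^2}\,\big(\beta r^2 g(r^2)+\rho\big)}{r}\right),\qquad r'=\rho,$$ on the phase space $M_0=(-1,1)\times\mathbb{R}_{>0}$. Consider solutions $(\rho,r)$ defined on an interval of the form $(0,s_{\max})$. Conditions: (S1) $\lim_{s\to0^+}\rho(s)=1$, $\lim_{s\to0^+}r(s)=0$, and $\lim_{s\to0^+}\sqrt{1-\rho(s)^2}/r(s)=\eta_0$ for some $\eta_0>0$. (S2) there exist $s_0>0$ and a real-analytic $G:(-a,a)\to\mathbb{R}_{>0}$ with $a=r(s_0)^2$ such that $\rho(s)=G(r(s)^2)$ for all $s\in(0,s_0)$. (S3) the solution is defined on $(0,\infty)$ and $\rho'(s)<0$, $\rho(s)>0$ for all $s>0$. (S4) $\lim_{s\to\infty}\rho(s)=0$ and $\lim_{s\to\infty}r(s)=r_\infty$ for some $r_\infty>0$. A toy steady tip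 growth solution is a solution of the toy model satisfying (S1)–(S4). *)

theory Defs
  imports "HOL-Analysis.Analysis"
begin

definition real_analytic_on :: "(real \<Rightarrow> real) \<Rightarrow> real set \<Rightarrow> bool" where
  "real_analytic_on f S \<longleftrightarrow>
     (\<forall>x\<in>S. \<exists>\<delta>>0. \<exists>c :: nat \<Rightarrow> real.
        \<forall>y. \<bar>y - x\<bar> < \<delta> \<longrightarrow> (\<lambda>n. c n * (y - x) ^ n) sums f y)"

definition toy_rhs :: "(real \<Rightarrow> real) \<Rightarrow> real \<Rightarrow> real \<Rightarrow> real \<Rightarrow> real" where
  "toy_rhs g \<beta> \<rho> r =
     3/2 * (1 - \<rho>^2) / r *
       (-1 + sqrt (1 - \<rho>^2) * (\<beta> * r^2 * g (r^2) + \<rho>) / r)"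

text \<open>Toy steady tip growth solution: a solution of the toy model satisfying (S1)--(S4).
 Because of (S3) it is a solution on (0,\<infinity>).\<close>
definition toy_steady_tip_growth ::
  "(real \<Rightarrow> real) \<Rightarrow> real \<Rightarrow> (real \<Rightarrow> real) \<Rightarrow> (real \<Rightarrow> real) \<Rightarrow> bool" where
  "toy_steady_tip_growth g \<beta> \<rho> r \<longleftrightarrow>
     (\<forall>s>0. -1 < \<rho> s \<and> \<rho> s < 1 \<and> 0 < r s \<and>
        (\<rho> has_real_derivative toy_rhs g \<beta> (\<rho> s) (r s)) (at s) \<and>
        (r has_real_derivative \<rho> s) (at s))
   \<comment> \<open>(S1)\<close>
   \<and> (\<rho> \<longlongrightarrow> 1) (at_right 0) \<and> (r \<longlongrightarrow> 0) (at_right 0)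
   \<and> (\<exists>\<eta>0>0. ((\<lambda>s. sqrt (1 - \<rho> s ^ 2) / r s) \<longlongrightarrow> \<eta>0) (at_right 0))
   \<comment> \<open>(S2)\<close>
   \<and> (\<exists>s0>0. \<exists>G. real_analytic_on G {- (r s0 ^ 2)<..<r s0 ^ 2}
        \<and> (\<forall>v\<in>{- (r s0 ^ 2)<..<r s0 ^ 2}. G v > 0)
        \<and> (\<forall>s\<in>{0<..<s0}. \<rho> s = G (r s ^ 2)))
   \<comment> \<open>(S3)\<close>
   \<and> (\<forall>s>0. deriv \<rho> s < 0 \<and> \<rho> s > 0)
   \<comment> \<open>(S4)\<close>
   \<and> (\<rho> \<longlongrightarrow> 0) at_top \<and> (\<exists>r_inf>0. (r \<longlongrightarrow> r_inf) at_top)"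

end

theory Submission
  imports Defs "HOL-Complex_Analysis.Complex_Analysis"
begin

text \<open>
  In the variables \<open>v = r\<^sup>2\<close> and \<open>\<eta> = \<surd>(1 - \<rho>\<^sup>2) / r\<close> the model reads
  \<open>4 v \<eta>' = \<eta> (1 - 3 \<eta> (\<beta> v g(v) + \<rho>))\<close> with \<open>\<rho> = \<surd>(1 - v \<eta>\<^sup>2)\<close>. At the singular point \<open>v = 0\<close> the
  only admissible value is \<open>\<eta> = 1/3\<close>, where the linearisation has the negative exponent \<open>-1/4\<close>.
  Hence (S1) alone determines the trajectory for given \<open>\<beta>\<close>, and a contraction on holomorphic
  functions produces it as an analytic function of \<open>v\<close>, Lipschitz in \<open>\<beta>\<close>.

  The parameter is found by shooting. Write \<open>\<rho>' = (3/2) r \<eta>\<^sup>2 (N - 1)\<close> with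
  \<open>N = \<eta> (\<beta> r\<^sup>2 g(r\<^sup>2) + \<rho>)\<close>. The set of \<open>\<beta>\<close> for which \<open>N\<close> exceeds \<open>1\<close> while still \<open>\<rho> > 0\<close>, and
  the set for which \<open>\<rho>\<close> becomes negative while still \<open>N < 1\<close>, are disjoint and open; the first omits
  small \<open>\<beta>\<close>, the second omits large \<open>\<beta>\<close>. So some \<open>\<beta>\<close> lies in neither set. Convexity of
  \<open>f(r) = r\<^sup>2 g(r\<^sup>2)\<close> excludes that \<open>N = 1\<close> is reached tangentially, and backward uniqueness that the
  equilibrium is reached in finite time, so for this \<open>\<beta>\<close> both \<open>\<rho> > 0\<close> and \<open>\<rho>' < 0\<close> persist for ever.
  Since \<open>N < 1\<close> and \<open>r g(r\<^sup>2) \<longlongrightarrow> \<infinity>\<close>, the radius stays bounded, which forces \<open>\<rho> \<longlongrightarrow> 0\<close>.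
\<close>

section \<open>Autonomous differential equations with Lipschitz right-hand side\<close>

lemma at_within_atLeast: "a < t \<Longrightarrow> at t within {a..} = at (t::real)"
  by (rule at_within_interior) (simp add: interior_real_atLeast)

lemma indefinite_integral_has_vector_derivative:
  fixes F :: "real \<Rightarrow> 'a::banach"
  assumes "continuous_on {0..} F" "t \<ge> 0"
  shows "((\<lambda>t. integral {0..t} F) has_vector_derivative F t) (at t within {0..})"
proof -
  have "((\<lambda>t. integral {0..t} F) has_vector_derivative F t) (at t within {0..t+1})"
    using assms by (intro integral_has_vector_derivative) (auto intro: continuous_on_subset)
  moreover have "at t within {0..t+1} = at t within {0..}"
    by (rule at_within_nhd[where S = "{..<t+1}"]) auto
  ultimately show ?thesis by simp
qed

definition ode_solution :: "('a::real_normed_vector \<Rightarrow> 'a) \<Rightarrow> (real \<Rightarrow> 'a) \<Rightarrow> bool" where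
  "ode_solution f x \<longleftrightarrow> (\<forall>t\<ge>0. (x has_vector_derivative f (x t)) (at t within {0..}))"

lemma ode_solution_derivative_within:
  "ode_solution f x \<Longrightarrow> t \<ge> 0 \<Longrightarrow> (x has_vector_derivative f (x t)) (at t within {0..})"
  by (simp add: ode_solution_def)

lemma ode_solution_derivative:
  "ode_solution f x \<Longrightarrow> t > 0 \<Longrightarrow> (x has_vector_derivative f (x t)) (at t)"
  using ode_solution_derivative_within[of f x t] by (simp add: at_within_atLeast)

lemma ode_solution_continuous_on: "ode_solution f x \<Longrightarrow> continuous_on {0..} x"
  by (rule continuous_on_vector_derivative) (auto intro: ode_solution_derivative_within)

lemma exp_weighted_integral_bound:
  fixes F :: "real \<Rightarrow> 'a::banach"
  assumes cont: "continuous_on {0..s} F" and "0 \<le> s" "0 < k" "0 \<le> C"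
    and bound: "\<And>u. u \<in> {0..s} \<Longrightarrow> norm (F u) \<le> C * exp (k * u)"
  shows "exp (- k * s) * norm (integral {0..s} F) \<le> C / k"
proof -
  have weight: "((\<lambda>u. C * exp (k * u)) has_integral C * exp (k * s) / k - C * exp (k * 0) / k) {0..s}"
    by (rule fundamental_theorem_of_calculus[OF \<open>0 \<le> s\<close>])
      (use \<open>0 < k\<close> in \<open>auto intro!: derivative_eq_intros
        simp: has_real_derivative_iff_has_vector_derivative[symmetric]\<close>)
  have "norm (integral {0..s} F) \<le> integral {0..s} (\<lambda>u. C * exp (k * u))"
    by (intro integral_norm_bound_integral integrable_continuous_interval cont bound)
      (auto intro!: continuous_intros)
  also have "\<dots> \<le> C * exp (k * s) / k"
    using integral_unique[OF weight] \<open>0 < k\<close> \<open>0 \<le> C\<close> by simp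
  finally have "exp (- k * s) * norm (integral {0..s} F) \<le> exp (- k * s) * (C * exp (k * s) / k)"
    by (rule mult_left_mono) simp
  also have "\<dots> = C / k" by (simp add: exp_minus field_simps)
  finally show ?thesis .
qed

text \<open>The Picard operator in the unknown \<open>\<psi> t = exp (- k t) x t\<close>: for large \<open>k\<close> it contracts the
  supremum norm on the whole half-line.\<close>

definition weighted_picard ::
  "real \<Rightarrow> ('a::banach \<Rightarrow> 'a) \<Rightarrow> 'a \<Rightarrow> (real \<Rightarrow> 'a) \<Rightarrow> real \<Rightarrow> 'a" where
  "weighted_picard k f x0 \<psi> t =
     exp (- k * max 0 t) *\<^sub>R (x0 + integral {0..max 0 t} (\<lambda>u. f (exp (k * u) *\<^sub>R \<psi> u)))"

context
  fixes f :: "'a::banach \<Rightarrow> 'a" and L k :: real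
  assumes lipschitz: "L-lipschitz_on UNIV f" and k: "k = 2 * (L + 1)"
begin

lemma picard_weight_pos: "0 \<le> L" "0 < k"
  using lipschitz_on_nonneg[OF lipschitz] k by auto

lemma picard_integrand_continuous_on:
  "continuous_on S (\<lambda>u. f (exp (k * u) *\<^sub>R apply_bcontfun \<psi> u))"
  by (rule continuous_on_compose2[OF lipschitz_on_continuous_on[OF lipschitz]])
    (auto intro!: continuous_intros)

lemma picard_integral_derivative:
  "t \<ge> 0 \<Longrightarrow> ((\<lambda>t. integral {0..t} (\<lambda>u. f (exp (k * u) *\<^sub>R apply_bcontfun \<psi> u)))
     has_vector_derivative f (exp (k * t) *\<^sub>R \<psi> t)) (at t within {0..})"
  by (rule indefinite_integral_has_vector_derivative[OF picard_integrand_continuous_on])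

lemma weighted_picard_bcontfun: "weighted_picard k f x0 (apply_bcontfun \<psi>) \<in> bcontfun"
proof (rule bcontfun_normI)
  define I where "I = (\<lambda>t. integral {0..t} (\<lambda>u. f (exp (k * u) *\<^sub>R \<psi> u)))"
  define C where "C = norm (f 0) + L * norm \<psi>"
  have "continuous_on {0..} I"
    unfolding I_def by (rule continuous_on_vector_derivative) (auto intro: picard_integral_derivative)
  then have I_continuous: "continuous_on UNIV (\<lambda>t. I (max 0 t))"
    by (rule continuous_on_compose2) (auto intro!: continuous_intros)
  have "continuous_on UNIV (\<lambda>t. exp (- k * max 0 t) *\<^sub>R (x0 + I (max 0 t)))"
    by (intro continuous_intros I_continuous)
  then show "continuous_on UNIV (weighted_picard k f x0 \<psi>)"
    by (simp add: weighted_picard_def[abs_def] I_def)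
  fix t :: real
  define s where "s = max 0 t"
  have "norm (f (exp (k * u) *\<^sub>R \<psi> u)) \<le> C * exp (k * u)" if "u \<in> {0..s}" for u
  proof -
    have "norm (f (exp (k * u) *\<^sub>R \<psi> u)) \<le> norm (f 0) + norm (f (exp (k * u) *\<^sub>R \<psi> u) - f 0)"
      by (rule norm_triangle_sub)
    also have "\<dots> \<le> norm (f 0) + L * norm (exp (k * u) *\<^sub>R \<psi> u)"
      using lipschitz_on_normD[OF lipschitz, of "exp (k * u) *\<^sub>R \<psi> u" 0] by simp
    also have "\<dots> \<le> norm (f 0) * exp (k * u) + L * (exp (k * u) * norm \<psi>)"
      using that picard_weight_pos norm_bounded[of \<psi> u]
      by (intro add_mono mult_left_mono) (auto simp: mult_le_cancel_left1)
    finally show ?thesis by (simp add: C_def algebra_simps)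
  qed
  then have "exp (- k * s) * norm (I s) \<le> C / k"
    unfolding I_def using picard_weight_pos
    by (intro exp_weighted_integral_bound picard_integrand_continuous_on) (auto simp: s_def C_def)
  moreover have "exp (- k * s) * norm x0 \<le> norm x0"
    using picard_weight_pos by (intro mult_left_le_one_le) (auto simp: s_def)
  moreover have "norm (weighted_picard k f x0 \<psi> t) \<le> exp (- k * s) * norm x0 + exp (- k * s) * norm (I s)"
    unfolding weighted_picard_def s_def[symmetric] distrib_left[symmetric]
    by (simp add: I_def norm_triangle_ineq)
  ultimately show "norm (weighted_picard k f x0 \<psi> t) \<le> norm x0 + C / k" by linarith
qed

lemma weighted_picard_contraction:
  fixes \<psi> \<phi> :: "real \<Rightarrow>\<^sub>C 'a"
  shows "dist (weighted_picard k f x0 \<psi> t) (weighted_picard k f x0 \<phi> t) \<le> 1/2 * dist \<psi> \<phi>"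
proof -
  define s where "s = max 0 t"
  define F where "F = (\<lambda>(\<psi> :: real \<Rightarrow>\<^sub>C 'a) u. f (exp (k * u) *\<^sub>R apply_bcontfun \<psi> u))"
  have cont: "continuous_on S (F \<psi>)" for S \<psi>
    unfolding F_def by (rule picard_integrand_continuous_on)
  have "norm (F \<psi> u - F \<phi> u) \<le> L * dist \<psi> \<phi> * exp (k * u)" for u
  proof -
    have "norm (F \<psi> u - F \<phi> u) \<le> L * norm (exp (k * u) *\<^sub>R (\<psi> u - \<phi> u))"
      unfolding F_def scaleR_diff_right by (rule lipschitz_on_normD[OF lipschitz UNIV_I UNIV_I])
    also have "\<dots> \<le> L * (exp (k * u) * dist \<psi> \<phi>)"
      using picard_weight_pos dist_bounded[of \<psi> u \<phi>] by (simp add: mult_left_mono dist_norm)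
    finally show ?thesis by (simp add: mult_ac)
  qed
  then have "exp (- k * s) * norm (integral {0..s} (\<lambda>u. F \<psi> u - F \<phi> u)) \<le> L * dist \<psi> \<phi> / k"
    using picard_weight_pos
    by (intro exp_weighted_integral_bound continuous_intros cont) (auto simp: s_def)
  also have "\<dots> \<le> 1/2 * dist \<psi> \<phi>"
    using picard_weight_pos by (simp add: k field_simps)
  also have "exp (- k * s) * norm (integral {0..s} (\<lambda>u. F \<psi> u - F \<phi> u))
      = dist (weighted_picard k f x0 \<psi> t) (weighted_picard k f x0 \<phi> t)"
    unfolding weighted_picard_def s_def[symmetric] dist_norm scaleR_diff_right[symmetric]
    by (simp add: F_def integral_diff integrable_continuous_interval[OF cont[unfolded F_def]])
  finally show ?thesis .
qed

lemma weighted_picard_fixpoint: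
  obtains \<psi> where "apply_bcontfun \<psi> = weighted_picard k f x0 \<psi>"
proof -
  define T where "T = (\<lambda>\<psi>. Bcontfun (weighted_picard k f x0 (apply_bcontfun \<psi>)))"
  have apply_T: "apply_bcontfun (T \<psi>) = weighted_picard k f x0 \<psi>" for \<psi>
    by (simp add: T_def Bcontfun_inverse[OF weighted_picard_bcontfun])
  have "\<forall>\<psi> \<phi>. dist (T \<psi>) (T \<phi>) \<le> 1/2 * dist \<psi> \<phi>"
    by (intro allI dist_bound) (simp only: apply_T weighted_picard_contraction)
  then obtain \<psi> where "T \<psi> = \<psi>" using banach_fix_type[of "1/2" T] by auto
  then show thesis using apply_T[of \<psi>] that by simp
qed

end

theorem ode_solution_exists:
  fixes f :: "'a::banach \<Rightarrow> 'a"
  assumes "L-lipschitz_on UNIV f"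
  obtains x where "x 0 = x0" "ode_solution f x"
proof -
  define k where "k = 2 * (L + 1)"
  obtain \<psi> where fixpoint: "apply_bcontfun \<psi> = weighted_picard k f x0 \<psi>"
    by (rule weighted_picard_fixpoint[OF assms k_def])
  define x where "x = (\<lambda>t. x0 + integral {0..t} (\<lambda>u. f (exp (k * u) *\<^sub>R \<psi> u)))"
  have unweighted: "exp (k * t) *\<^sub>R \<psi> t = x t" if "t \<ge> 0" for t
    using that by (subst fixpoint) (simp add: weighted_picard_def x_def exp_minus)
  have "(x has_vector_derivative f (x t)) (at t within {0..})" if "t \<ge> 0" for t
    using picard_integral_derivative[OF assms k_def that, of \<psi>] unweighted[OF that]
    unfolding x_def by (auto intro!: derivative_eq_intros)
  then have "ode_solution f x" by (simp add: ode_solution_def)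
  moreover have "x 0 = x0" by (simp add: x_def)
  ultimately show thesis using that by blast
qed

lemma linear_growth_bound:
  fixes u :: "real \<Rightarrow> real"
  assumes "a \<le> b" and cont: "continuous_on {a..b} u"
    and deriv: "\<And>t. a < t \<Longrightarrow> t < b \<Longrightarrow> (u has_real_derivative u' t) (at t)"
    and growth: "\<And>t. a < t \<Longrightarrow> t < b \<Longrightarrow> u' t \<le> c * u t"
  shows "u b \<le> exp (c * (b - a)) * u a"
proof -
  have "exp (- c * (b - a)) * u b \<le> exp (- c * (a - a)) * u a"
  proof (rule DERIV_nonpos_imp_decreasing_open[OF \<open>a \<le> b\<close>, where f = "\<lambda>t. exp (- c * (t - a)) * u t"])
    show "continuous_on {a..b} (\<lambda>t. exp (- c * (t - a)) * u t)"
      by (intro continuous_intros cont)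
    fix t assume t: "a < t" "t < b"
    have "((\<lambda>t. exp (- c * (t - a)) * u t) has_real_derivative exp (- c * (t - a)) * (u' t - c * u t)) (at t)"
      by (rule derivative_eq_intros refl deriv t)+ (simp add: algebra_simps)
    moreover have "exp (- c * (t - a)) * (u' t - c * u t) \<le> 0"
      using growth[OF t] by (simp add: mult_nonneg_nonpos)
    ultimately show "\<exists>y. ((\<lambda>t. exp (- c * (t - a)) * u t) has_real_derivative y) (at t) \<and> y \<le> 0"
      by blast
  qed
  then have "exp (c * (b - a)) * (exp (- c * (b - a)) * u b) \<le> exp (c * (b - a)) * u a" by simp
  moreover have "exp (c * (b - a)) * exp (- c * (b - a)) = 1"
    by (simp add: exp_minus)
  ultimately show ?thesis by (simp only: mult.assoc[symmetric] mult_1)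
qed

lemma ode_solution_difference_derivative:
  fixes x y :: "real \<Rightarrow> 'a::real_inner"
  assumes x: "ode_solution f x" and y: "ode_solution f y" and "0 < t"
  shows "((\<lambda>t. (norm (x t - y t))\<^sup>2) has_real_derivative 2 * ((x t - y t) \<bullet> (f (x t) - f (y t)))) (at t)"
proof -
  have "((\<lambda>t. x t - y t) has_derivative (\<lambda>h. h *\<^sub>R (f (x t) - f (y t)))) (at t)"
    using has_vector_derivative_diff[OF ode_solution_derivative[OF x \<open>0 < t\<close>]
        ode_solution_derivative[OF y \<open>0 < t\<close>]]
    by (simp add: has_vector_derivative_def)
  from has_derivative_inner[OF this this] show ?thesis
    unfolding power2_norm_eq_inner has_field_derivative_def
    by (rule has_derivative_eq_rhs) (auto simp: inner_commute)
qed

lemma lipschitz_on_inner_bound: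
  fixes f :: "'a::real_inner \<Rightarrow> 'a"
  assumes "L-lipschitz_on S f" "x \<in> S" "y \<in> S"
  shows "\<bar>(x - y) \<bullet> (f x - f y)\<bar> \<le> L * (norm (x - y))\<^sup>2"
proof -
  have "\<bar>(x - y) \<bullet> (f x - f y)\<bar> \<le> norm (x - y) * norm (f x - f y)" by (rule Cauchy_Schwarz_ineq2)
  also have "\<dots> \<le> norm (x - y) * (L * norm (x - y))"
    by (intro mult_left_mono lipschitz_on_normD[OF assms]) auto
  finally show ?thesis by (simp add: power2_eq_square mult_ac)
qed

lemma ode_gronwall:
  fixes f :: "'a::real_inner \<Rightarrow> 'a"
  assumes lipschitz: "L-lipschitz_on UNIV f"
    and x: "ode_solution f x" and y: "ode_solution f y" and "t \<ge> 0"
  shows "norm (x t - y t) \<le> exp (L * t) * norm (x 0 - y 0)"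
    and "norm (x 0 - y 0) \<le> exp (L * t) * norm (x t - y t)"
proof -
  define u where "u = (\<lambda>t. (norm (x t - y t))\<^sup>2)"
  define u' where "u' = (\<lambda>t. 2 * ((x t - y t) \<bullet> (f (x t) - f (y t))))"
  have cont: "continuous_on {0..t} u"
    unfolding u_def
    by (intro continuous_intros continuous_on_subset[OF ode_solution_continuous_on[OF x]]
        continuous_on_subset[OF ode_solution_continuous_on[OF y]]) auto
  have deriv: "(u has_real_derivative u' s) (at s)" if "0 < s" for s
    unfolding u_def u'_def by (rule ode_solution_difference_derivative[OF x y that])
  have u'_bound: "\<bar>u' s\<bar> \<le> 2 * L * u s" for s
    using lipschitz_on_inner_bound[OF lipschitz UNIV_I UNIV_I, of "x s" "y s"]
    by (simp add: u_def u'_def abs_mult)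
  have sqrt_bound: "a \<le> exp (L * t) * b" if "a\<^sup>2 \<le> exp (2 * L * t) * b\<^sup>2" "b \<ge> 0" for a b
  proof (rule power2_le_imp_le)
    show "a\<^sup>2 \<le> (exp (L * t) * b)\<^sup>2"
      using that(1) exp_double[of "L * t"] by (simp add: power_mult_distrib mult.assoc)
  qed (use that in simp)
  have "u t \<le> exp (2 * L * (t - 0)) * u 0"
    using u'_bound by (intro linear_growth_bound[OF \<open>t \<ge> 0\<close> cont deriv]) (auto simp: abs_le_iff)
  then show "norm (x t - y t) \<le> exp (L * t) * norm (x 0 - y 0)"
    by (intro sqrt_bound) (auto simp: u_def)
  have "- u t \<le> exp (- (2 * L) * (t - 0)) * - u 0"
  proof (rule linear_growth_bound[OF \<open>t \<ge> 0\<close>])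
    show "((\<lambda>s. - u s) has_real_derivative - u' s) (at s)" if "0 < s" for s
      using deriv[OF that] by (rule DERIV_minus)
    show "- u' s \<le> - (2 * L) * - u s" for s using u'_bound[of s] by (simp add: abs_le_iff)
  qed (intro continuous_intros cont)
  then have "u 0 \<le> exp (2 * L * t) * u t" by (simp add: exp_minus field_simps)
  then show "norm (x 0 - y 0) \<le> exp (L * t) * norm (x t - y t)"
    by (intro sqrt_bound) (auto simp: u_def)
qed

lemma ode_solution_backward_unique:
  fixes f :: "'a::real_inner \<Rightarrow> 'a"
  assumes "L-lipschitz_on UNIV f" "ode_solution f x" "ode_solution f y" "t \<ge> 0" "x t = y t"
  shows "x 0 = y 0"
  using ode_gronwall(2)[OF assms(1-4)] assms(5) by simp

lemma ode_solution_family_continuous_on: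
  fixes f :: "'a::real_inner \<Rightarrow> 'a" and x :: "'p::topological_space \<Rightarrow> real \<Rightarrow> 'a"
  assumes lipschitz: "L-lipschitz_on UNIV f" and solution: "\<And>p. p \<in> I \<Longrightarrow> ode_solution f (x p)"
    and initial: "continuous_on I (\<lambda>p. x p 0)"
  shows "continuous_on (I \<times> {0..}) (\<lambda>(p, t). x p t)"
  unfolding continuous_on_def
proof
  fix z :: "'p \<times> real" assume "z \<in> I \<times> {0..}"
  then obtain p t where z: "z = (p, t)" "p \<in> I" "t \<ge> 0" by auto
  define bound where
    "bound = (\<lambda>(q, s). exp (L * s) * norm (x q 0 - x p 0) + norm (x p s - x p t))"
  have "continuous_on (I \<times> {0..}) bound"
    unfolding bound_def split_beta
    by (intro continuous_intros continuous_on_compose2[OF initial]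
        continuous_on_compose2[OF ode_solution_continuous_on[OF solution[OF z(2)]]]) auto
  then have "(bound \<longlongrightarrow> bound z) (at z within I \<times> {0..})"
    using \<open>z \<in> I \<times> {0..}\<close> unfolding continuous_on_def by blast
  then have "(bound \<longlongrightarrow> 0) (at z within I \<times> {0..})" by (simp add: bound_def z(1))
  moreover have "norm (x q s - x p t) \<le> bound (q, s)" if "q \<in> I" "s \<ge> 0" for q s
    using ode_gronwall(1)[OF lipschitz solution[OF that(1)] solution[OF z(2)] that(2)]
      norm_triangle_ineq[of "x q s - x p s" "x p s - x p t"] by (simp add: bound_def)
  then have "\<forall>\<^sub>F w in at z within I \<times> {0..}. norm ((\<lambda>(p, t). x p t) w - (\<lambda>(p, t). x p t) z) \<le> bound w"
    unfolding eventually_at_filter z(1) by (intro always_eventually) auto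
  ultimately have "((\<lambda>w. (\<lambda>(p, t). x p t) w - (\<lambda>(p, t). x p t) z) \<longlongrightarrow> 0) (at z within I \<times> {0..})"
    by (rule Lim_null_comparison[rotated])
  then show "((\<lambda>(p, t). x p t) \<longlongrightarrow> (\<lambda>(p, t). x p t) z) (at z within I \<times> {0..})"
    by (simp only: Lim_null[symmetric])
qed

section \<open>Real-analytic functions and their holomorphic extensions\<close>

lemma power_series_has_derivative:
  fixes f :: "real \<Rightarrow> real"
  assumes sums: "\<And>y. \<bar>y - x\<bar> < \<delta> \<Longrightarrow> (\<lambda>n. c n * (y - x) ^ n) sums f y"
    and y: "\<bar>y - x\<bar> < \<delta>"
  obtains D where "(f has_real_derivative D) (at y)" "(\<lambda>n. diffs c n * (y - x) ^ n) sums D"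
proof
  define F where "F = (\<lambda>z. f (x + z))"
  have F_sums: "(\<lambda>n. c n * z ^ n) sums F z" if "norm z < \<delta>" for z
    using sums[of "x + z"] that by (simp add: F_def)
  obtain K where K: "\<bar>y - x\<bar> < K" "K < \<delta>" using y dense by blast
  have "summable (\<lambda>n. c n * K ^ n)" using F_sums[of K] K by (auto simp: sums_iff)
  then have "((\<lambda>z. \<Sum>n. c n * z ^ n) has_real_derivative (\<Sum>n. diffs c n * (y - x) ^ n)) (at (y - x))"
    using K by (intro termdiffs_strong) auto
  then have F_deriv: "(F has_real_derivative (\<Sum>n. diffs c n * (y - x) ^ n)) (at (y - x))"
    by (rule has_field_derivative_transform_within_open[where S = "ball 0 \<delta>"])
      (use y F_sums in \<open>auto simp: sums_iff\<close>)
  show "(\<lambda>n. diffs c n * (y - x) ^ n) sums (\<Sum>n. diffs c n * (y - x) ^ n)"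
    by (rule termdiffs_sums_strong[OF F_sums F_deriv]) (use y in auto)
  have "((\<lambda>y. F (y - x)) has_real_derivative (\<Sum>n. diffs c n * (y - x) ^ n)) (at y)"
    using DERIV_shift[of F _ y "-x"] F_deriv by simp
  then show "(f has_real_derivative (\<Sum>n. diffs c n * (y - x) ^ n)) (at y)"
    by (simp add: F_def)
qed

lemma real_analytic_on_power_series:
  assumes "real_analytic_on f S" "x \<in> S"
  obtains \<delta> c where "\<delta> > 0" "\<And>y. \<bar>y - x\<bar> < \<delta> \<Longrightarrow> (\<lambda>n. c n * (y - x) ^ n) sums f y"
  using assms unfolding real_analytic_on_def by blast

lemma real_analytic_on_has_derivative:
  assumes "real_analytic_on f S" "x \<in> S"
  shows "(f has_real_derivative deriv f x) (at x)"
proof -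
  obtain \<delta> c where "\<delta> > 0" and sums: "\<And>y. \<bar>y - x\<bar> < \<delta> \<Longrightarrow> (\<lambda>n. c n * (y - x) ^ n) sums f y"
    by (rule real_analytic_on_power_series[OF assms]) (rule that)
  obtain D where "(f has_real_derivative D) (at x)"
    using power_series_has_derivative[where f = f and x = x and y = x, OF sums] \<open>\<delta> > 0\<close> by auto
  then show ?thesis by (simp add: DERIV_imp_deriv)
qed

lemma real_analytic_on_deriv:
  assumes "real_analytic_on f S"
  shows "real_analytic_on (deriv f) S"
  unfolding real_analytic_on_def
proof
  fix x assume "x \<in> S"
  obtain \<delta> c where "\<delta> > 0" and sums: "\<And>y. \<bar>y - x\<bar> < \<delta> \<Longrightarrow> (\<lambda>n. c n * (y - x) ^ n) sums f y"
    by (rule real_analytic_on_power_series[OF assms \<open>x \<in> S\<close>]) (rule that)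
  have "(\<lambda>n. diffs c n * (y - x) ^ n) sums deriv f y" if "\<bar>y - x\<bar> < \<delta>" for y
    by (rule power_series_has_derivative[OF sums that]) (simp_all add: DERIV_imp_deriv)
  then show "\<exists>\<delta>>0. \<exists>c. \<forall>y. \<bar>y - x\<bar> < \<delta> \<longrightarrow> (\<lambda>n. c n * (y - x) ^ n) sums deriv f y"
    using \<open>\<delta> > 0\<close> by blast
qed

lemma real_analytic_on_continuous_on: "real_analytic_on f S \<Longrightarrow> continuous_on S f"
  by (rule DERIV_continuous_on)
    (auto intro: real_analytic_on_has_derivative has_field_derivative_at_within)

lemma real_analytic_on_subset:
  "real_analytic_on f S \<Longrightarrow> T \<subseteq> S \<Longrightarrow> real_analytic_on f T"
  unfolding real_analytic_on_def by blast

lemma holomorphic_imp_real_analytic_on: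
  assumes holomorphic: "F holomorphic_on S" and "open S"
  shows "real_analytic_on (\<lambda>v. Re (F (of_real v))) {v. of_real v \<in> S}"
  unfolding real_analytic_on_def
proof
  fix x :: real assume "x \<in> {v. of_real v \<in> S}"
  then obtain \<delta> where "\<delta> > 0" and ball: "ball (complex_of_real x) \<delta> \<subseteq> S"
    using \<open>open S\<close> by (auto simp: open_contains_ball)
  define c where "c = (\<lambda>n. Re ((deriv ^^ n) F (of_real x) / fact n))"
  have "(\<lambda>n. c n * (y - x) ^ n) sums Re (F (of_real y))" if "\<bar>y - x\<bar> < \<delta>" for y
  proof -
    have "complex_of_real y \<in> ball (of_real x) \<delta>"
      using that by (simp add: dist_norm norm_minus_commute flip: of_real_diff)
    from holomorphic_power_series[OF holomorphic_on_subset[OF holomorphic ball] this]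
    have "(\<lambda>n. Re ((deriv ^^ n) F (of_real x) / fact n * (of_real y - of_real x) ^ n)) sums Re (F (of_real y))"
      by (rule sums_Re)
    moreover have "Re (A * (of_real y - of_real x) ^ n) = Re A * (y - x) ^ n" for A n
      by (simp flip: of_real_diff of_real_power)
    ultimately show ?thesis by (simp only: c_def)
  qed
  then show "\<exists>\<delta>>0. \<exists>c. \<forall>y. \<bar>y - x\<bar> < \<delta> \<longrightarrow> (\<lambda>n. c n * (y - x) ^ n) sums Re (F (of_real y))"
    using \<open>\<delta> > 0\<close> by blast
qed

lemma real_analytic_on_complexify:
  assumes "real_analytic_on g S" "x \<in> S"
  obtains \<delta> \<gamma> where "\<delta> > 0" "\<gamma> holomorphic_on ball (of_real x) \<delta>"
    "\<And>v. \<bar>v - x\<bar> < \<delta> \<Longrightarrow> \<gamma> (of_real v) = of_real (g v)"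
proof -
  obtain \<delta> c where "\<delta> > 0" and sums: "\<And>y. \<bar>y - x\<bar> < \<delta> \<Longrightarrow> (\<lambda>n. c n * (y - x) ^ n) sums g y"
    by (rule real_analytic_on_power_series[OF assms]) (rule that)
  define \<gamma> where "\<gamma> = (\<lambda>z::complex. \<Sum>n. of_real (c n) * (z - of_real x) ^ n)"
  have "(\<lambda>n. of_real (c n) * (z - of_real x) ^ n) sums \<gamma> z" if "z \<in> ball (of_real x) \<delta>" for z
  proof -
    obtain v where v: "norm (z - of_real x) < v" "v < \<delta>"
      using \<open>z \<in> ball (of_real x) \<delta>\<close> dense[of "norm (z - of_real x)" \<delta>]
      by (auto simp: dist_norm norm_minus_commute)
    have "0 < v" using v(1) norm_ge_zero le_less_trans by blast
    have "summable (\<lambda>n. complex_of_real (c n * v ^ n))"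
      using sums[of "x + v"] v \<open>0 < v\<close> by (intro summable_of_real) (auto simp: sums_iff)
    then have "summable (\<lambda>n. of_real (c n) * (complex_of_real v) ^ n)" by simp
    then have "summable (\<lambda>n. of_real (c n) * (z - of_real x) ^ n)"
      by (rule powser_inside) (use v \<open>0 < v\<close> in simp)
    then show ?thesis by (simp add: \<gamma>_def summable_sums)
  qed
  then have "\<gamma> holomorphic_on ball (of_real x) \<delta>" by (rule power_series_holomorphic)
  moreover have "\<gamma> (of_real v) = of_real (g v)" if "\<bar>v - x\<bar> < \<delta>" for v
  proof -
    have "(\<lambda>n. complex_of_real (c n * (v - x) ^ n)) sums of_real (g v)"
      using sums[OF that] by (rule sums_of_real)
    then show ?thesis by (simp add: \<gamma>_def sums_iff)
  qed
  ultimately show thesis using \<open>\<delta> > 0\<close> that by blast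
qed

lemma has_real_derivative_Re_of_real:
  assumes "(F has_field_derivative D) (at (complex_of_real v))"
  shows "((\<lambda>x. Re (F (of_real x))) has_real_derivative Re D) (at v)"
  unfolding has_real_derivative_iff_has_vector_derivative
  by (rule bounded_linear.has_vector_derivative[OF bounded_linear_Re has_vector_derivative_real_field[OF assms]])

section \<open>The singular Euler operator\<close>

text \<open>Substituting \<open>t = z \<sigma>\<^sup>n\<close> in the variation-of-constants formula
  \<open>y(z) = z\<^sup>-\<^sup>1\<^sup>/\<^sup>n \<integral>\<^sub>0\<^sup>z t\<^sup>1\<^sup>/\<^sup>n\<^sup>-\<^sup>1 H(t) dt\<close> for \<open>z y' + y/n = H\<close> removes the singularity.\<close>

definition euler_inverse :: "nat \<Rightarrow> (complex \<Rightarrow> complex) \<Rightarrow> complex \<Rightarrow> complex" where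
  "euler_inverse n H z = of_nat n * integral {0..1} (\<lambda>\<sigma>. H (z * of_real (\<sigma> ^ n)))"

lemma norm_scale_power_less:
  assumes "norm (z::complex) < \<delta>" "\<sigma> \<in> {0..1}"
  shows "norm (z * of_real (\<sigma> ^ n)) < \<delta>"
proof -
  have "\<bar>\<sigma> ^ n\<bar> \<le> 1" using assms(2) by (simp add: power_le_one)
  then have "norm (z * of_real (\<sigma> ^ n)) \<le> norm z"
    unfolding norm_mult norm_of_real by (rule mult_right_le_one_le[rotated 2]) auto
  then show ?thesis using assms(1) by simp
qed

lemma continuous_on_scale_power:
  assumes "continuous_on (ball 0 \<delta>) H" "norm z < \<delta>"
  shows "continuous_on {0..1} (\<lambda>\<sigma>. H (z * complex_of_real (\<sigma> ^ n)))"
  by (rule continuous_on_compose2[OF assms(1)])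
    (use norm_scale_power_less[OF assms(2)] in \<open>auto intro!: continuous_intros\<close>)

lemma has_field_derivative_scale_power:
  assumes "H holomorphic_on ball 0 \<delta>" "norm z < \<delta>" "\<sigma> \<in> {0..1}"
  shows "(H has_field_derivative deriv H (z * of_real (\<sigma> ^ n))) (at (z * of_real (\<sigma> ^ n)))"
  by (rule holomorphic_derivI[OF assms(1) open_ball])
    (use norm_scale_power_less[OF assms(2,3)] in simp)

lemma euler_inverse_has_derivative:
  assumes H: "H holomorphic_on ball 0 \<delta>" and z: "norm z < \<delta>"
  shows "(euler_inverse n H has_field_derivative
    of_nat n * integral {0..1} (\<lambda>\<sigma>. deriv H (z * of_real (\<sigma> ^ n)) * of_real (\<sigma> ^ n))) (at z)"
proof -
  have deriv_continuous: "continuous_on (ball 0 \<delta>) (deriv H)"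
    by (intro holomorphic_on_imp_continuous_on holomorphic_deriv H) auto
  have "((\<lambda>x. integral (cbox 0 1) (\<lambda>\<sigma>. H (x * complex_of_real (\<sigma> ^ n)))) has_field_derivative
        integral (cbox 0 1) (\<lambda>\<sigma>. deriv H (z * of_real (\<sigma> ^ n)) * of_real (\<sigma> ^ n))) (at z within ball 0 \<delta>)"
  proof (rule leibniz_rule_field_derivative)
    fix x :: complex and \<sigma> :: real assume "x \<in> ball 0 \<delta>" "\<sigma> \<in> cbox 0 1"
    then have "(H has_field_derivative deriv H (x * of_real (\<sigma> ^ n))) (at (x * of_real (\<sigma> ^ n)))"
      by (intro has_field_derivative_scale_power[OF H]) auto
    then have "((\<lambda>x. H (x * of_real (\<sigma> ^ n))) has_field_derivative
        deriv H (x * of_real (\<sigma> ^ n)) * of_real (\<sigma> ^ n)) (at x)"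
      by (rule DERIV_chain2) (auto intro!: derivative_eq_intros)
    then show "((\<lambda>x. H (x * of_real (\<sigma> ^ n))) has_field_derivative
        deriv H (x * of_real (\<sigma> ^ n)) * of_real (\<sigma> ^ n)) (at x within ball 0 \<delta>)"
      by (rule has_field_derivative_at_within)
  next
    fix x :: complex assume "x \<in> ball 0 \<delta>"
    then show "(\<lambda>\<sigma>. H (x * complex_of_real (\<sigma> ^ n))) integrable_on cbox 0 1"
      using integrable_continuous_interval[OF continuous_on_scale_power[OF holomorphic_on_imp_continuous_on[OF H]]]
      by simp
  next
    have "continuous_on (ball 0 \<delta> \<times> cbox 0 1) (\<lambda>p. deriv H (fst p * complex_of_real (snd p ^ n)))"
      by (rule continuous_on_compose2[OF deriv_continuous])
        (use norm_scale_power_less[of _ \<delta>] in \<open>auto intro!: continuous_intros\<close>)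
    then show "continuous_on (ball 0 \<delta> \<times> cbox 0 1)
        (\<lambda>(x, \<sigma>). deriv H (x * complex_of_real (\<sigma> ^ n)) * of_real (\<sigma> ^ n))"
      unfolding split_beta by (intro continuous_intros)
  qed (use z in auto)
  then show ?thesis
    using z unfolding euler_inverse_def[abs_def]
    by (intro DERIV_cmult) (simp add: at_within_open[of z "ball 0 \<delta>"] box_real)
qed

lemma euler_inverse_holomorphic:
  "H holomorphic_on ball 0 \<delta> \<Longrightarrow> euler_inverse n H holomorphic_on ball 0 \<delta>"
  unfolding holomorphic_on_open[OF open_ball, of "euler_inverse n H"]
  using euler_inverse_has_derivative[of H \<delta> _ n] by (metis mem_ball_0)

lemma scale_power_primitive:
  assumes H: "H holomorphic_on ball 0 \<delta>" and z: "norm z < \<delta>" and "n > 0" and \<sigma>: "\<sigma> \<in> {0..1}"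
  shows "((\<lambda>\<sigma>. of_real \<sigma> * H (z * of_real (\<sigma> ^ n))) has_vector_derivative
    H (z * of_real (\<sigma> ^ n)) + of_nat n * z * (deriv H (z * of_real (\<sigma> ^ n)) * of_real (\<sigma> ^ n)))
    (at \<sigma> within {0..1})"
proof -
  define F where "F = (\<lambda>w. w * H (z * w ^ n))"
  define h where "h = deriv H (z * of_real \<sigma> ^ n)"
  have "(H has_field_derivative h) (at (z * of_real \<sigma> ^ n))"
    using has_field_derivative_scale_power[OF H z \<sigma>, of n] by (simp add: h_def)
  then have "((\<lambda>w. H (z * w ^ n)) has_field_derivative
      h * (z * (of_nat n * of_real \<sigma> ^ (n - 1)))) (at (of_real \<sigma>))"
    by (rule DERIV_chain2) (auto intro!: derivative_eq_intros)
  then have "(F has_field_derivative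
      H (z * of_real \<sigma> ^ n) + of_real \<sigma> * (h * (z * (of_nat n * of_real \<sigma> ^ (n - 1))))) (at (of_real \<sigma>))"
    unfolding F_def by (auto intro!: derivative_eq_intros)
  also have "of_real \<sigma> * (h * (z * (of_nat n * of_real \<sigma> ^ (n - 1)))) = of_nat n * z * (h * of_real \<sigma> ^ n)"
    using power_minus_mult[OF \<open>n > 0\<close>, of "complex_of_real \<sigma>"] by (simp add: mult_ac)
  finally show ?thesis
    using has_vector_derivative_real_field[of F _ \<sigma>] by (simp add: F_def h_def)
qed

lemma euler_inverse_ode:
  assumes H: "H holomorphic_on ball 0 \<delta>" and z: "norm z < \<delta>" and "n > 0"
  shows "z * deriv (euler_inverse n H) z + euler_inverse n H z / of_nat n = H z"
proof -
  have H_continuous: "continuous_on (ball 0 \<delta>) H"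
    and deriv_continuous: "continuous_on (ball 0 \<delta>) (deriv H)"
    by (intro holomorphic_on_imp_continuous_on holomorphic_deriv H open_ball)+
  define I where "I = integral {0..1} (\<lambda>\<sigma>. H (z * of_real (\<sigma> ^ n)))"
  define J where "J = integral {0..1} (\<lambda>\<sigma>. deriv H (z * of_real (\<sigma> ^ n)) * of_real (\<sigma> ^ n))"
  have "((\<lambda>\<sigma>. H (z * of_real (\<sigma> ^ n)) + of_nat n * z * (deriv H (z * of_real (\<sigma> ^ n)) * of_real (\<sigma> ^ n)))
      has_integral of_real 1 * H (z * of_real (1 ^ n)) - of_real 0 * H (z * of_real (0 ^ n))) {0..1}"
    by (rule fundamental_theorem_of_calculus[OF zero_le_one scale_power_primitive[OF H z \<open>n > 0\<close>]])
  moreover have "((\<lambda>\<sigma>. H (z * of_real (\<sigma> ^ n)) + of_nat n * z * (deriv H (z * of_real (\<sigma> ^ n)) * of_real (\<sigma> ^ n)))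
      has_integral I + of_nat n * z * J) {0..1}"
    unfolding I_def J_def
    by (intro has_integral_add has_integral_mult_right integrable_integral integrable_continuous_interval
        continuous_intros continuous_on_scale_power[OF _ z] H_continuous deriv_continuous)
  ultimately have "I + of_nat n * z * J = of_real 1 * H (z * of_real (1 ^ n)) - of_real 0 * H (z * of_real (0 ^ n))"
    by (rule has_integral_unique[rotated])
  moreover have "deriv (euler_inverse n H) z = of_nat n * J"
    unfolding J_def using euler_inverse_has_derivative[OF H z] by (rule DERIV_imp_deriv)
  moreover have "euler_inverse n H z = of_nat n * I" by (simp add: euler_inverse_def I_def)
  ultimately show ?thesis using \<open>n > 0\<close> by (simp add: algebra_simps)
qed

lemma euler_inverse_const: "euler_inverse n (\<lambda>_. c) z = of_nat n * c"
  by (simp add: euler_inverse_def)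

lemma euler_inverse_diff_bound:
  assumes H: "continuous_on (ball 0 \<delta>) H" and K: "continuous_on (ball 0 \<delta>) K" and z: "norm z < \<delta>"
    and bound: "\<And>w. norm w < \<delta> \<Longrightarrow> norm (H w - K w) \<le> e"
  shows "norm (euler_inverse n H z - euler_inverse n K z) \<le> of_nat n * e"
proof -
  note integrable = integrable_continuous_interval[OF continuous_on_scale_power[OF _ z]]
  have "norm (integral {0..1} (\<lambda>\<sigma>. H (z * of_real (\<sigma> ^ n)) - K (z * of_real (\<sigma> ^ n))))
      \<le> integral {0..1::real} (\<lambda>\<sigma>. e)"
    by (rule integral_norm_bound_integral)
      (use bound norm_scale_power_less[OF z] integrable[OF H] integrable[OF K]
        in \<open>auto intro!: integrable_diff\<close>)
  then have "norm (integral {0..1} (\<lambda>\<sigma>. H (z * of_real (\<sigma> ^ n))) - integral {0..1} (\<lambda>\<sigma>. K (z * of_real (\<sigma> ^ n)))) \<le> e"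
    by (subst integral_diff[symmetric]) (use integrable[OF H] integrable[OF K] in simp_all)
  then show ?thesis
    unfolding euler_inverse_def right_diff_distrib[symmetric] norm_mult norm_of_nat
    by (intro mult_left_mono) auto
qed

lemma euler_inverse_Reals:
  assumes H: "continuous_on (ball 0 \<delta>) H" and v: "\<bar>v\<bar> < \<delta>"
    and real: "\<And>u. \<bar>u\<bar> < \<delta> \<Longrightarrow> H (of_real u) \<in> \<real>"
  shows "euler_inverse n H (of_real v) \<in> \<real>"
proof -
  have v': "norm (complex_of_real v) < \<delta>" using v by simp
  have "Im (integral {0..1} (\<lambda>\<sigma>. H (of_real v * of_real (\<sigma> ^ n))))
      = integral {0..1} (Im \<circ> (\<lambda>\<sigma>. H (of_real v * of_real (\<sigma> ^ n))))"
    by (rule integral_linear[symmetric, OF integrable_continuous_interval bounded_linear_Im])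
      (rule continuous_on_scale_power[OF H v'])
  also have "\<dots> = integral {0..1} (\<lambda>\<sigma>::real. 0::real)"
  proof (rule integral_cong)
    fix \<sigma> :: real assume "\<sigma> \<in> {0..1}"
    then have "\<bar>v * \<sigma> ^ n\<bar> < \<delta>"
      using norm_scale_power_less[OF v', of \<sigma> n] by (simp add: norm_mult abs_mult norm_power power_abs)
    from real[OF this] show "(Im \<circ> (\<lambda>\<sigma>. H (of_real v * of_real (\<sigma> ^ n)))) \<sigma> = 0"
      by (simp add: complex_is_Real_iff)
  qed
  finally show ?thesis by (simp add: euler_inverse_def complex_is_Real_iff)
qed

section \<open>Contractions of holomorphic functions\<close>

definition real_holomorphic_near :: "real \<Rightarrow> complex \<Rightarrow> real \<Rightarrow> (complex \<Rightarrow> complex) set" where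
  "real_holomorphic_near \<delta> c \<epsilon> = {\<phi>. \<phi> holomorphic_on ball 0 \<delta> \<and>
     (\<forall>z. norm z < \<delta> \<longrightarrow> norm (\<phi> z - c) \<le> \<epsilon>) \<and> (\<forall>v. \<bar>v\<bar> < \<delta> \<longrightarrow> \<phi> (of_real v) \<in> \<real>)}"

lemma real_holomorphic_nearD:
  assumes "\<phi> \<in> real_holomorphic_near \<delta> c \<epsilon>"
  shows "\<phi> holomorphic_on ball 0 \<delta>" "norm z < \<delta> \<Longrightarrow> norm (\<phi> z - c) \<le> \<epsilon>"
    "\<bar>v\<bar> < \<delta> \<Longrightarrow> \<phi> (of_real v) \<in> \<real>"
  using assms by (auto simp: real_holomorphic_near_def)

lemma real_holomorphic_near_uniform_limit:
  assumes f: "\<And>n. f n \<in> real_holomorphic_near \<delta> c \<epsilon>"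
    and limit: "uniform_limit (ball 0 \<delta>) f \<phi> sequentially"
  shows "\<phi> \<in> real_holomorphic_near \<delta> c \<epsilon>"
  unfolding real_holomorphic_near_def
proof (intro CollectI conjI allI impI)
  have pointwise: "(\<lambda>n. f n z) \<longlonglongrightarrow> \<phi> z" if "norm z < \<delta>" for z
    using tendsto_uniform_limitI[OF limit, of z] that by simp
  show "\<phi> holomorphic_on ball 0 \<delta>"
  proof (rule holomorphic_uniform_sequence[OF open_ball real_holomorphic_nearD(1)[OF f]])
    fix x :: complex assume "x \<in> ball 0 \<delta>"
    then obtain d where "d > 0" "cball x d \<subseteq> ball 0 \<delta>"
      using open_contains_cball[of "ball 0 \<delta>"] open_ball by blast
    then show "\<exists>d>0. cball x d \<subseteq> ball 0 \<delta> \<and> uniform_limit (cball x d) f \<phi> sequentially"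
      using uniform_limit_on_subset[OF limit] by blast
  qed
  show "norm (\<phi> z - c) \<le> \<epsilon>" if "norm z < \<delta>" for z
    by (rule tendsto_upperbound[OF tendsto_norm[OF tendsto_diff[OF pointwise[OF that] tendsto_const]]])
      (use real_holomorphic_nearD(2)[OF f that] in auto)
  show "\<phi> (of_real v) \<in> \<real>" if "\<bar>v\<bar> < \<delta>" for v
    by (rule closed_sequentially[OF closed_complex_Reals _ pointwise])
      (use real_holomorphic_nearD(3)[OF f that] that in auto)
qed

lemma geometric_uniform_limit:
  fixes f :: "nat \<Rightarrow> 'a \<Rightarrow> 'b::banach"
  assumes step: "\<And>n x. x \<in> S \<Longrightarrow> norm (f (Suc n) x - f n x) \<le> C * q ^ n" and q: "0 \<le> q" "q < 1"
  obtains \<phi> where "uniform_limit S f \<phi> sequentially"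
proof -
  have "uniform_limit S (\<lambda>n x. \<Sum>i<n. f (Suc i) x - f i x) (\<lambda>x. \<Sum>i. f (Suc i) x - f i x) sequentially"
  proof (rule Weierstrass_m_test)
    show "summable (\<lambda>n. C * q ^ n)" using q by (intro summable_mult summable_geometric) simp
  qed (rule step)
  then have "uniform_limit S (\<lambda>n x. f 0 x + (\<Sum>i<n. f (Suc i) x - f i x))
      (\<lambda>x. f 0 x + (\<Sum>i. f (Suc i) x - f i x)) sequentially"
    by (intro uniform_limit_intros)
  then show thesis using that by (simp add: sum_lessThan_telescope[of "\<lambda>i. f i _"])
qed

lemma uniform_limit_fixpoint:
  assumes limit: "uniform_limit S f \<phi> sequentially"
    and iterate: "\<And>n x. x \<in> S \<Longrightarrow> f (Suc n) x = T (f n) x" and q: "0 \<le> q" "q < 1"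
    and contraction: "\<And>n d x. \<lbrakk>\<And>y. y \<in> S \<Longrightarrow> norm (f n y - \<phi> y) \<le> d; x \<in> S\<rbrakk> \<Longrightarrow> norm (T (f n) x - T \<phi> x) \<le> q * d"
    and x: "x \<in> S"
  shows "T \<phi> x = \<phi> x"
proof (rule LIMSEQ_unique)
  show "(\<lambda>n. f (Suc n) x) \<longlonglongrightarrow> \<phi> x"
    by (rule LIMSEQ_Suc[OF tendsto_uniform_limitI[OF limit x]])
  show "(\<lambda>n. f (Suc n) x) \<longlonglongrightarrow> T \<phi> x"
  proof (rule metric_LIMSEQ_I)
    fix e :: real assume "e > 0"
    then obtain N where N: "\<And>n y. n \<ge> N \<Longrightarrow> y \<in> S \<Longrightarrow> dist (f n y) (\<phi> y) < e"
      using uniform_limitD[OF limit] unfolding eventually_sequentially by metis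
    have "dist (f (Suc n) x) (T \<phi> x) < e" if "n \<ge> N" for n
    proof -
      have "norm (T (f n) x - T \<phi> x) \<le> q * e"
        by (rule contraction[OF _ x]) (use N[OF that] in \<open>auto simp: dist_norm less_imp_le\<close>)
      also have "q * e < e" using q \<open>e > 0\<close> by simp
      finally show ?thesis by (simp add: dist_norm iterate[OF x])
    qed
    then show "\<exists>N. \<forall>n\<ge>N. dist (f (Suc n) x) (T \<phi> x) < e" by blast
  qed
qed

theorem real_holomorphic_contraction_fixpoint:
  assumes c: "c \<in> \<real>" and q: "0 \<le> q" "q < 1" and "0 \<le> \<epsilon>"
    and self_map: "\<And>\<phi>. \<phi> \<in> real_holomorphic_near \<delta> c \<epsilon> \<Longrightarrow> T \<phi> \<in> real_holomorphic_near \<delta> c \<epsilon>"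
    and contraction: "\<And>\<phi> \<psi> d z. \<lbrakk>\<phi> \<in> real_holomorphic_near \<delta> c \<epsilon>; \<psi> \<in> real_holomorphic_near \<delta> c \<epsilon>;
      \<And>w. norm w < \<delta> \<Longrightarrow> norm (\<phi> w - \<psi> w) \<le> d; norm z < \<delta>\<rbrakk> \<Longrightarrow> norm (T \<phi> z - T \<psi> z) \<le> q * d"
  obtains \<phi> where "\<phi> \<in> real_holomorphic_near \<delta> c \<epsilon>" "\<And>z. norm z < \<delta> \<Longrightarrow> T \<phi> z = \<phi> z"
proof -
  define f where "f = (\<lambda>n. (T ^^ n) (\<lambda>_. c))"
  have f_near: "f n \<in> real_holomorphic_near \<delta> c \<epsilon>" for n
  proof (induction n)
    case 0
    show ?case using c \<open>0 \<le> \<epsilon>\<close> by (auto simp: f_def real_holomorphic_near_def)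
  next
    case (Suc n)
    then show ?case using self_map by (simp add: f_def)
  qed
  have "norm (f (Suc n) z - f n z) \<le> \<epsilon> * q ^ n" if "norm z < \<delta>" for n z
    using that
  proof (induction n arbitrary: z)
    case 0
    then show ?case using real_holomorphic_nearD(2)[OF f_near[of 1]] by (simp add: f_def)
  next
    case (Suc n)
    have "norm (T (f (Suc n)) z - T (f n) z) \<le> q * (\<epsilon> * q ^ n)"
      by (rule contraction[OF f_near f_near Suc])
    then show ?case by (simp add: f_def mult_ac)
  qed
  then obtain \<phi> where limit: "uniform_limit (ball 0 \<delta>) f \<phi> sequentially"
    using geometric_uniform_limit[of "ball 0 \<delta>" f \<epsilon> q] q by auto
  have \<phi>_near: "\<phi> \<in> real_holomorphic_near \<delta> c \<epsilon>"
    by (rule real_holomorphic_near_uniform_limit[OF f_near limit])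
  have "T \<phi> z = \<phi> z" if z: "norm z < \<delta>" for z
  proof (rule uniform_limit_fixpoint[OF limit _ q])
    show "f (Suc n) w = T (f n) w" for n w by (simp add: f_def)
    show "norm (T (f n) w - T \<phi> w) \<le> q * d"
      if "\<And>y. y \<in> ball 0 \<delta> \<Longrightarrow> norm (f n y - \<phi> y) \<le> d" "w \<in> ball 0 \<delta>" for n d w
      by (rule contraction[OF f_near \<phi>_near]) (use that in auto)
  qed (use z in simp)
  then show thesis using \<phi>_near that by blast
qed

lemma self_improving_bound:
  fixes h :: "'a \<Rightarrow> real"
  assumes bounded: "\<And>x. x \<in> S \<Longrightarrow> h x \<le> M" and "q < 1"
    and improve: "\<And>d x. (\<And>y. y \<in> S \<Longrightarrow> h y \<le> d) \<Longrightarrow> x \<in> S \<Longrightarrow> h x \<le> q * d + \<Delta>" and x: "x \<in> S"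
  shows "h x \<le> \<Delta> / (1 - q)"
proof -
  define d where "d = Sup (h ` S)"
  have le_d: "h y \<le> d" if "y \<in> S" for y
    unfolding d_def using that bounded by (intro cSup_upper) (auto intro!: bdd_aboveI)
  have "d \<le> q * d + \<Delta>"
    unfolding d_def using x improve[OF le_d] by (intro cSup_least) (auto simp: d_def)
  then have "d \<le> \<Delta> / (1 - q)" using \<open>q < 1\<close> by (simp add: field_simps)
  then show ?thesis using le_d[OF x] by linarith
qed

section \<open>The analytic solution at the tip\<close>

lemma norm_csqrt_diff_le:
  assumes "1 \<le> Re (csqrt a) + Re (csqrt b)"
  shows "norm (csqrt a - csqrt b) \<le> norm (a - b)"
proof -
  have "(csqrt a - csqrt b) * (csqrt a + csqrt b) = a - b"
    using power2_csqrt[of a] power2_csqrt[of b] by (simp add: algebra_simps power2_eq_square)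
  then have "norm (csqrt a - csqrt b) * norm (csqrt a + csqrt b) = norm (a - b)"
    by (metis norm_mult)
  moreover have "1 \<le> norm (csqrt a + csqrt b)"
    using assms complex_Re_le_cmod[of "csqrt a + csqrt b"] by (simp del: csqrt.sel)
  then have "norm (csqrt a - csqrt b) * 1 \<le> norm (csqrt a - csqrt b) * norm (csqrt a + csqrt b)"
    by (intro mult_left_mono) auto
  ultimately show ?thesis by simp
qed

lemma norm_near_third:
  assumes "norm (w - 1/3 :: complex) \<le> 1/24"
  shows "norm w \<le> 3/8"
  using norm_triangle_ineq[of "w - 1/3" "1/3"] assms by (simp add: norm_divide)

lemma norm_power2_diff_near_third:
  fixes w w' :: complex
  assumes "norm (w - 1/3) \<le> 1/24" "norm (w' - 1/3) \<le> 1/24"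
  shows "norm (w\<^sup>2 - w'\<^sup>2) \<le> 3/4 * norm (w - w')"
proof -
  have "norm (w + w') \<le> 3/4"
    using norm_triangle_ineq[of w w'] assms[THEN norm_near_third] by linarith
  then have "norm (w + w') * norm (w - w') \<le> 3/4 * norm (w - w')" by (rule mult_right_mono) simp
  moreover have "w\<^sup>2 - w'\<^sup>2 = (w + w') * (w - w')" by (simp add: algebra_simps power2_eq_square)
  ultimately show ?thesis by (simp add: norm_mult)
qed

lemma csqrt_near_one:
  fixes z w :: complex
  assumes z: "norm z \<le> 1/24" and w: "norm (w - 1/3) \<le> 1/24"
  shows "norm (csqrt (1 - z * w\<^sup>2) - 1) \<le> norm z / 4" "1/2 \<le> Re (csqrt (1 - z * w\<^sup>2))"
    "1 - z * w\<^sup>2 \<notin> \<real>\<^sub>\<le>\<^sub>0"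
proof -
  have "(norm w)\<^sup>2 \<le> (3/8)\<^sup>2" using norm_near_third[OF w] by (intro power_mono) auto
  then have "norm z * (norm w)\<^sup>2 \<le> norm z * (1/4)" by (intro mult_left_mono) (auto simp: power2_eq_square)
  then have zw: "norm (z * w\<^sup>2) \<le> norm z / 4" by (simp add: norm_mult norm_power)
  have "norm (csqrt (1 - z * w\<^sup>2) - csqrt 1) \<le> norm (1 - z * w\<^sup>2 - 1)"
    by (rule norm_csqrt_diff_le) (use Re_csqrt[of "1 - z * w\<^sup>2"] in \<open>simp del: csqrt.sel\<close>)
  also have "\<dots> \<le> norm z / 4" using zw by simp
  finally show near: "norm (csqrt (1 - z * w\<^sup>2) - 1) \<le> norm z / 4" by simp
  show "1/2 \<le> Re (csqrt (1 - z * w\<^sup>2))"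
    using abs_Re_le_cmod[of "csqrt (1 - z * w\<^sup>2) - 1"] near z by (simp del: csqrt.sel)
  show "1 - z * w\<^sup>2 \<notin> \<real>\<^sub>\<le>\<^sub>0"
    using abs_Re_le_cmod[of "z * w\<^sup>2"] zw z by (auto simp: complex_nonpos_Reals_iff)
qed

text \<open>With \<open>w = \<eta>\<close> and \<open>z = v\<close>, \<open>tip_drive\<close> is \<open>\<beta> v g(v) + \<rho>\<close> and the equation for \<open>\<eta>\<close> reads
  \<open>z w' + w/4 = tip_rhs \<beta> z w\<close>. The derivative of \<open>tip_rhs\<close> in \<open>w\<close> vanishes at
  \<open>(z, w) = (0, 1/3)\<close>, which makes \<open>tip_step\<close> contract near this point.\<close>

locale tip_equation =
  fixes g :: "real \<Rightarrow> real" and \<gamma> :: "complex \<Rightarrow> complex" and \<delta> B :: real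
  assumes radius_pos: "0 < \<delta>" and radius_le: "\<delta> \<le> 1/24" and B_ge_1: "1 \<le> B"
    and extension_holomorphic: "\<gamma> holomorphic_on ball 0 \<delta>"
    and extension_real: "\<bar>v\<bar> < \<delta> \<Longrightarrow> \<gamma> (of_real v) = of_real (g v)"
    and extension_small: "norm z < \<delta> \<Longrightarrow> B * norm (z * \<gamma> z) \<le> 1/48"
begin

definition tip_drive :: "real \<Rightarrow> complex \<Rightarrow> complex \<Rightarrow> complex" where
  "tip_drive \<beta> z w = of_real \<beta> * (z * \<gamma> z) + csqrt (1 - z * w\<^sup>2)"

definition tip_rhs :: "real \<Rightarrow> complex \<Rightarrow> complex \<Rightarrow> complex" where
  "tip_rhs \<beta> z w = w / 2 - 3/4 * w\<^sup>2 * tip_drive \<beta> z w"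

definition tip_step :: "real \<Rightarrow> (complex \<Rightarrow> complex) \<Rightarrow> complex \<Rightarrow> complex" where
  "tip_step \<beta> \<phi> = euler_inverse 4 (\<lambda>z. tip_rhs \<beta> z (\<phi> z))"

abbreviation tip_profiles :: "(complex \<Rightarrow> complex) set" where
  "tip_profiles \<equiv> real_holomorphic_near \<delta> (1/3) (1/24)"

lemma tip_drive_near_one:
  assumes \<beta>: "\<beta> \<in> {0..B}" and z: "norm z < \<delta>" and w: "norm (w - 1/3) \<le> 1/24"
  shows "norm (tip_drive \<beta> z w - 1) \<le> 1/32"
proof -
  have "norm (of_real \<beta> * (z * \<gamma> z)) \<le> B * norm (z * \<gamma> z)"
    unfolding norm_mult using \<beta> by (intro mult_right_mono) auto
  moreover have "norm (csqrt (1 - z * w\<^sup>2) - 1) \<le> norm z / 4"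
    by (rule csqrt_near_one) (use z radius_le w in auto)
  moreover have "norm (tip_drive \<beta> z w - 1) \<le> norm (of_real \<beta> * (z * \<gamma> z)) + norm (csqrt (1 - z * w\<^sup>2) - 1)"
    using norm_triangle_ineq[of "of_real \<beta> * (z * \<gamma> z)" "csqrt (1 - z * w\<^sup>2) - 1"]
    by (simp add: tip_drive_def add_diff_eq)
  ultimately show ?thesis using extension_small[OF z] z radius_le by linarith
qed

lemma tip_drive_lipschitz:
  assumes z: "norm z < \<delta>" and w: "norm (w - 1/3) \<le> 1/24" and w': "norm (w' - 1/3) \<le> 1/24"
  shows "norm (tip_drive \<beta> z w - tip_drive \<beta>' z w') \<le> \<bar>\<beta> - \<beta>'\<bar> + 1/32 * norm (w - w')"
proof -
  have "1 * norm (z * \<gamma> z) \<le> B * norm (z * \<gamma> z)" using B_ge_1 by (intro mult_right_mono) auto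
  then have "norm (z * \<gamma> z) \<le> 1" using extension_small[OF z] by simp
  then have "norm (of_real (\<beta> - \<beta>') * (z * \<gamma> z)) \<le> \<bar>\<beta> - \<beta>'\<bar> * 1"
    unfolding norm_mult[of "of_real (\<beta> - \<beta>')"] norm_of_real by (rule mult_left_mono) simp
  moreover have "norm (csqrt (1 - z * w\<^sup>2) - csqrt (1 - z * w'\<^sup>2)) \<le> 1/32 * norm (w - w')"
  proof -
    have "1 \<le> Re (csqrt (1 - z * w\<^sup>2)) + Re (csqrt (1 - z * w'\<^sup>2))"
      using csqrt_near_one(2)[OF _ w, of z] csqrt_near_one(2)[OF _ w', of z] z radius_le by linarith
    then have "norm (csqrt (1 - z * w\<^sup>2) - csqrt (1 - z * w'\<^sup>2)) \<le> norm (- z * (w\<^sup>2 - w'\<^sup>2))"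
      using norm_csqrt_diff_le by (fastforce simp: algebra_simps)
    also have "\<dots> \<le> 1/24 * (3/4 * norm (w - w'))"
      unfolding norm_mult norm_minus_cancel using z radius_le norm_power2_diff_near_third[OF w w']
      by (intro mult_mono) auto
    finally show ?thesis by simp
  qed
  moreover have "tip_drive \<beta> z w - tip_drive \<beta>' z w' =
      of_real (\<beta> - \<beta>') * (z * \<gamma> z) + (csqrt (1 - z * w\<^sup>2) - csqrt (1 - z * w'\<^sup>2))"
    by (simp add: tip_drive_def algebra_simps)
  ultimately show ?thesis
    using norm_triangle_ineq[of "of_real (\<beta> - \<beta>') * (z * \<gamma> z)"
        "csqrt (1 - z * w\<^sup>2) - csqrt (1 - z * w'\<^sup>2)"] by simp
qed

lemma tip_rhs_near:
  assumes "\<beta> \<in> {0..B}" "norm z < \<delta>" "norm (w - 1/3) \<le> 1/24"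
  shows "norm (tip_rhs \<beta> z w - 1/12) \<le> 1/96"
proof -
  have "tip_rhs \<beta> z w - 1/12 = - (3/4 * (w - 1/3)\<^sup>2) - 3/4 * (w\<^sup>2 * (tip_drive \<beta> z w - 1))"
    by (simp add: tip_rhs_def field_simps power2_eq_square)
  also have "norm \<dots> \<le> 3/4 * (norm (w - 1/3))\<^sup>2 + 3/4 * ((norm w)\<^sup>2 * norm (tip_drive \<beta> z w - 1))"
    using norm_triangle_ineq4[of "- (3/4 * (w - 1/3)\<^sup>2)" "3/4 * (w\<^sup>2 * (tip_drive \<beta> z w - 1))"]
    by (simp add: norm_mult norm_power)
  also have "\<dots> \<le> 3/4 * (1/24)\<^sup>2 + 3/4 * ((3/8)\<^sup>2 * (1/32))"
    using tip_drive_near_one[OF assms] norm_near_third assms(3)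
    by (intro add_mono mult_mono power_mono) auto
  also have "\<dots> \<le> 1/96" by (simp add: power2_eq_square)
  finally show ?thesis .
qed

lemma tip_rhs_lipschitz:
  assumes \<beta>: "\<beta> \<in> {0..B}" and z: "norm z < \<delta>"
    and w: "norm (w - 1/3) \<le> 1/24" and w': "norm (w' - 1/3) \<le> 1/24"
  shows "norm (tip_rhs \<beta> z w - tip_rhs \<beta>' z w') \<le> 1/8 * norm (w - w') + 1/4 * \<bar>\<beta> - \<beta>'\<bar>"
proof -
  define d where "d = norm (w - w')"
  define e where "e = \<bar>\<beta> - \<beta>'\<bar>"
  define linear where "linear = (w - w') * (- 3 * ((w - 1/3) + (w' - 1/3)))"
  define quadratic where "quadratic = 3 * ((w\<^sup>2 - w'\<^sup>2) * (tip_drive \<beta> z w - 1))"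
  define drive where "drive = 3 * (w'\<^sup>2 * (tip_drive \<beta> z w - tip_drive \<beta>' z w'))"
  have "norm ((w - 1/3) + (w' - 1/3)) \<le> 1/12"
    using norm_triangle_ineq[of "w - 1/3" "w' - 1/3"] w w' by linarith
  then have "norm linear \<le> d * (3 * (1/12))"
    unfolding linear_def norm_mult d_def by (intro mult_left_mono) auto
  then have "norm linear \<le> 1/4 * d" by simp
  moreover have "norm quadratic \<le> 3 * ((3/4 * d) * (1/32))"
    unfolding quadratic_def norm_mult d_def
    using norm_power2_diff_near_third[OF w w'] tip_drive_near_one[OF \<beta> z w] by (intro mult_mono) auto
  then have "norm quadratic \<le> 9/128 * d" by simp
  moreover have "norm drive \<le> 3 * ((3/8)\<^sup>2 * (e + 1/32 * d))"
    unfolding drive_def norm_mult norm_power d_def e_def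
    using norm_near_third[OF w'] tip_drive_lipschitz[OF z w w'] by (intro mult_mono power_mono) auto
  then have "norm drive \<le> 27/64 * e + 27/2048 * d" by (simp add: power2_eq_square)
  moreover have "4 * (tip_rhs \<beta> z w - tip_rhs \<beta>' z w') = linear - quadratic - drive"
    by (simp add: tip_rhs_def linear_def quadratic_def drive_def field_simps power2_eq_square)
  then have "4 * norm (tip_rhs \<beta> z w - tip_rhs \<beta>' z w') = norm (linear - quadratic - drive)"
    by (metis norm_mult norm_numeral)
  then have "4 * norm (tip_rhs \<beta> z w - tip_rhs \<beta>' z w') \<le> norm linear + norm quadratic + norm drive"
    using norm_triangle_ineq4[of "linear - quadratic" drive] norm_triangle_ineq4[of linear quadratic]
    by linarith
  moreover have "0 \<le> d" "0 \<le> e" by (auto simp: d_def e_def)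
  ultimately show ?thesis unfolding d_def[symmetric] e_def[symmetric] by linarith
qed

lemma csqrt_tip_of_real:
  assumes "\<bar>v\<bar> < \<delta>" "\<bar>y - 1/3\<bar> \<le> 1/24"
  shows "0 < 1 - v * y\<^sup>2"
    and "csqrt (1 - of_real v * (of_real y)\<^sup>2) = of_real (sqrt (1 - v * y\<^sup>2))"
proof -
  have "\<bar>y\<bar> \<le> 1" using assms(2) by linarith
  then have "\<bar>v\<bar> * y\<^sup>2 \<le> 1/24 * 1"
    using assms(1) radius_le by (intro mult_mono) (auto simp: abs_square_le_1)
  then show "0 < 1 - v * y\<^sup>2" using abs_le_D1[of "v * y\<^sup>2" "1/24"] by (simp add: abs_mult)
  then have "csqrt (of_real (1 - v * y\<^sup>2)) = of_real (sqrt (1 - v * y\<^sup>2))" by simp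
  then show "csqrt (1 - of_real v * (of_real y)\<^sup>2) = of_real (sqrt (1 - v * y\<^sup>2))" by simp
qed

lemma tip_rhs_Reals:
  assumes v: "\<bar>v\<bar> < \<delta>" and w: "w \<in> \<real>" "norm (w - 1/3) \<le> 1/24"
  shows "tip_rhs \<beta> (of_real v) w \<in> \<real>"
proof -
  obtain y where y: "w = of_real y" using w(1) by (auto elim: Reals_cases)
  have "norm (complex_of_real (y - 1/3)) = \<bar>y - 1/3\<bar>" by (rule norm_of_real)
  then have "\<bar>y - 1/3\<bar> \<le> 1/24" using w(2) by (simp add: y)
  then show ?thesis
    by (simp add: tip_rhs_def tip_drive_def y extension_real[OF v] csqrt_tip_of_real(2)[OF v])
qed

lemma tip_rhs_holomorphic:
  assumes "\<phi> \<in> tip_profiles"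
  shows "(\<lambda>z. tip_rhs \<beta> z (\<phi> z)) holomorphic_on ball 0 \<delta>"
  unfolding tip_rhs_def tip_drive_def
  by (intro holomorphic_intros extension_holomorphic real_holomorphic_nearD(1)[OF assms]
      csqrt_near_one(3) real_holomorphic_nearD(2)[OF assms]) (use radius_le in auto)

lemmas tip_rhs_continuous = holomorphic_on_imp_continuous_on[OF tip_rhs_holomorphic]

lemma tip_step_profile:
  assumes \<beta>: "\<beta> \<in> {0..B}" and \<phi>: "\<phi> \<in> tip_profiles"
  shows "tip_step \<beta> \<phi> \<in> tip_profiles"
  unfolding real_holomorphic_near_def
proof (intro CollectI conjI allI impI)
  show "tip_step \<beta> \<phi> holomorphic_on ball 0 \<delta>"
    unfolding tip_step_def by (intro euler_inverse_holomorphic tip_rhs_holomorphic \<phi>)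
  show "norm (tip_step \<beta> \<phi> z - 1/3) \<le> 1/24" if z: "norm z < \<delta>" for z
  proof -
    have "norm (tip_step \<beta> \<phi> z - euler_inverse 4 (\<lambda>_. 1/12) z) \<le> of_nat 4 * (1/96)"
      unfolding tip_step_def
      by (rule euler_inverse_diff_bound[OF tip_rhs_continuous[OF \<phi>] continuous_on_const z])
        (intro tip_rhs_near \<beta> real_holomorphic_nearD(2)[OF \<phi>])
    then show ?thesis by (simp add: euler_inverse_const)
  qed
  show "tip_step \<beta> \<phi> (of_real v) \<in> \<real>" if "\<bar>v\<bar> < \<delta>" for v
    unfolding tip_step_def
    by (rule euler_inverse_Reals[OF tip_rhs_continuous[OF \<phi>] that])
      (use real_holomorphic_nearD(2,3)[OF \<phi>] in \<open>auto intro: tip_rhs_Reals\<close>)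
qed

lemma tip_step_lipschitz:
  assumes \<beta>: "\<beta> \<in> {0..B}" and \<phi>: "\<phi> \<in> tip_profiles" and \<psi>: "\<psi> \<in> tip_profiles"
    and dist: "\<And>w. norm w < \<delta> \<Longrightarrow> norm (\<phi> w - \<psi> w) \<le> d" and z: "norm z < \<delta>"
  shows "norm (tip_step \<beta> \<phi> z - tip_step \<beta>' \<psi> z) \<le> 1/2 * d + \<bar>\<beta> - \<beta>'\<bar>"
proof -
  have "norm (tip_step \<beta> \<phi> z - tip_step \<beta>' \<psi> z) \<le> of_nat 4 * (1/8 * d + 1/4 * \<bar>\<beta> - \<beta>'\<bar>)"
    unfolding tip_step_def
  proof (rule euler_inverse_diff_bound[OF tip_rhs_continuous[OF \<phi>] tip_rhs_continuous[OF \<psi>] z])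
    fix w :: complex assume w: "norm w < \<delta>"
    show "norm (tip_rhs \<beta> w (\<phi> w) - tip_rhs \<beta>' w (\<psi> w)) \<le> 1/8 * d + 1/4 * \<bar>\<beta> - \<beta>'\<bar>"
      using tip_rhs_lipschitz[OF \<beta> w real_holomorphic_nearD(2)[OF \<phi> w] real_holomorphic_nearD(2)[OF \<psi> w]]
        dist[OF w] by (fastforce elim: order_trans)
  qed
  then show ?thesis by simp
qed

definition tip_profile :: "real \<Rightarrow> complex \<Rightarrow> complex" where
  "tip_profile \<beta> = (SOME \<phi>. \<phi> \<in> tip_profiles \<and> (\<forall>z. norm z < \<delta> \<longrightarrow> tip_step \<beta> \<phi> z = \<phi> z))"

lemma
  assumes "\<beta> \<in> {0..B}"
  shows tip_profile_mem: "tip_profile \<beta> \<in> tip_profiles"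
    and tip_profile_fixpoint: "norm z < \<delta> \<Longrightarrow> tip_step \<beta> (tip_profile \<beta>) z = tip_profile \<beta> z"
proof -
  have "norm (tip_step \<beta> \<phi> z - tip_step \<beta> \<psi> z) \<le> 1/2 * d"
    if "\<phi> \<in> tip_profiles" "\<psi> \<in> tip_profiles" "\<And>w. norm w < \<delta> \<Longrightarrow> norm (\<phi> w - \<psi> w) \<le> d"
      "norm z < \<delta>" for \<phi> \<psi> d z
    using tip_step_lipschitz[OF assms that, of \<beta>] by simp
  then obtain \<phi> where "\<phi> \<in> tip_profiles" "\<And>z. norm z < \<delta> \<Longrightarrow> tip_step \<beta> \<phi> z = \<phi> z"
    by (rule real_holomorphic_contraction_fixpoint[where c = "1/3" and q = "1/2" and \<epsilon> = "1/24",
          rotated 5]) (use tip_step_profile[OF assms] in auto)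
  then have "\<exists>\<phi>. \<phi> \<in> tip_profiles \<and> (\<forall>z. norm z < \<delta> \<longrightarrow> tip_step \<beta> \<phi> z = \<phi> z)" by blast
  from someI_ex[OF this] show "tip_profile \<beta> \<in> tip_profiles"
    and "norm z < \<delta> \<Longrightarrow> tip_step \<beta> (tip_profile \<beta>) z = tip_profile \<beta> z"
    unfolding tip_profile_def[symmetric] by auto
qed

lemma tip_profile_lipschitz:
  assumes \<beta>: "\<beta> \<in> {0..B}" and \<beta>': "\<beta>' \<in> {0..B}" and z: "norm z < \<delta>"
  shows "norm (tip_profile \<beta> z - tip_profile \<beta>' z) \<le> 2 * \<bar>\<beta> - \<beta>'\<bar>"
proof -
  have "norm (tip_profile \<beta> z - tip_profile \<beta>' z) \<le> \<bar>\<beta> - \<beta>'\<bar> / (1 - 1/2)"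
  proof (rule self_improving_bound[where S = "ball 0 \<delta>" and M = "1/12"
        and h = "\<lambda>z. norm (tip_profile \<beta> z - tip_profile \<beta>' z)" and x = z])
    show "norm (tip_profile \<beta> w - tip_profile \<beta>' w) \<le> 1/12" if "w \<in> ball 0 \<delta>" for w
      using norm_triangle_ineq4[of "tip_profile \<beta> w - 1/3" "tip_profile \<beta>' w - 1/3"]
        real_holomorphic_nearD(2)[OF tip_profile_mem[OF \<beta>], of w]
        real_holomorphic_nearD(2)[OF tip_profile_mem[OF \<beta>'], of w] that by simp
    show "norm (tip_profile \<beta> w - tip_profile \<beta>' w) \<le> 1/2 * d + \<bar>\<beta> - \<beta>'\<bar>"
      if "\<And>y. y \<in> ball 0 \<delta> \<Longrightarrow> norm (tip_profile \<beta> y - tip_profile \<beta>' y) \<le> d" "w \<in> ball 0 \<delta>" for d w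
      using tip_step_lipschitz[OF \<beta> tip_profile_mem[OF \<beta>] tip_profile_mem[OF \<beta>'], of d w \<beta>'] that
      by (simp add: tip_profile_fixpoint[OF \<beta>] tip_profile_fixpoint[OF \<beta>'])
  qed (use z in auto)
  then show ?thesis by simp
qed

definition tip_eta :: "real \<Rightarrow> real \<Rightarrow> real" where
  "tip_eta \<beta> v = Re (tip_profile \<beta> (of_real v))"

definition tip_rho :: "real \<Rightarrow> real \<Rightarrow> real" where
  "tip_rho \<beta> v = Re (csqrt (1 - of_real v * (tip_profile \<beta> (of_real v))\<^sup>2))"

definition tip_excess :: "real \<Rightarrow> real \<Rightarrow> real" where
  "tip_excess \<beta> v = tip_eta \<beta> v * (\<beta> * v * g v + tip_rho \<beta> v) - 1"

lemma tip_eta_lipschitz: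
  assumes "\<beta> \<in> {0..B}" "\<beta>' \<in> {0..B}" "\<bar>v\<bar> < \<delta>"
  shows "\<bar>tip_eta \<beta> v - tip_eta \<beta>' v\<bar> \<le> 2 * \<bar>\<beta> - \<beta>'\<bar>"
  using tip_profile_lipschitz[OF assms(1,2), of "of_real v"] assms(3)
    abs_Re_le_cmod[of "tip_profile \<beta> (of_real v) - tip_profile \<beta>' (of_real v)"]
  by (simp add: tip_eta_def)

context
  fixes \<beta> :: real
  assumes \<beta>: "\<beta> \<in> {0..B}"
begin

lemma tip_profile_of_real: "\<bar>v\<bar> < \<delta> \<Longrightarrow> tip_profile \<beta> (of_real v) = of_real (tip_eta \<beta> v)"
  using real_holomorphic_nearD(3)[OF tip_profile_mem[OF \<beta>]] by (simp add: tip_eta_def)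

lemma tip_eta_near: "\<bar>v\<bar> < \<delta> \<Longrightarrow> \<bar>tip_eta \<beta> v - 1/3\<bar> \<le> 1/24"
  using real_holomorphic_nearD(2)[OF tip_profile_mem[OF \<beta>], of "of_real v"]
    abs_Re_le_cmod[of "tip_profile \<beta> (of_real v) - 1/3"] by (simp add: tip_eta_def)

lemma tip_eta_bounds: "\<bar>v\<bar> < \<delta> \<Longrightarrow> 7/24 \<le> tip_eta \<beta> v \<and> tip_eta \<beta> v \<le> 3/8"
  using tip_eta_near[of v] unfolding abs_le_iff by linarith

lemma csqrt_tip_profile:
  "\<bar>v\<bar> < \<delta> \<Longrightarrow> csqrt (1 - of_real v * (tip_profile \<beta> (of_real v))\<^sup>2) = of_real (tip_rho \<beta> v)"
  using csqrt_tip_of_real(2)[OF _ tip_eta_near, of v v]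
  by (simp add: tip_rho_def tip_profile_of_real del: csqrt.sel)

lemma tip_rho_eq: "\<bar>v\<bar> < \<delta> \<Longrightarrow> tip_rho \<beta> v = sqrt (1 - v * (tip_eta \<beta> v)\<^sup>2)"
  using csqrt_tip_of_real(2)[OF _ tip_eta_near, of v v] csqrt_tip_profile[of v]
  by (simp add: tip_profile_of_real del: csqrt.sel)

lemma tip_rho_power2: "\<bar>v\<bar> < \<delta> \<Longrightarrow> (tip_rho \<beta> v)\<^sup>2 = 1 - v * (tip_eta \<beta> v)\<^sup>2"
  using csqrt_tip_of_real(1)[OF _ tip_eta_near, of v v] by (simp add: tip_rho_eq)

lemma tip_rho_ge:
  assumes "\<bar>v\<bar> < \<delta>"
  shows "95/96 \<le> tip_rho \<beta> v"
proof -
  have "norm (csqrt (1 - of_real v * (tip_profile \<beta> (of_real v))\<^sup>2) - 1) \<le> norm (complex_of_real v) / 4"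
    by (rule csqrt_near_one)
      (use assms radius_le real_holomorphic_nearD(2)[OF tip_profile_mem[OF \<beta>]] in auto)
  moreover have "norm (complex_of_real (tip_rho \<beta> v) - 1) = \<bar>tip_rho \<beta> v - 1\<bar>"
    by (metis norm_of_real of_real_1 of_real_diff)
  ultimately show ?thesis
    using assms radius_le unfolding csqrt_tip_profile[OF assms] norm_of_real by linarith
qed

lemma tip_rho_analytic: "real_analytic_on (tip_rho \<beta>) {-\<delta><..<\<delta>}"
proof -
  have "(\<lambda>z. csqrt (1 - z * (tip_profile \<beta> z)\<^sup>2)) holomorphic_on ball 0 \<delta>"
    using real_holomorphic_nearD(1,2)[OF tip_profile_mem[OF \<beta>]] radius_le
    by (intro holomorphic_intros csqrt_near_one(3)) auto
  from holomorphic_imp_real_analytic_on[OF this open_ball]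
  have "real_analytic_on (tip_rho \<beta>) {v. complex_of_real v \<in> ball 0 \<delta>}"
    by (simp add: tip_rho_def[abs_def] del: csqrt.sel)
  then show ?thesis by (rule real_analytic_on_subset) auto
qed

lemma tip_drive_of_real:
  "\<bar>v\<bar> < \<delta> \<Longrightarrow> tip_drive \<beta> (of_real v) (tip_profile \<beta> (of_real v)) = of_real (\<beta> * v * g v + tip_rho \<beta> v)"
  unfolding tip_drive_def csqrt_tip_profile by (simp add: extension_real)

lemma
  assumes v: "\<bar>v\<bar> < \<delta>"
  shows tip_eta_has_derivative: "(tip_eta \<beta> has_real_derivative deriv (tip_eta \<beta>) v) (at v)"
    and tip_eta_ode: "v * deriv (tip_eta \<beta>) v = 1/4 * tip_eta \<beta> v * (1 - 3 * (tip_excess \<beta> v + 1))"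
proof -
  define H where "H = (\<lambda>z. tip_rhs \<beta> z (tip_profile \<beta> z))"
  define D where "D = deriv (tip_profile \<beta>) (of_real v)"
  have z: "norm (complex_of_real v) < \<delta>" using v by simp
  have H_holomorphic: "H holomorphic_on ball 0 \<delta>"
    unfolding H_def by (rule tip_rhs_holomorphic[OF tip_profile_mem[OF \<beta>]])
  have profile_eq: "euler_inverse 4 H z = tip_profile \<beta> z" if "z \<in> ball 0 \<delta>" for z
    using tip_profile_fixpoint[OF \<beta>, of z] that by (simp add: tip_step_def H_def)
  have profile_deriv: "(tip_profile \<beta> has_field_derivative D) (at (of_real v))"
    unfolding D_def using z
    by (intro holomorphic_derivI[OF real_holomorphic_nearD(1)[OF tip_profile_mem[OF \<beta>]] open_ball]) simp
  then have eta_deriv: "(tip_eta \<beta> has_real_derivative Re D) (at v)"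
    unfolding tip_eta_def[abs_def] by (rule has_real_derivative_Re_of_real)
  then have deriv_eq: "deriv (tip_eta \<beta>) v = Re D" by (rule DERIV_imp_deriv)
  show "(tip_eta \<beta> has_real_derivative deriv (tip_eta \<beta>) v) (at v)"
    using eta_deriv deriv_eq by simp
  have "(euler_inverse 4 H has_field_derivative D) (at (of_real v))"
    by (rule has_field_derivative_transform_within_open[OF profile_deriv open_ball[of 0 \<delta>]])
      (use z profile_eq in auto)
  then have "deriv (euler_inverse 4 H) (of_real v) = D" by (rule DERIV_imp_deriv)
  then have "of_real v * D + of_real (tip_eta \<beta> v) / 4 = H (of_real v)"
    using euler_inverse_ode[OF H_holomorphic z, of 4] z v
    by (simp add: profile_eq tip_profile_of_real)
  also have "H (of_real v) = of_real (tip_eta \<beta> v / 2 - 3/4 * (tip_eta \<beta> v)\<^sup>2 * (\<beta> * v * g v + tip_rho \<beta> v))"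
    unfolding H_def tip_rhs_def tip_drive_of_real[OF v] by (simp add: tip_profile_of_real[OF v])
  finally have "v * Re D + tip_eta \<beta> v / 4
      = tip_eta \<beta> v / 2 - 3/4 * (tip_eta \<beta> v)\<^sup>2 * (\<beta> * v * g v + tip_rho \<beta> v)"
    by (simp add: complex_eq_iff)
  then show "v * deriv (tip_eta \<beta>) v = 1/4 * tip_eta \<beta> v * (1 - 3 * (tip_excess \<beta> v + 1))"
    unfolding deriv_eq tip_excess_def by (simp add: field_simps power2_eq_square)
qed

lemma tip_excess_neg:
  assumes "\<bar>v\<bar> < \<delta>"
  shows "tip_excess \<beta> v < 0"
proof -
  have "norm (complex_of_real (\<beta> * v * g v + tip_rho \<beta> v) - 1) \<le> 1/32"
    using tip_drive_near_one[OF \<beta>, of "of_real v" "tip_profile \<beta> (of_real v)"] assms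
      real_holomorphic_nearD(2)[OF tip_profile_mem[OF \<beta>]] by (simp only: tip_drive_of_real) simp
  then have "\<bar>\<beta> * v * g v + tip_rho \<beta> v - 1\<bar> \<le> 1/32"
    by (metis norm_of_real of_real_1 of_real_diff)
  then have "\<beta> * v * g v + tip_rho \<beta> v \<le> 33/32" "0 \<le> \<beta> * v * g v + tip_rho \<beta> v"
    unfolding abs_le_iff by linarith+
  then have "tip_eta \<beta> v * (\<beta> * v * g v + tip_rho \<beta> v) \<le> 3/8 * (33/32)"
    using tip_eta_bounds[OF assms] by (intro mult_mono) auto
  then show ?thesis by (simp add: tip_excess_def)
qed

lemma tip_eta_0: "tip_eta \<beta> 0 = 1/3"
proof -
  have "0 < tip_eta \<beta> 0" "tip_rho \<beta> 0 = 1"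
    using tip_eta_bounds[of 0] tip_rho_eq[of 0] radius_pos by auto
  then show ?thesis using tip_eta_ode[of 0] radius_pos by (simp add: tip_excess_def)
qed

lemma tip_rho_derivative:
  assumes v: "\<bar>v\<bar> < \<delta>"
  shows "2 * tip_rho \<beta> v * deriv (tip_rho \<beta>) v = 3/2 * (tip_eta \<beta> v)\<^sup>2 * tip_excess \<beta> v"
proof -
  have "(tip_rho \<beta> has_real_derivative deriv (tip_rho \<beta>) v) (at v)"
    using real_analytic_on_has_derivative[OF tip_rho_analytic] v by (simp add: abs_less_iff)
  then have "((\<lambda>v. (tip_rho \<beta> v)\<^sup>2) has_real_derivative 2 * tip_rho \<beta> v * deriv (tip_rho \<beta>) v) (at v)"
    by (auto intro!: derivative_eq_intros)
  moreover have "((\<lambda>v. 1 - v * (tip_eta \<beta> v)\<^sup>2) has_real_derivative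
      - ((tip_eta \<beta> v)\<^sup>2 + 2 * tip_eta \<beta> v * (v * deriv (tip_eta \<beta>) v))) (at v)"
    by (rule derivative_eq_intros tip_eta_has_derivative[OF v] refl)+ (simp add: algebra_simps)
  then have "((\<lambda>v. (tip_rho \<beta> v)\<^sup>2) has_real_derivative
      - ((tip_eta \<beta> v)\<^sup>2 + 2 * tip_eta \<beta> v * (v * deriv (tip_eta \<beta>) v))) (at v)"
    by (rule has_field_derivative_transform_within_open[of _ _ _ "{-\<delta><..<\<delta>}"])
      (use v tip_rho_power2 in auto)
  ultimately have "2 * tip_rho \<beta> v * deriv (tip_rho \<beta>) v
      = - ((tip_eta \<beta> v)\<^sup>2 + 2 * tip_eta \<beta> v * (v * deriv (tip_eta \<beta>) v))"
    by (rule DERIV_unique)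
  then show ?thesis
    unfolding tip_eta_ode[OF v] by (simp add: field_simps power2_eq_square)
qed

end

end

lemma tip_equation_exists:
  assumes "real_analytic_on g S" "0 \<in> S" "1 \<le> B"
  obtains \<gamma> \<delta> where "tip_equation g \<gamma> \<delta> B"
proof -
  obtain \<delta>0 \<gamma> where "\<delta>0 > 0" and holomorphic: "\<gamma> holomorphic_on ball 0 \<delta>0"
    and real: "\<And>v. \<bar>v\<bar> < \<delta>0 \<Longrightarrow> \<gamma> (of_real v) = of_real (g v)"
    using real_analytic_on_complexify[OF assms(1,2)] by auto
  have "compact (\<gamma> ` cball 0 (\<delta>0 / 2))"
    using \<open>\<delta>0 > 0\<close>
    by (intro compact_continuous_image continuous_on_subset[OF holomorphic_on_imp_continuous_on[OF holomorphic]])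
      auto
  then obtain M where M: "M > 0" "\<And>z. norm z \<le> \<delta>0 / 2 \<Longrightarrow> norm (\<gamma> z) \<le> M"
    using compact_imp_bounded bounded_pos by (metis imageI mem_cball_0)
  define \<delta> where "\<delta> = min (\<delta>0 / 2) (min (1/24) (1 / (48 * B * M)))"
  have \<delta>: "0 < \<delta>" "\<delta> \<le> 1/24" "\<delta> \<le> \<delta>0 / 2" "\<delta> \<le> 1 / (48 * B * M)"
    using \<open>\<delta>0 > 0\<close> assms(3) M(1) by (auto simp: \<delta>_def)
  have "tip_equation g \<gamma> \<delta> B"
  proof
    show "\<gamma> holomorphic_on ball 0 \<delta>"
      using holomorphic by (rule holomorphic_on_subset) (use \<delta> \<open>\<delta>0 > 0\<close> in auto)
    fix z :: complex assume z: "norm z < \<delta>"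
    have "norm (z * \<gamma> z) \<le> 1 / (48 * B * M) * M"
      unfolding norm_mult using z \<delta> M(2)[of z] M(1) assms(3) by (intro mult_mono) auto
    then have "B * norm (z * \<gamma> z) \<le> B * (1 / (48 * B * M) * M)"
      using assms(3) by (intro mult_left_mono) auto
    then show "B * norm (z * \<gamma> z) \<le> 1/48" using M(1) assms(3) by simp
  qed (use \<delta> \<open>\<delta>0 > 0\<close> assms(3) real in auto)
  then show thesis by (rule that)
qed

section \<open>Uniqueness\<close>

lemma eventually_at_right_interval:
  fixes a b :: real
  assumes "a < b" "\<And>x. a < x \<Longrightarrow> x < b \<Longrightarrow> P x"
  shows "eventually P (at_right a)"
  using assms unfolding eventually_at_right_field by blast

lemma scaled_derivative_limit_zero:
  fixes f f' :: "real \<Rightarrow> real"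
  assumes limit: "(f \<longlongrightarrow> l) (at_right 0)" and scaled_limit: "((\<lambda>x. x * f' x) \<longlongrightarrow> c) (at_right 0)"
    and deriv: "\<forall>\<^sub>F x in at_right 0. (f has_real_derivative f' x) (at x)"
  shows "c = 0"
proof -
  have "((\<lambda>x. x * f x / x) \<longlongrightarrow> l + c) (at_right 0)"
  proof (rule lhopital_right_0[where f' = "\<lambda>x. f x + x * f' x" and g' = "\<lambda>_. 1"])
    show "((\<lambda>x. x * f x) \<longlongrightarrow> 0) (at_right 0)"
      using tendsto_mult[OF tendsto_ident_at limit] by simp
    show "\<forall>\<^sub>F x in at_right 0. ((\<lambda>x. x * f x) has_real_derivative f x + x * f' x) (at x)"
      using deriv by eventually_elim (auto intro!: derivative_eq_intros)
    show "((\<lambda>x. (f x + x * f' x) / 1) \<longlongrightarrow> l + c) (at_right 0)"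
      using tendsto_add[OF limit scaled_limit] by simp
  qed (auto simp: eventually_at_right_less intro!: eventually_at_right_interval[of 0 1])
  moreover have "\<forall>\<^sub>F x in at_right 0. x * f x / x = f x"
    by (rule eventually_at_right_interval[of 0 1]) auto
  ultimately have "(f \<longlongrightarrow> l + c) (at_right 0)" by (simp add: tendsto_cong)
  then have "l + c = l" using limit by (rule tendsto_unique[OF trivial_limit_at_right_real])
  then show ?thesis by simp
qed

lemma nonincreasing_le_right_limit:
  fixes u :: "real \<Rightarrow> real"
  assumes limit: "(u \<longlongrightarrow> l) (at_right a)" and "a < b"
    and deriv: "\<And>x. a < x \<Longrightarrow> x \<le> b \<Longrightarrow> \<exists>D. (u has_real_derivative D) (at x) \<and> D \<le> 0"
  shows "u b \<le> l"
proof (rule tendsto_lowerbound[OF limit])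
  have "u b \<le> u x" if "a < x" "x < b" for x
    using that deriv by (intro DERIV_nonpos_imp_nonincreasing[of x b u]) auto
  then show "\<forall>\<^sub>F x in at_right a. u b \<le> u x" by (rule eventually_at_right_interval[OF \<open>a < b\<close>])
qed simp

lemma linear_ode_zero_from_right_limit:
  fixes d q :: "real \<Rightarrow> real"
  assumes deriv: "\<And>x. a < x \<Longrightarrow> x < b \<Longrightarrow> (d has_real_derivative q x * d x) (at x)"
    and cont: "\<And>x. a < x \<Longrightarrow> x < b \<Longrightarrow> isCont q x"
    and sign: "\<forall>\<^sub>F x in at_right a. q x \<le> 0" and limit: "(d \<longlongrightarrow> 0) (at_right a)"
    and x: "a < x" "x < b"
  shows "d x = 0"
proof -
  define u where "u = (\<lambda>x. (d x)\<^sup>2)"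
  have u_deriv: "(u has_real_derivative 2 * q z * u z) (at z)" if "a < z" "z < b" for z
    unfolding u_def using deriv[OF that] by (auto intro!: derivative_eq_intros simp: power2_eq_square)
  obtain \<epsilon> where "a < \<epsilon>" and q_nonpos: "\<And>z. a < z \<Longrightarrow> z < \<epsilon> \<Longrightarrow> q z \<le> 0"
    using sign by (auto simp: eventually_at_right_field)
  define y where "y = (a + min \<epsilon> x) / 2"
  have y: "a < y" "y < \<epsilon>" "y < x" using \<open>a < \<epsilon>\<close> x(1) by (auto simp: y_def min_def field_simps)
  have "u y \<le> 0"
  proof (rule nonincreasing_le_right_limit[OF _ y(1)])
    show "(u \<longlongrightarrow> 0) (at_right a)" using tendsto_power[OF limit, of 2] by (simp add: u_def)
    fix z assume "a < z" "z \<le> y"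
    then have z: "a < z" "z < \<epsilon>" "z < b" using y x by auto
    have "2 * q z * u z \<le> 0" using q_nonpos[OF z(1,2)] by (simp add: u_def mult_nonpos_nonneg)
    then show "\<exists>D. (u has_real_derivative D) (at z) \<and> D \<le> 0" using u_deriv[OF z(1,3)] by blast
  qed
  have "compact (q ` {y..x})"
    using cont x y by (intro compact_continuous_image continuous_at_imp_continuous_on) auto
  then obtain M where M: "\<And>z. z \<in> {y..x} \<Longrightarrow> norm (q z) \<le> M"
    using compact_imp_bounded bounded_iff by (metis imageI)
  have "u x \<le> exp (2 * M * (x - y)) * u y"
  proof (rule linear_growth_bound)
    show "continuous_on {y..x} u"
      using x y by (intro continuous_at_imp_continuous_on ballI DERIV_isCont[OF u_deriv]) auto
    fix z assume z: "y < z" "z < x"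
    then show "(u has_real_derivative 2 * q z * u z) (at z)" using x y by (intro u_deriv) auto
    have "q z \<le> M" using M[of z] z by auto
    then show "2 * q z * u z \<le> 2 * M * u z" by (intro mult_right_mono) (auto simp: u_def)
  qed (use y in simp)
  also have "\<dots> \<le> 0" using \<open>u y \<le> 0\<close> by (simp add: mult_nonneg_nonpos)
  finally show ?thesis by (simp add: u_def)
qed

text \<open>Since \<open>r' = \<rho> > 0\<close>, a solution can be described with the radius \<open>x = r s\<close> as independent
  variable; there \<open>\<eta>\<close> solves an equation with a singular point at \<open>x = 0\<close>.\<close>

locale tip_growth_solution =
  fixes g :: "real \<Rightarrow> real" and \<beta> :: real and \<rho> r :: "real \<Rightarrow> real"
  assumes growth: "toy_steady_tip_growth g \<beta> \<rho> r" and g_isCont: "isCont g v"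
begin

lemma solution_at:
  assumes "s > 0"
  shows "0 < \<rho> s" "\<rho> s < 1" "0 < r s" "(\<rho> has_real_derivative toy_rhs g \<beta> (\<rho> s) (r s)) (at s)"
    "(r has_real_derivative \<rho> s) (at s)"
  using growth assms by (auto simp: toy_steady_tip_growth_def)

lemma limits_at_tip: "(\<rho> \<longlongrightarrow> 1) (at_right 0)" "(r \<longlongrightarrow> 0) (at_right 0)"
  and \<rho>_at_top: "(\<rho> \<longlongrightarrow> 0) at_top"
  using growth by (auto simp: toy_steady_tip_growth_def)

definition r_inf :: real where "r_inf = Lim at_top r"

lemma r_at_top: "(r \<longlongrightarrow> r_inf) at_top" and r_inf_pos: "0 < r_inf"
proof -
  obtain R where "0 < R" "(r \<longlongrightarrow> R) at_top" using growth by (auto simp: toy_steady_tip_growth_def)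
  moreover from this have "r_inf = R"
    unfolding r_inf_def by (intro tendsto_Lim) auto
  ultimately show "(r \<longlongrightarrow> r_inf) at_top" "0 < r_inf" by auto
qed

lemma r_strict_mono:
  assumes "0 < a" "a < b"
  shows "r a < r b"
proof (rule DERIV_pos_imp_increasing[OF assms(2), where f = r])
  fix s assume "a \<le> s"
  then have "s > 0" using assms(1) by simp
  then show "\<exists>y. (r has_real_derivative y) (at s) \<and> 0 < y" using solution_at(1,5) by blast
qed

lemma r_less_r_inf:
  assumes "s > 0"
  shows "r s < r_inf"
proof -
  have "r (s + 1) \<le> r_inf"
    by (rule tendsto_lowerbound[OF r_at_top])
      (use r_strict_mono[of "s + 1"] assms
        in \<open>auto intro!: eventually_mono[OF eventually_gt_at_top[of "s + 1"]] less_imp_le\<close>)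
  then show ?thesis using r_strict_mono[of s "s + 1"] assms by simp
qed

lemma r_attains:
  assumes x: "0 < x" "x < r_inf"
  obtains s where "s > 0" "r s = x"
proof -
  obtain d where d: "d > 0" "\<And>s. 0 < s \<Longrightarrow> s < d \<Longrightarrow> r s < x"
    using order_tendstoD(2)[OF limits_at_tip(2) x(1)] by (auto simp: eventually_at_right_field)
  obtain b where b: "\<And>s. s \<ge> b \<Longrightarrow> x < r s"
    using order_tendstoD(1)[OF r_at_top x(2)] by (auto simp: eventually_at_top_linorder)
  have "\<exists>s\<ge>d / 2. s \<le> max b d \<and> r s = x"
  proof (rule IVT)
    show "r (d / 2) \<le> x" "x \<le> r (max b d)" using d b by (auto intro: less_imp_le)
    show "d / 2 \<le> max b d" using d(1) by (simp add: le_max_iff_disj)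
    show "\<forall>s. d / 2 \<le> s \<and> s \<le> max b d \<longrightarrow> isCont r s"
      using d(1) by (intro allI impI DERIV_isCont[OF solution_at(5)]) auto
  qed
  then show thesis using that d(1) by (metis half_gt_zero less_le_trans)
qed

definition time_at :: "real \<Rightarrow> real" where "time_at = inv_into {0<..} r"

lemma time_at_r: "s > 0 \<Longrightarrow> time_at (r s) = s"
proof -
  have "inj_on r {0<..}"
    by (rule strict_mono_on_imp_inj_on) (auto simp: strict_mono_on_def r_strict_mono)
  then show "s > 0 \<Longrightarrow> time_at (r s) = s" unfolding time_at_def by (intro inv_into_f_f) auto
qed

lemma r_time_at:
  assumes "0 < x" "x < r_inf"
  shows "0 < time_at x" "r (time_at x) = x"
proof -
  obtain s where "s > 0" "r s = x" by (rule r_attains[OF assms])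
  then show "0 < time_at x" "r (time_at x) = x" using time_at_r by auto
qed

lemma time_at_derivative:
  assumes "0 < x" "x < r_inf"
  shows "(time_at has_real_derivative 1 / \<rho> (time_at x)) (at x)"
  unfolding inverse_eq_divide[symmetric]
proof (rule has_field_derivative_inverse_strong_x[where S = "{0<..}"])
  show "continuous_on {0<..} r"
    using solution_at(5) by (intro continuous_at_imp_continuous_on ballI) (auto intro: DERIV_isCont)
  show "(r has_real_derivative \<rho> (time_at x)) (at (time_at x))" "\<rho> (time_at x) \<noteq> 0"
    using solution_at(1,5)[OF r_time_at(1)[OF assms]] by simp_all
qed (simp_all add: r_time_at[OF assms] time_at_r)

lemma time_at_at_right_0: "filterlim time_at (at_right 0) (at_right 0)"
proof -
  have pos: "\<forall>\<^sub>F x in at_right 0. 0 < time_at x"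
    using r_time_at(1) by (rule eventually_at_right_interval[OF r_inf_pos])
  have "(time_at \<longlongrightarrow> 0) (at_right 0)"
  proof (rule order_tendstoI)
    fix e :: real assume "0 < e"
    have "time_at x < e" if x: "0 < x" "x < r e" for x
    proof (rule ccontr)
      assume "\<not> time_at x < e"
      then have "r e \<le> r (time_at x)"
        using r_strict_mono[OF \<open>0 < e\<close>, of "time_at x"] by (cases "time_at x = e") auto
      moreover have "x < r_inf" using x r_less_r_inf[OF \<open>0 < e\<close>] by simp
      ultimately show False using r_time_at(2)[of x] x by simp
    qed
    then show "\<forall>\<^sub>F x in at_right 0. time_at x < e"
      by (rule eventually_at_right_interval[OF solution_at(3)[OF \<open>0 < e\<close>]])
  next
    fix e :: real assume "e < 0"
    then show "\<forall>\<^sub>F x in at_right 0. e < time_at x" using pos by (auto elim: eventually_mono)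
  qed
  then show ?thesis using pos unfolding filterlim_at by (auto elim: eventually_mono)
qed

definition speed_at :: "real \<Rightarrow> real" where "speed_at x = \<rho> (time_at x)"

definition eta_at :: "real \<Rightarrow> real" where "eta_at x = sqrt (1 - (speed_at x)\<^sup>2) / x"

lemma speed_at_bounds: "0 < x \<Longrightarrow> x < r_inf \<Longrightarrow> 0 < speed_at x \<and> speed_at x < 1"
  unfolding speed_at_def using solution_at(1,2)[OF r_time_at(1)] by simp

lemma speed_at_r: "s > 0 \<Longrightarrow> speed_at (r s) = \<rho> s"
  by (simp add: speed_at_def time_at_r)

lemma speed_at_power2:
  assumes "0 < x" "x < r_inf"
  shows "(speed_at x)\<^sup>2 = 1 - x\<^sup>2 * (eta_at x)\<^sup>2"
proof -
  have "(speed_at x)\<^sup>2 \<le> 1" using speed_at_bounds[OF assms] by (simp add: abs_square_le_1)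
  then show ?thesis using assms(1) by (simp add: eta_at_def power_divide)
qed

lemma speed_at_derivative:
  assumes x: "0 < x" "x < r_inf"
  shows "(speed_at has_real_derivative toy_rhs g \<beta> (speed_at x) x / speed_at x) (at x)"
  using DERIV_chain2[OF solution_at(4)[OF r_time_at(1)[OF x]] time_at_derivative[OF x]]
  by (simp add: speed_at_def[abs_def] r_time_at(2)[OF x])

lemma eta_at_derivative:
  assumes x: "0 < x" "x < r_inf"
  shows "(eta_at has_real_derivative
    eta_at x * (1 - 3 * eta_at x * (\<beta> * x\<^sup>2 * g (x\<^sup>2) + speed_at x)) / (2 * x)) (at x)"
proof -
  define h where "h = speed_at x"
  define q where "q = sqrt (1 - h\<^sup>2)"
  define X where "X = \<beta> * x\<^sup>2 * g (x\<^sup>2) + h"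
  have h: "0 < h" "h\<^sup>2 < 1"
    using speed_at_bounds[OF x] by (auto simp: h_def abs_square_less_1)
  then have q: "0 < q" "q\<^sup>2 = 1 - h\<^sup>2" by (auto simp: q_def)
  have rhs: "toy_rhs g \<beta> h x = 3/2 * q\<^sup>2 / x * (-1 + q * X / x)"
    by (simp add: toy_rhs_def q(2) X_def) (simp add: q_def)
  have "((\<lambda>y. 1 - (speed_at y)\<^sup>2) has_real_derivative - 2 * toy_rhs g \<beta> h x) (at x)"
    using speed_at_derivative[OF x] h(1) by (auto intro!: derivative_eq_intros simp: h_def[symmetric])
  then have "((\<lambda>y. sqrt (1 - (speed_at y)\<^sup>2)) has_real_derivative
      inverse q / 2 * (- 2 * toy_rhs g \<beta> h x)) (at x)"
    unfolding q_def h_def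
    by (rule DERIV_chain2[OF DERIV_real_sqrt, rotated]) (use h(2) in \<open>simp add: h_def\<close>)
  from DERIV_divide[OF this DERIV_ident] have deriv: "(eta_at has_real_derivative
      (inverse q / 2 * (- 2 * toy_rhs g \<beta> h x) * x - q * 1) / (x * x)) (at x)"
    using x(1) by (simp only: eta_at_def[abs_def] q_def h_def)
  have "inverse q / 2 * (- 2 * toy_rhs g \<beta> h x) * x - q * 1 = q / 2 * (1 - 3 * (q / x) * X)"
    unfolding rhs power2_eq_square using q(1) x(1) by (simp add: field_simps)
  then have value_eq: "(inverse q / 2 * (- 2 * toy_rhs g \<beta> h x) * x - q * 1) / (x * x)
      = q / x * (1 - 3 * (q / x) * X) / (2 * x)" by (simp only:) simp
  have "eta_at x = q / x" by (simp add: eta_at_def q_def h_def)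
  then show ?thesis using deriv by (simp only: value_eq flip: X_def h_def)
qed

lemma speed_at_tendsto_1: "(speed_at \<longlongrightarrow> 1) (at_right 0)"
  unfolding speed_at_def[abs_def] by (rule filterlim_compose[OF limits_at_tip(1) time_at_at_right_0])

lemma feedback_tendsto_0: "((\<lambda>x. \<beta> * x\<^sup>2 * g (x\<^sup>2)) \<longlongrightarrow> 0) (at_right 0)"
proof -
  have "((\<lambda>x. \<beta> * x\<^sup>2 * g (x\<^sup>2)) \<longlongrightarrow> \<beta> * 0\<^sup>2 * g (0\<^sup>2)) (at_right 0)"
    by (intro tendsto_intros isCont_tendsto_compose[OF g_isCont])
  then show ?thesis by simp
qed

lemma eta_at_tendsto: "(eta_at \<longlongrightarrow> 1/3) (at_right 0)"
proof -
  obtain \<eta>0 where \<eta>0: "\<eta>0 > 0" "((\<lambda>s. sqrt (1 - (\<rho> s)\<^sup>2) / r s) \<longlongrightarrow> \<eta>0) (at_right 0)"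
    using growth by (auto simp: toy_steady_tip_growth_def)
  have "\<forall>\<^sub>F x in at_right 0. sqrt (1 - (\<rho> (time_at x))\<^sup>2) / r (time_at x) = eta_at x"
    using r_time_at(2)
    by (intro eventually_at_right_interval[OF r_inf_pos]) (simp add: eta_at_def speed_at_def)
  then have limit: "(eta_at \<longlongrightarrow> \<eta>0) (at_right 0)"
    using filterlim_compose[OF \<eta>0(2) time_at_at_right_0] by (simp add: tendsto_cong)
  define D where
    "D = (\<lambda>x. eta_at x * (1 - 3 * eta_at x * (\<beta> * x\<^sup>2 * g (x\<^sup>2) + speed_at x)) / (2 * x))"
  have "((\<lambda>x. eta_at x * (1 - 3 * eta_at x * (\<beta> * x\<^sup>2 * g (x\<^sup>2) + speed_at x)) / 2)
      \<longlongrightarrow> \<eta>0 * (1 - 3 * \<eta>0 * (0 + 1)) / 2) (at_right 0)"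
    by (intro tendsto_intros limit feedback_tendsto_0 speed_at_tendsto_1) simp
  moreover have "\<forall>\<^sub>F x in at_right 0.
      eta_at x * (1 - 3 * eta_at x * (\<beta> * x\<^sup>2 * g (x\<^sup>2) + speed_at x)) / 2 = x * D x"
    by (rule eventually_at_right_interval[OF zero_less_one]) (simp add: D_def)
  ultimately have "((\<lambda>x. x * D x) \<longlongrightarrow> \<eta>0 * (1 - 3 * \<eta>0 * (0 + 1)) / 2) (at_right 0)"
    by (rule Lim_transform_eventually)
  moreover have "\<forall>\<^sub>F x in at_right 0. (eta_at has_real_derivative D x) (at x)"
    unfolding D_def using eta_at_derivative by (rule eventually_at_right_interval[OF r_inf_pos])
  ultimately have "\<eta>0 * (1 - 3 * \<eta>0 * (0 + 1)) / 2 = 0"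
    by (rule scaled_derivative_limit_zero[OF limit])
  then have "\<eta>0 = 1/3" using \<eta>0(1) by simp
  show ?thesis using limit unfolding \<open>\<eta>0 = 1/3\<close> .
qed

end

lemma eta_rhs_difference:
  fixes E1 E2 H1 H2 F x :: real
  assumes H: "H1\<^sup>2 = 1 - x\<^sup>2 * E1\<^sup>2" "H2\<^sup>2 = 1 - x\<^sup>2 * E2\<^sup>2" "0 < H1" "0 < H2"
  shows "E1 * (1 - 3 * E1 * (F + H1)) - E2 * (1 - 3 * E2 * (F + H2)) =
    (1 - 3 * (E1 + E2) * (F + H1 - E2\<^sup>2 * x\<^sup>2 / (H1 + H2))) * (E1 - E2)"
proof -
  define Y where "Y = E2\<^sup>2 * x\<^sup>2 / (H1 + H2)"
  have "(H1 - H2) * (H1 + H2) = - (x\<^sup>2 * (E1\<^sup>2 - E2\<^sup>2))"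
    using H(1,2) by (simp add: algebra_simps power2_eq_square)
  moreover have "H1 + H2 \<noteq> 0" using H(3,4) by linarith
  ultimately have "H1 - H2 = - (x\<^sup>2 * (E1\<^sup>2 - E2\<^sup>2)) / (H1 + H2)"
    by (rule nonzero_eq_divide_eq[THEN iffD2, rotated])
  then have speed_difference: "E2\<^sup>2 * (H1 - H2) = - ((E1\<^sup>2 - E2\<^sup>2) * Y)"
    by (simp add: Y_def mult_ac)
  have "E1 * (1 - 3 * E1 * (F + H1)) - E2 * (1 - 3 * E2 * (F + H2)) =
      (E1 - E2) - 3 * (E1\<^sup>2 - E2\<^sup>2) * (F + H1) - 3 * (E2\<^sup>2 * (H1 - H2))"
    by (simp add: algebra_simps power2_eq_square)
  also have "\<dots> = (1 - 3 * (E1 + E2) * (F + H1 - Y)) * (E1 - E2)"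
    unfolding speed_difference by (simp add: algebra_simps power2_eq_square)
  finally show ?thesis by (simp add: Y_def)
qed

locale tip_growth_pair =
  S1: tip_growth_solution g \<beta> \<rho>1 r1 + S2: tip_growth_solution g \<beta> \<rho>2 r2 for g \<beta> \<rho>1 r1 \<rho>2 r2
begin

definition r_common :: real where "r_common = min S1.r_inf S2.r_inf"

lemma r_common: "0 < r_common" "x < r_common \<Longrightarrow> x < S1.r_inf" "x < r_common \<Longrightarrow> x < S2.r_inf"
  using S1.r_inf_pos S2.r_inf_pos by (auto simp: r_common_def)

definition contraction_rate :: "real \<Rightarrow> real" where
  "contraction_rate x = 1 - 3 * (S1.eta_at x + S2.eta_at x) *
     (\<beta> * x\<^sup>2 * g (x\<^sup>2) + S1.speed_at x - (S2.eta_at x)\<^sup>2 * x\<^sup>2 / (S1.speed_at x + S2.speed_at x))"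

lemma eta_difference_derivative:
  assumes "0 < x" "x < r_common"
  shows "((\<lambda>x. S1.eta_at x - S2.eta_at x) has_real_derivative
    contraction_rate x / (2 * x) * (S1.eta_at x - S2.eta_at x)) (at x)"
proof -
  have x: "0 < x" "x < S1.r_inf" "x < S2.r_inf" using assms r_common by auto
  have "((\<lambda>x. S1.eta_at x - S2.eta_at x) has_real_derivative
      (S1.eta_at x * (1 - 3 * S1.eta_at x * (\<beta> * x\<^sup>2 * g (x\<^sup>2) + S1.speed_at x))
       - S2.eta_at x * (1 - 3 * S2.eta_at x * (\<beta> * x\<^sup>2 * g (x\<^sup>2) + S2.speed_at x))) / (2 * x)) (at x)"
    unfolding diff_divide_distrib
    by (intro DERIV_diff S1.eta_at_derivative S2.eta_at_derivative x)
  then show ?thesis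
    using S1.speed_at_bounds[OF x(1,2)] S2.speed_at_bounds[OF x(1,3)]
    by (subst (asm) eta_rhs_difference)
      (auto simp: S1.speed_at_power2[OF x(1,2)] S2.speed_at_power2[OF x(1,3)] contraction_rate_def)
qed

lemma contraction_rate_isCont:
  assumes "0 < x" "x < r_common"
  shows "isCont contraction_rate x"
proof -
  have x: "0 < x" "x < S1.r_inf" "x < S2.r_inf" using assms r_common by auto
  note continuous = S1.eta_at_derivative[OF x(1,2)] S2.eta_at_derivative[OF x(1,3)]
    S1.speed_at_derivative[OF x(1,2)] S2.speed_at_derivative[OF x(1,3)]
  show ?thesis
    unfolding contraction_rate_def[abs_def]
    using S1.speed_at_bounds[OF x(1,2)] S2.speed_at_bounds[OF x(1,3)]
    by (intro continuous_intros isCont_o2[OF _ S1.g_isCont] continuous[THEN DERIV_isCont]) auto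
qed

lemma contraction_rate_tendsto: "(contraction_rate \<longlongrightarrow> -1) (at_right 0)"
proof -
  have "(contraction_rate \<longlongrightarrow> 1 - 3 * (1/3 + 1/3) * (0 + 1 - (1/3)\<^sup>2 * 0\<^sup>2 / (1 + 1))) (at_right 0)"
    unfolding contraction_rate_def[abs_def]
    by (intro tendsto_intros S1.eta_at_tendsto S2.eta_at_tendsto S1.feedback_tendsto_0
        S1.speed_at_tendsto_1 S2.speed_at_tendsto_1) auto
  then show ?thesis by simp
qed

lemma eta_at_eq:
  assumes "0 < x" "x < r_common"
  shows "S1.eta_at x = S2.eta_at x"
proof -
  have "S1.eta_at x - S2.eta_at x = 0"
  proof (rule linear_ode_zero_from_right_limit[OF eta_difference_derivative])
    show "isCont (\<lambda>x. contraction_rate x / (2 * x)) y" if "0 < y" "y < r_common" for y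
      using that by (intro continuous_intros contraction_rate_isCont) auto
    have "\<forall>\<^sub>F x in at_right 0. contraction_rate x < 0"
      by (rule order_tendstoD[OF contraction_rate_tendsto]) simp
    then show "\<forall>\<^sub>F x in at_right 0. contraction_rate x / (2 * x) \<le> 0"
      using eventually_at_right_less[of "0::real"] by eventually_elim (simp add: divide_nonpos_pos)
    show "((\<lambda>x. S1.eta_at x - S2.eta_at x) \<longlongrightarrow> 0) (at_right 0)"
      using tendsto_diff[OF S1.eta_at_tendsto S2.eta_at_tendsto] by simp
  qed (use assms in auto)
  then show ?thesis by simp
qed

lemma speed_at_eq:
  assumes "0 < x" "x < r_common"
  shows "S1.speed_at x = S2.speed_at x"
proof -
  have x: "0 < x" "x < S1.r_inf" "x < S2.r_inf" using assms r_common by auto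
  have "(S1.speed_at x)\<^sup>2 = (S2.speed_at x)\<^sup>2"
    by (simp add: S1.speed_at_power2 S2.speed_at_power2 x eta_at_eq assms)
  then show ?thesis
    using S1.speed_at_bounds[OF x(1,2)] S2.speed_at_bounds[OF x(1,3)]
    by (simp add: power2_eq_iff_nonneg)
qed

lemma time_at_eq:
  assumes "0 < x" "x < r_common"
  shows "S1.time_at x = S2.time_at x"
proof -
  have "S1.time_at x - S2.time_at x = 0"
  proof (rule linear_ode_zero_from_right_limit[where q = "\<lambda>_. 0" and a = 0
        and d = "\<lambda>x. S1.time_at x - S2.time_at x" and b = r_common and x = x])
    show "((\<lambda>x. S1.time_at x - S2.time_at x) \<longlongrightarrow> 0) (at_right 0)"
      using tendsto_diff[of S1.time_at 0 "at_right 0" S2.time_at 0] S1.time_at_at_right_0 S2.time_at_at_right_0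
      by (simp add: filterlim_at)
    fix y assume y: "0 < y" "y < r_common"
    have "((\<lambda>x. S1.time_at x - S2.time_at x) has_real_derivative
        1 / S1.speed_at y - 1 / S2.speed_at y) (at y)"
      unfolding S1.speed_at_def S2.speed_at_def
      using y r_common by (intro DERIV_diff S1.time_at_derivative S2.time_at_derivative) auto
    then show "((\<lambda>x. S1.time_at x - S2.time_at x) has_real_derivative
        0 * (S1.time_at y - S2.time_at y)) (at y)" by (simp add: speed_at_eq[OF y])
  qed (use assms in auto)
  then show ?thesis by simp
qed

text \<open>If the first solution stopped at a smaller radius, the second would have speed \<open>0\<close> there.\<close>

lemma r_inf_le: "S2.r_inf \<le> S1.r_inf"
proof (rule ccontr)
  assume "\<not> S2.r_inf \<le> S1.r_inf"
  then have less: "S1.r_inf < S2.r_inf" and common: "r_common = S1.r_inf" by (auto simp: r_common_def)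
  have "((\<lambda>s. S2.speed_at (r1 s)) \<longlongrightarrow> S2.speed_at S1.r_inf) at_top"
    by (rule isCont_tendsto_compose[OF DERIV_isCont[OF S2.speed_at_derivative[OF S1.r_inf_pos less]] S1.r_at_top])
  moreover have "\<forall>\<^sub>F s in at_top. S2.speed_at (r1 s) = \<rho>1 s"
    using eventually_gt_at_top[of 0]
  proof eventually_elim
    case (elim s)
    then show ?case
      using speed_at_eq[of "r1 s"] S1.solution_at(3) S1.r_less_r_inf S1.speed_at_r by (simp add: common)
  qed
  ultimately have "(\<rho>1 \<longlongrightarrow> S2.speed_at S1.r_inf) at_top" by (simp add: tendsto_cong)
  then have "S2.speed_at S1.r_inf = 0"
    using S1.\<rho>_at_top tendsto_unique[OF trivial_limit_at_top_linorder] by blast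
  then show False using S2.speed_at_bounds[OF S1.r_inf_pos less] by simp
qed

end

theorem toy_steady_tip_growth_unique:
  assumes growth1: "toy_steady_tip_growth g \<beta> \<rho>1 r1" and growth2: "toy_steady_tip_growth g \<beta> \<rho>2 r2"
    and g: "\<And>v. isCont g v" and s: "s > 0"
  shows "\<rho>1 s = \<rho>2 s \<and> r1 s = r2 s"
proof -
  interpret tip_growth_pair g \<beta> \<rho>1 r1 \<rho>2 r2
    by unfold_locales (fact growth1 growth2 g)+
  interpret swapped: tip_growth_pair g \<beta> \<rho>2 r2 \<rho>1 r1 ..
  have "S1.r_inf = S2.r_inf" using r_inf_le swapped.r_inf_le by (rule antisym[rotated])
  then have "r_common = S1.r_inf" "r_common = S2.r_inf" by (auto simp: r_common_def)
  then have x: "0 < r1 s" "r1 s < r_common" "r1 s < S2.r_inf"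
    using S1.solution_at(3)[OF s] S1.r_less_r_inf[OF s] by auto
  have "S2.time_at (r1 s) = s" using time_at_eq[OF x(1,2)] S1.time_at_r[OF s] by simp
  then have "r1 s = r2 s" using S2.r_time_at(2)[OF x(1,3)] by simp
  moreover have "\<rho>1 s = \<rho>2 s"
    using speed_at_eq[OF x(1,2)] S1.speed_at_r[OF s] S2.speed_at_r[OF s] \<open>r1 s = r2 s\<close> by simp
  ultimately show ?thesis by simp
qed

section \<open>Bounded Lipschitz functions\<close>

definition bdd_lipschitz :: "('a::metric_space \<Rightarrow> 'b::real_normed_vector) \<Rightarrow> bool" where
  "bdd_lipschitz f \<longleftrightarrow> bounded (range f) \<and> (\<exists>L. L-lipschitz_on UNIV f)"

lemma bdd_lipschitzE:
  assumes "bdd_lipschitz f"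
  obtains M L where "0 \<le> M" "\<And>x. norm (f x) \<le> M" "L-lipschitz_on UNIV f"
proof -
  obtain M L where "\<And>x. norm (f x) \<le> M" "L-lipschitz_on UNIV f"
    using assms unfolding bdd_lipschitz_def bounded_iff by auto
  moreover from this have "0 \<le> M" using norm_ge_zero order_trans by blast
  ultimately show thesis using that by blast
qed

lemma bdd_lipschitzI:
  assumes "\<And>x. norm (f x) \<le> M" "L-lipschitz_on UNIV f"
  shows "bdd_lipschitz f"
  using assms unfolding bdd_lipschitz_def bounded_iff by blast

lemma bdd_lipschitz_const: "bdd_lipschitz (\<lambda>x. c)"
  by (rule bdd_lipschitzI[where M = "norm c"]) (auto intro: lipschitz_on_constant)

lemma bdd_lipschitz_diff:
  assumes "bdd_lipschitz f" "bdd_lipschitz h"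
  shows "bdd_lipschitz (\<lambda>x. f x - h x)"
proof -
  obtain M L where f: "0 \<le> M" "\<And>x. norm (f x) \<le> M" "L-lipschitz_on UNIV f"
    by (rule bdd_lipschitzE[OF assms(1)]) (rule that)
  obtain M' L' where h: "0 \<le> M'" "\<And>x. norm (h x) \<le> M'" "L'-lipschitz_on UNIV h"
    by (rule bdd_lipschitzE[OF assms(2)]) (rule that)
  show ?thesis
  proof (rule bdd_lipschitzI)
    show "norm (f x - h x) \<le> M + M'" for x
      using norm_triangle_ineq4[of "f x" "h x"] f(2)[of x] h(2)[of x] by linarith
  qed (rule lipschitz_on_diff[OF f(3) h(3)])
qed

lemma bdd_lipschitz_mult:
  fixes f h :: "'a::metric_space \<Rightarrow> 'b::real_normed_algebra"
  assumes "bdd_lipschitz f" "bdd_lipschitz h"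
  shows "bdd_lipschitz (\<lambda>x. f x * h x)"
proof -
  obtain M L where f: "0 \<le> M" "\<And>x. norm (f x) \<le> M" "L-lipschitz_on UNIV f"
    by (rule bdd_lipschitzE[OF assms(1)]) (rule that)
  obtain M' L' where h: "0 \<le> M'" "\<And>x. norm (h x) \<le> M'" "L'-lipschitz_on UNIV h"
    by (rule bdd_lipschitzE[OF assms(2)]) (rule that)
  show ?thesis
  proof (rule bdd_lipschitzI)
    show "norm (f x * h x) \<le> M * M'" for x
      using norm_mult_ineq[of "f x" "h x"] mult_mono[OF f(2) h(2) f(1) norm_ge_zero, of x x] by linarith
    show "(M * L' + L * M')-lipschitz_on UNIV (\<lambda>x. f x * h x)"
    proof (rule lipschitz_onI)
      show "0 \<le> M * L' + L * M'"
        using f(1) h(1) lipschitz_on_nonneg[OF f(3)] lipschitz_on_nonneg[OF h(3)] by simp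
      fix x y
      have "f x * h x - f y * h y = f x * (h x - h y) + (f x - f y) * h y" by (simp add: algebra_simps)
      also have "norm \<dots> \<le> norm (f x) * norm (h x - h y) + norm (f x - f y) * norm (h y)"
        by (intro order_trans[OF norm_triangle_ineq] add_mono norm_mult_ineq)
      also have "\<dots> \<le> M * (L' * dist x y) + L * dist x y * M'"
        using f h lipschitz_onD[OF f(3), of x y] lipschitz_onD[OF h(3), of x y] lipschitz_on_nonneg[OF f(3)]
        by (intro add_mono mult_mono) (auto simp: dist_norm)
      finally show "dist (f x * h x) (f y * h y) \<le> (M * L' + L * M') * dist x y"
        by (simp add: dist_norm algebra_simps)
    qed
  qed
qed

lemma bdd_lipschitz_compose:
  assumes "bdd_lipschitz f" and h: "C-lipschitz_on UNIV h"
  shows "bdd_lipschitz (\<lambda>x. f (h x))"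
proof -
  obtain M L where f: "0 \<le> M" "\<And>x. norm (f x) \<le> M" "L-lipschitz_on UNIV f"
    by (rule bdd_lipschitzE[OF assms(1)]) (rule that)
  show ?thesis
    by (rule bdd_lipschitzI[OF f(2) lipschitz_on_compose2[OF h lipschitz_on_subset[OF f(3) subset_UNIV]]])
qed

lemma lipschitz_on_derivative_bound:
  fixes f :: "real \<Rightarrow> real"
  assumes "convex S" "0 \<le> L" "\<And>x. x \<in> S \<Longrightarrow> (f has_real_derivative f' x) (at x within S)"
    and "\<And>x. x \<in> S \<Longrightarrow> \<bar>f' x\<bar> \<le> L"
  shows "L-lipschitz_on S f"
proof (rule lipschitz_onI)
  show "dist (f x) (f y) \<le> L * dist x y" if "x \<in> S" "y \<in> S" for x y
    using field_differentiable_bound[OF assms(1,3), of L x y] assms(4) that by (simp add: dist_norm)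
qed fact

lemma bdd_lipschitz_sin: "bdd_lipschitz (sin :: real \<Rightarrow> real)"
  by (rule bdd_lipschitzI[where M = 1 and L = 1], simp)
    (rule lipschitz_on_derivative_bound[where f' = cos]; auto intro!: derivative_eq_intros)

lemma bdd_lipschitz_cos: "bdd_lipschitz (cos :: real \<Rightarrow> real)"
  by (rule bdd_lipschitzI[where M = 1 and L = 1], simp)
    (rule lipschitz_on_derivative_bound[where f' = "\<lambda>x. - sin x"]; auto intro!: derivative_eq_intros)

lemma bdd_lipschitz_clamp:
  fixes \<phi> :: "real \<Rightarrow> real"
  assumes "a \<le> b" and deriv: "\<And>x. x \<in> {a..b} \<Longrightarrow> (\<phi> has_real_derivative \<phi>' x) (at x within {a..b})"
    and cont: "continuous_on {a..b} \<phi>'"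
  shows "bdd_lipschitz (\<lambda>x. \<phi> (max a (min b x)))"
proof -
  have "bounded (\<phi> ` {a..b})" "bounded (\<phi>' ` {a..b})"
    using cont DERIV_continuous_on[OF deriv]
    by (auto intro!: compact_imp_bounded compact_continuous_image)
  then obtain M L where M: "\<And>x. x \<in> {a..b} \<Longrightarrow> \<bar>\<phi> x\<bar> \<le> M" and L: "\<And>x. x \<in> {a..b} \<Longrightarrow> \<bar>\<phi>' x\<bar> \<le> L"
    unfolding bounded_iff by (metis imageI real_norm_def)
  have clamp_mem: "max a (min b x) \<in> {a..b}" for x using \<open>a \<le> b\<close> by auto
  have "0 \<le> L" using L[of a] \<open>a \<le> b\<close> by (auto intro: order_trans[OF abs_ge_zero])
  then have "L-lipschitz_on {a..b} \<phi>"
    by (intro lipschitz_on_derivative_bound[OF _ _ deriv L]) auto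
  then have "L-lipschitz_on (range (\<lambda>x. max a (min b x))) \<phi>"
    by (rule lipschitz_on_subset) (use clamp_mem in auto)
  moreover have "1-lipschitz_on UNIV (\<lambda>x. max a (min b x))"
    by (rule lipschitz_onI) (auto simp: dist_real_def)
  ultimately have "(L * 1)-lipschitz_on UNIV (\<lambda>x. \<phi> (max a (min b x)))"
    by (intro lipschitz_on_compose2)
  then show ?thesis using M clamp_mem by (intro bdd_lipschitzI[where M = M]) auto
qed

section \<open>First zeros, barriers and monotone limits\<close>

lemma first_zero:
  fixes f :: "real \<Rightarrow> real"
  assumes cont: "continuous_on {a..t} f" and "a \<le> t" "0 < f a" "f t \<le> 0"
  obtains s where "a < s" "s \<le> t" "f s = 0" "\<And>u. a \<le> u \<Longrightarrow> u < s \<Longrightarrow> 0 < f u"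
proof -
  define S where "S = {u \<in> {a..t}. f u \<le> 0}"
  have "closed S"
    unfolding S_def by (intro continuous_on_closed_Collect_le) (auto intro: cont continuous_intros)
  moreover have "S \<noteq> {}" "bdd_below S"
    using assms by (auto simp: S_def intro!: bdd_belowI[of _ a])
  ultimately have "Inf S \<in> S" by (intro closed_contains_Inf)
  then have s: "a \<le> Inf S" "Inf S \<le> t" "f (Inf S) \<le> 0" by (auto simp: S_def)
  have before: "0 < f u" if "a \<le> u" "u < Inf S" for u
  proof (rule ccontr)
    assume "\<not> 0 < f u"
    then have "Inf S \<le> u" using that s \<open>bdd_below S\<close> by (intro cInf_lower) (auto simp: S_def)
    then show False using that by simp
  qed
  have "continuous_on {a..Inf S} f" using cont by (rule continuous_on_subset) (use s in auto)
  then obtain u where u: "a \<le> u" "u \<le> Inf S" "f u = 0"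
    using IVT2'[of f "Inf S" 0 a] s \<open>0 < f a\<close> by auto
  then have "u = Inf S" using before[of u] by force
  moreover have "a \<noteq> Inf S" using s(3) \<open>0 < f a\<close> by auto
  ultimately show thesis using that[of "Inf S"] u s before by auto
qed

lemma barrier_le:
  fixes y :: "real \<Rightarrow> real"
  assumes "a \<le> b" and cont: "continuous_on {a..b} y" and "y a \<le> c"
    and deriv: "\<And>t. a < t \<Longrightarrow> t < b \<Longrightarrow> (y has_real_derivative y' t) (at t)"
    and inward: "\<And>t. a < t \<Longrightarrow> t < b \<Longrightarrow> c < y t \<Longrightarrow> y' t \<le> 0"
  shows "y b \<le> c"
proof (rule ccontr)
  assume "\<not> y b \<le> c"
  have "continuous_on {a..b} (\<lambda>s. y (a + b - s) - c)"
    by (intro continuous_intros continuous_on_compose2[OF cont]) auto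
  then obtain s where s: "a < s" "s \<le> b" "y (a + b - s) - c = 0"
    and after: "\<And>u. a \<le> u \<Longrightarrow> u < s \<Longrightarrow> 0 < y (a + b - u) - c"
    by (rule first_zero[where a = a and t = b]) (use \<open>\<not> y b \<le> c\<close> assms(1,3) in auto)
  have "y b \<le> y (a + b - s)"
  proof (rule DERIV_nonpos_imp_decreasing_open[where f = y])
    show "continuous_on {a + b - s..b} y" using cont by (rule continuous_on_subset) (use s in auto)
    fix t assume t: "a + b - s < t" "t < b"
    then have "c < y t" using after[of "a + b - t"] by simp
    then show "\<exists>D. (y has_real_derivative D) (at t) \<and> D \<le> 0"
      using deriv[of t] inward[of t] t s by (intro exI[of _ "y' t"]) auto
  qed (use s in simp)
  then show False using s(3) \<open>\<not> y b \<le> c\<close> by simp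
qed

lemma mono_bounded_tendsto_at_top:
  fixes f :: "real \<Rightarrow> real"
  assumes mono: "\<And>s t. a \<le> s \<Longrightarrow> s \<le> t \<Longrightarrow> f s \<le> f t" and bounded: "\<And>t. a \<le> t \<Longrightarrow> f t \<le> M"
  obtains l where "(f \<longlongrightarrow> l) at_top" "\<And>t. a \<le> t \<Longrightarrow> f t \<le> l"
proof -
  define l where "l = Sup (f ` {a..})"
  have bdd: "bdd_above (f ` {a..})" using bounded by (auto intro!: bdd_aboveI)
  then have upper: "f t \<le> l" if "a \<le> t" for t
    unfolding l_def using that by (intro cSup_upper) auto
  have "(f \<longlongrightarrow> l) at_top"
  proof (rule increasing_tendsto)
    show "\<forall>\<^sub>F t in at_top. f t \<le> l"
      using eventually_ge_at_top[of a] by eventually_elim (rule upper)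
    fix x assume "x < l"
    then obtain t where t: "a \<le> t" "x < f t"
      unfolding l_def using less_cSup_iff[OF _ bdd] by auto
    show "\<forall>\<^sub>F w in at_top. x < f w"
      using eventually_ge_at_top[of t] by eventually_elim (rule less_le_trans[OF t(2) mono[OF t(1)]])
  qed
  then show thesis using upper that by blast
qed

lemma antimono_derivative_tendsto_0:
  fixes f h :: "real \<Rightarrow> real"
  assumes cont: "continuous_on {0..} f"
    and deriv: "\<And>t. 0 < t \<Longrightarrow> (f has_real_derivative h t) (at t)"
    and antimono: "\<And>s t. 0 \<le> s \<Longrightarrow> s \<le> t \<Longrightarrow> h t \<le> h s"
    and nonneg: "\<And>t. 0 \<le> t \<Longrightarrow> 0 \<le> h t" and bounded: "\<And>t. 0 \<le> t \<Longrightarrow> f t \<le> M"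
  shows "(h \<longlongrightarrow> 0) at_top"
proof (rule decreasing_tendsto)
  show "\<forall>\<^sub>F t in at_top. 0 \<le> h t"
    using eventually_ge_at_top[of 0] by eventually_elim (rule nonneg)
  fix e :: real assume "0 < e"
  have "\<exists>t\<ge>0. h t < e"
  proof (rule ccontr)
    assume "\<not> (\<exists>t\<ge>0. h t < e)"
    then have e_le: "e \<le> h t" if "0 \<le> t" for t using that not_less by blast
    define T where "T = (M - f 0) / e + 1"
    have "0 \<le> T" using bounded[of 0] \<open>0 < e\<close> by (simp add: T_def)
    have "f 0 - e * 0 \<le> f T - e * T"
    proof (rule DERIV_nonneg_imp_increasing_open[OF \<open>0 \<le> T\<close>, where f = "\<lambda>t. f t - e * t"])
      show "continuous_on {0..T} (\<lambda>t. f t - e * t)"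
        by (intro continuous_intros continuous_on_subset[OF cont]) auto
      fix t assume t: "0 < t" "t < T"
      have "((\<lambda>t. f t - e * t) has_real_derivative h t - e) (at t)"
        using deriv[OF t(1)] by (auto intro!: derivative_eq_intros)
      then show "\<exists>D. ((\<lambda>t. f t - e * t) has_real_derivative D) (at t) \<and> 0 \<le> D"
        using e_le[of t] t by (intro exI[of _ "h t - e"]) auto
    qed
    moreover have "e * T = M - f 0 + e" using \<open>0 < e\<close> by (simp add: T_def field_simps)
    ultimately show False using bounded[OF \<open>0 \<le> T\<close>] \<open>0 < e\<close> by simp
  qed
  then obtain t where t: "0 \<le> t" "h t < e" by blast
  show "\<forall>\<^sub>F w in at_top. h w < e"
    using eventually_ge_at_top[of t] by eventually_elim (rule le_less_trans[OF antimono[OF t(1)] t(2)])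
qed

section \<open>A shooting principle\<close>

definition crosses_first :: "(real \<Rightarrow> real) \<Rightarrow> (real \<Rightarrow> real) \<Rightarrow> bool" where
  "crosses_first p q \<longleftrightarrow> (\<exists>t\<ge>0. p t < 0 \<and> (\<forall>u\<in>{0..t}. 0 < q u))"

lemma crosses_first_asym: "crosses_first p q \<Longrightarrow> \<not> crosses_first q p"
proof
  assume "crosses_first p q" "crosses_first q p"
  then obtain s t where "0 \<le> s" "p s < 0" "\<And>u. u \<in> {0..s} \<Longrightarrow> 0 < q u"
    and "0 \<le> t" "q t < 0" "\<And>u. u \<in> {0..t} \<Longrightarrow> 0 < p u"
    unfolding crosses_first_def by blast
  then show False using linorder_linear[of s t] by (metis atLeastAtMost_iff order_less_asym)
qed

lemma continuous_on_section:
  assumes "continuous_on (U \<times> C) (\<lambda>(x, t). f x t)" "x \<in> U"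
  shows "continuous_on C (f x)"
proof -
  have "continuous_on C (Pair x)" "Pair x ` C \<subseteq> U \<times> C"
    using assms(2) by (auto intro!: continuous_intros)
  then show ?thesis using continuous_on_compose2[OF assms(1), of C "Pair x"] by simp
qed

lemma positive_on_tube:
  fixes f :: "'a::topological_space \<Rightarrow> 'b::topological_space \<Rightarrow> real"
  assumes cont: "continuous_on (U \<times> C) (\<lambda>(x, t). f x t)" and "compact C" "x \<in> U"
    and pos: "\<And>t. t \<in> C \<Longrightarrow> 0 < f x t"
  obtains V where "open V" "x \<in> V" "\<And>y t. y \<in> V \<inter> U \<Longrightarrow> t \<in> C \<Longrightarrow> 0 < f y t"
proof (cases "C = {}")
  case True
  then show thesis using that[of UNIV] by simp
next
  case False
  have "continuous_on C (f x)" by (rule continuous_on_section[OF cont \<open>x \<in> U\<close>])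
  then obtain t0 where t0: "t0 \<in> C" "\<And>t. t \<in> C \<Longrightarrow> f x t0 \<le> f x t"
    using continuous_attains_inf[OF \<open>compact C\<close> False] by blast
  have "0 < f x t0 / 2" using pos[OF t0(1)] by simp
  then obtain V where V: "x \<in> V" "open V" "\<forall>y\<in>V \<inter> U. \<forall>t\<in>C. dist (f y t) (f x t) \<le> f x t0 / 2"
    by (rule continuous_on_prod_compactE[OF cont \<open>compact C\<close> \<open>x \<in> U\<close>]) (simp only: prod.case that)
  have "0 < f y t" if "y \<in> V \<inter> U" "t \<in> C" for y t
  proof -
    have "\<bar>f y t - f x t\<bar> \<le> f x t0 / 2" using V(3) that by (auto simp: dist_real_def)
    then show ?thesis using t0(2)[OF that(2)] pos[OF t0(1)] by linarith
  qed
  then show thesis using that V by blast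
qed

lemma openin_crosses_first:
  fixes p q :: "'a::topological_space \<Rightarrow> real \<Rightarrow> real"
  assumes p: "continuous_on (I \<times> {0..}) (\<lambda>(x, t). p x t)" and q: "continuous_on (I \<times> {0..}) (\<lambda>(x, t). q x t)"
  shows "openin (top_of_set I) {x \<in> I. crosses_first (p x) (q x)}"
proof (subst openin_subopen, intro ballI)
  fix x assume "x \<in> {x \<in> I. crosses_first (p x) (q x)}"
  then obtain t where x: "x \<in> I" and t: "0 \<le> t" "p x t < 0" "\<And>u. u \<in> {0..t} \<Longrightarrow> 0 < q x u"
    by (auto simp: crosses_first_def)
  have "continuous_on (I \<times> {t}) (\<lambda>(x, t). - p x t)"
    using continuous_on_minus[OF continuous_on_subset[OF p, of "I \<times> {t}"]] t(1)
    by (auto simp: split_beta)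
  then obtain V where V: "open V" "x \<in> V" "\<And>y u. y \<in> V \<inter> I \<Longrightarrow> u \<in> {t} \<Longrightarrow> 0 < - p y u"
    by (rule positive_on_tube[where x = x]) (use x t(2) in \<open>auto intro: that\<close>)
  have "continuous_on (I \<times> {0..t}) (\<lambda>(x, t). q x t)" using q by (rule continuous_on_subset) auto
  then obtain W where W: "open W" "x \<in> W" "\<And>y u. y \<in> W \<inter> I \<Longrightarrow> u \<in> {0..t} \<Longrightarrow> 0 < q y u"
    by (rule positive_on_tube[where x = x]) (use x t(3) in \<open>auto intro: that\<close>)
  have "openin (top_of_set I) (I \<inter> (V \<inter> W))" using V(1) W(1) by (intro openin_open_Int open_Int)
  moreover have "I \<inter> (V \<inter> W) \<subseteq> {x \<in> I. crosses_first (p x) (q x)}"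
    using V(3)[of _ t] W(3) t(1) by (auto simp: crosses_first_def intro!: exI[of _ t])
  ultimately show "\<exists>T. openin (top_of_set I) T \<and> x \<in> T \<and> T \<subseteq> {x \<in> I. crosses_first (p x) (q x)}"
    using x V(2) W(2) by blast
qed

lemma transversal_zero_crosses_first:
  assumes deriv: "(p has_real_derivative D) (at t)" "D < 0" and "0 < t" "p t = 0"
    and cont: "continuous_on {0..} q" and q_pos: "\<And>u. 0 \<le> u \<Longrightarrow> u \<le> t \<Longrightarrow> 0 < q u"
  shows "crosses_first p q"
proof -
  obtain d where d: "d > 0" "\<And>h. 0 < h \<Longrightarrow> h < d \<Longrightarrow> p (t + h) < p t"
    using DERIV_neg_dec_right[OF deriv] by blast
  have "isCont q t" using cont by (rule continuous_on_interior) (use \<open>0 < t\<close> in simp)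
  then have "(q \<longlongrightarrow> q t) (at_right t)" by (simp add: isCont_def filterlim_at_split)
  then have "\<forall>\<^sub>F u in at_right t. 0 < q u"
    using q_pos[of t] \<open>0 < t\<close> by (intro order_tendstoD(1)[of q "q t"]) auto
  then obtain b where b: "t < b" "\<And>u. t < u \<Longrightarrow> u < b \<Longrightarrow> 0 < q u"
    by (auto simp: eventually_at_right_field)
  define h where "h = min d (b - t) / 2"
  have h: "0 < h" "h < d" "t + h < b" using d(1) b(1) by (auto simp: h_def min_def field_simps)
  have "0 < q u" if "u \<in> {0..t + h}" for u
    using q_pos[of u] b(2)[of u] that h by (cases "u \<le> t") auto
  moreover have "p (t + h) < 0" using d(2)[OF h(1,2)] \<open>p t = 0\<close> by simp
  ultimately show ?thesis
    unfolding crosses_first_def using h(1) \<open>0 < t\<close> by (intro exI[of _ "t + h"]) auto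
qed

definition transversal :: "(real \<Rightarrow> real) \<Rightarrow> (real \<Rightarrow> real) \<Rightarrow> bool" where
  "transversal p q \<longleftrightarrow> (\<forall>t>0. (\<forall>u\<in>{0..<t}. 0 < p u \<and> 0 < q u) \<longrightarrow> p t = 0 \<longrightarrow> 0 < q t \<longrightarrow>
     (\<exists>D<0. (p has_real_derivative D) (at t)))"

lemma transversal_stays_positive:
  assumes cont: "continuous_on {0..} p" "continuous_on {0..} q" and start: "0 < p 0" "0 < q 0"
    and "transversal p q" "transversal q p" and not_both: "\<And>t. 0 < t \<Longrightarrow> p t = 0 \<Longrightarrow> q t \<noteq> 0"
    and "\<not> crosses_first p q" "\<not> crosses_first q p" and "0 \<le> t"
  shows "0 < p t \<and> 0 < q t"
proof (rule ccontr)
  assume "\<not> (0 < p t \<and> 0 < q t)"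
  then have "min (p t) (q t) \<le> 0" by auto
  have "continuous_on {0..t} (\<lambda>u. min (p u) (q u))"
    by (intro continuous_intros continuous_on_subset[OF cont(1)] continuous_on_subset[OF cont(2)]) auto
  then obtain s where s: "0 < s" "s \<le> t" "min (p s) (q s) = 0"
    and before: "\<And>u. 0 \<le> u \<Longrightarrow> u < s \<Longrightarrow> 0 < min (p u) (q u)"
    by (rule first_zero) (use \<open>0 \<le> t\<close> start \<open>min (p t) (q t) \<le> 0\<close> that in auto)
  have False if zero: "p s = 0" "0 < q s" and "transversal p q" and not_first: "\<not> crosses_first p q"
    and cont_q: "continuous_on {0..} q" and before: "\<And>u. 0 \<le> u \<Longrightarrow> u < s \<Longrightarrow> 0 < p u \<and> 0 < q u"
    for p q
  proof -
    obtain D where D: "D < 0" "(p has_real_derivative D) (at s)"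
      using \<open>transversal p q\<close> before s(1) zero unfolding transversal_def by auto
    have "0 < q u" if "0 \<le> u" "u \<le> s" for u
      using before[of u] zero(2) that by (cases "u = s") auto
    then show False
      using transversal_zero_crosses_first[OF D(2,1) s(1) zero(1) cont_q] not_first by blast
  qed
  moreover have "p s = 0 \<and> 0 < q s \<or> q s = 0 \<and> 0 < p s"
    using s(3) not_both[OF s(1)] by (auto simp: min_def split: if_splits)
  ultimately show False using assms before by (metis min_less_iff_conj)
qed

theorem shooting:
  fixes p q :: "'a::topological_space \<Rightarrow> real \<Rightarrow> real"
  assumes "connected I"
    and p: "continuous_on (I \<times> {0..}) (\<lambda>(x, t). p x t)" and q: "continuous_on (I \<times> {0..}) (\<lambda>(x, t). q x t)"
    and start: "\<And>x. x \<in> I \<Longrightarrow> 0 < p x 0 \<and> 0 < q x 0"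
    and transversal: "\<And>x. x \<in> I \<Longrightarrow> transversal (p x) (q x) \<and> transversal (q x) (p x)"
    and not_both: "\<And>x t. x \<in> I \<Longrightarrow> 0 < t \<Longrightarrow> p x t = 0 \<Longrightarrow> q x t \<noteq> 0"
    and a: "a \<in> I" "\<not> crosses_first (p a) (q a)" and b: "b \<in> I" "\<not> crosses_first (q b) (p b)"
  obtains x where "x \<in> I" "\<And>t. 0 \<le> t \<Longrightarrow> 0 < p x t \<and> 0 < q x t"
proof -
  define P where "P = {x \<in> I. crosses_first (p x) (q x)}"
  define Q where "Q = {x \<in> I. crosses_first (q x) (p x)}"
  have "openin (top_of_set I) P" "openin (top_of_set I) Q"
    unfolding P_def Q_def by (rule openin_crosses_first[OF p q] openin_crosses_first[OF q p])+
  moreover have "P \<inter> Q = {}" using crosses_first_asym by (auto simp: P_def Q_def)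
  moreover have "a \<notin> P" "b \<notin> Q" using a b by (auto simp: P_def Q_def)
  ultimately have "\<not> I \<subseteq> P \<union> Q"
    using \<open>connected I\<close> a(1) b(1) unfolding connected_openin by blast
  then obtain x where x: "x \<in> I" "\<not> crosses_first (p x) (q x)" "\<not> crosses_first (q x) (p x)"
    by (auto simp: P_def Q_def)
  have "continuous_on {0..} (p x)" "continuous_on {0..} (q x)"
    by (rule continuous_on_section[OF p x(1)] continuous_on_section[OF q x(1)])+
  then have "0 < p x t \<and> 0 < q x t" if "0 \<le> t" for t
    using start[OF x(1)] transversal[OF x(1)] not_both[OF x(1)] x(2,3) that
    by (intro transversal_stays_positive) auto
  then show thesis using x(1) that by blast
qed

section \<open>The shooting family\<close>

text \<open>\<open>toy_excess\<close> is \<open>N - 1\<close>.\<close>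

definition toy_excess :: "(real \<Rightarrow> real) \<Rightarrow> real \<Rightarrow> real \<Rightarrow> real \<Rightarrow> real" where
  "toy_excess g \<beta> \<rho> r = sqrt (1 - \<rho>\<^sup>2) / r * (\<beta> * r\<^sup>2 * g (r\<^sup>2) + \<rho>) - 1"

lemma toy_rhs_eq_excess: "toy_rhs g \<beta> \<rho> r = 3/2 * (1 - \<rho>\<^sup>2) / r * toy_excess g \<beta> \<rho> r"
  by (simp add: toy_rhs_def toy_excess_def)

locale toy_nonlinearity =
  fixes g :: "real \<Rightarrow> real"
  assumes analytic: "real_analytic_on g UNIV"
    and g_pos: "v > 0 \<Longrightarrow> g v > 0"
    and g_deriv_nonneg: "v > 0 \<Longrightarrow> deriv g v \<ge> 0"
    and feedback_convex: "v > 0 \<Longrightarrow> deriv (deriv (\<lambda>v. v\<^sup>2 * g (v\<^sup>2))) v > 0"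
begin

definition feedback :: "real \<Rightarrow> real" where "feedback = (\<lambda>x. x\<^sup>2 * g (x\<^sup>2))"

lemma g_has_derivative: "(g has_real_derivative deriv g v) (at v)"
  using real_analytic_on_has_derivative[OF analytic] by simp

lemma g_mono: "0 < a \<Longrightarrow> a \<le> b \<Longrightarrow> g a \<le> g b"
proof (rule DERIV_nonneg_imp_nondecreasing[where f = g])
  show "\<exists>y. (g has_real_derivative y) (at x) \<and> 0 \<le> y" if "0 < a" "a \<le> x" for x
    using g_has_derivative[of x] g_deriv_nonneg[of x] that by auto
qed

lemma feedback_pos: "0 < x \<Longrightarrow> 0 < feedback x"
  by (simp add: feedback_def g_pos)

lemma feedback_ratio_mono:
  assumes "0 < x" "x \<le> y"
  shows "feedback x / x \<le> feedback y / y"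
proof -
  have "x\<^sup>2 \<le> y\<^sup>2" using assms by (intro power_mono) auto
  then have "x * g (x\<^sup>2) \<le> y * g (y\<^sup>2)"
    using assms g_mono[of "x\<^sup>2" "y\<^sup>2"] g_pos[of "x\<^sup>2"] by (intro mult_mono) auto
  then show ?thesis using assms by (simp add: feedback_def power2_eq_square)
qed

lemma feedback_mono:
  assumes "0 < x" "x \<le> y"
  shows "feedback x \<le> feedback y"
proof -
  have "x * (feedback x / x) \<le> y * (feedback y / y)"
    using assms feedback_ratio_mono[OF assms] feedback_pos[of x] by (intro mult_mono) auto
  then show ?thesis using assms by simp
qed

lemma feedback_has_derivative: "(feedback has_real_derivative deriv feedback x) (at x)"
  and feedback_deriv_has_derivative:
    "(deriv feedback has_real_derivative deriv (deriv feedback) x) (at x)"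
proof -
  define f' where "f' = (\<lambda>x. 2 * x * g (x\<^sup>2) + x\<^sup>2 * (deriv g (x\<^sup>2) * (2 * x)))"
  have g_square: "((\<lambda>x. g (x\<^sup>2)) has_real_derivative deriv g (x\<^sup>2) * (2 * x)) (at x)" for x
    by (rule DERIV_chain2[OF g_has_derivative]) (auto intro!: derivative_eq_intros)
  have "(deriv g has_real_derivative deriv (deriv g) v) (at v)" for v
    using real_analytic_on_has_derivative[OF real_analytic_on_deriv[OF analytic]] by simp
  then have g'_square: "((\<lambda>x. deriv g (x\<^sup>2)) has_real_derivative deriv (deriv g) (x\<^sup>2) * (2 * x)) (at x)" for x
    by (rule DERIV_chain2) (auto intro!: derivative_eq_intros)
  have feedback': "(feedback has_real_derivative f' x) (at x)" for x
    unfolding feedback_def f'_def by (rule derivative_eq_intros g_square refl)+ simp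
  then have deriv_eq: "deriv feedback = f'" by (auto intro: DERIV_imp_deriv)
  show "(feedback has_real_derivative deriv feedback x) (at x)" using feedback' deriv_eq by simp
  have "\<exists>D. (f' has_real_derivative D) (at x)"
    unfolding f'_def by (rule exI) (rule derivative_intros g_square g'_square)+
  then show "(deriv feedback has_real_derivative deriv (deriv feedback) x) (at x)"
    unfolding deriv_eq using DERIV_imp_deriv by blast
qed

lemma feedback_deriv2_pos: "0 < x \<Longrightarrow> 0 < deriv (deriv feedback) x"
  unfolding feedback_def by (rule feedback_convex)

lemma feedback_continuous_on: "continuous_on S feedback"
  using feedback_has_derivative by (auto intro: continuous_at_imp_continuous_on DERIV_isCont)

end

text \<open>The shooting argument runs in the angle \<open>\<rho> = cos \<theta>\<close>, with \<open>\<beta>\<close> as a third, constant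
  coordinate; clamping \<open>r\<close> and \<open>\<beta>\<close> makes the vector field globally Lipschitz.\<close>

locale toy_shooting = toy_nonlinearity +
  fixes r0 R \<beta>1 \<beta>2 :: real and \<theta>0 :: "real \<Rightarrow> real"
  assumes radii: "0 < r0" "r0 < 5" "r0 < R" and parameters: "0 < \<beta>1" "\<beta>1 \<le> \<beta>2"
    and \<beta>1_small: "\<beta>1 * feedback 5 \<le> 1/7"
    and \<beta>2_large: "12/25 \<le> 4/5 * (\<beta>2 * feedback (12/25))"
    and initial_angle: "\<beta> \<in> {\<beta>1..\<beta>2} \<Longrightarrow> 0 < \<theta>0 \<beta> \<and> \<theta>0 \<beta> < pi/2"
    and initial_cos: "\<beta> \<in> {\<beta>1..\<beta>2} \<Longrightarrow> 3/5 < cos (\<theta>0 \<beta>)"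
    and initial_eta: "\<beta> \<in> {\<beta>1..\<beta>2} \<Longrightarrow> 7/24 \<le> sin (\<theta>0 \<beta>) / r0 \<and> sin (\<theta>0 \<beta>) / r0 \<le> 3/8"
    and initial_excess: "\<beta> \<in> {\<beta>1..\<beta>2} \<Longrightarrow> toy_excess g \<beta> (cos (\<theta>0 \<beta>)) r0 < 0"
    and initial_continuous: "continuous_on {\<beta>1..\<beta>2} \<theta>0"
    and R_large: "\<beta> \<in> {\<beta>1..\<beta>2} \<Longrightarrow> 1 < sin (\<theta>0 \<beta>) / R * (\<beta> * feedback R)"
begin

definition clamp_radius :: "real \<Rightarrow> real" where "clamp_radius r = max (r0 / 2) (min R r)"

definition clamp_parameter :: "real \<Rightarrow> real" where "clamp_parameter \<beta> = max \<beta>1 (min \<beta>2 \<beta>)"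

definition excess_at :: "real \<Rightarrow> real \<Rightarrow> real \<Rightarrow> real" where
  "excess_at \<beta> \<theta> r = sin \<theta> / clamp_radius r * (\<beta> * feedback (clamp_radius r) + cos \<theta>) - 1"

definition field :: "real \<times> real \<times> real \<Rightarrow> real \<times> real \<times> real" where
  "field = (\<lambda>(\<theta>, r, \<beta>). (- (3/2 * (sin \<theta> / clamp_radius r) * excess_at (clamp_parameter \<beta>) \<theta> r), cos \<theta>, 0))"

lemma clamp_radius_pos: "0 < clamp_radius r" and clamp_radius_nonzero: "clamp_radius r \<noteq> 0"
  using radii by (auto simp: clamp_radius_def)

lemma clamp_radius_id: "r0 \<le> r \<Longrightarrow> r \<le> R \<Longrightarrow> clamp_radius r = r"
  using radii by (simp add: clamp_radius_def)

lemma clamp_radius_continuous: "continuous_on S f \<Longrightarrow> continuous_on S (\<lambda>x. clamp_radius (f x))"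
  unfolding clamp_radius_def by (intro continuous_intros)

lemma clamp_parameter_id: "\<beta> \<in> {\<beta>1..\<beta>2} \<Longrightarrow> clamp_parameter \<beta> = \<beta>"
  by (simp add: clamp_parameter_def)

lemma bdd_lipschitz_inverse_clamp_radius: "bdd_lipschitz (\<lambda>r. 1 / clamp_radius r)"
  unfolding clamp_radius_def
  by (rule bdd_lipschitz_clamp[where \<phi>' = "\<lambda>r. - (1 / r\<^sup>2)"])
    (use radii in \<open>auto intro!: derivative_eq_intros continuous_intros simp: power2_eq_square field_simps\<close>)

lemma bdd_lipschitz_feedback_clamp_radius: "bdd_lipschitz (\<lambda>r. feedback (clamp_radius r))"
  unfolding clamp_radius_def
proof (rule bdd_lipschitz_clamp[where \<phi>' = "deriv feedback"])
  show "(feedback has_real_derivative deriv feedback r) (at r within S)" for r S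
    by (rule has_field_derivative_at_within[OF feedback_has_derivative])
  show "continuous_on {r0 / 2..R} (deriv feedback)"
    using feedback_deriv_has_derivative by (auto intro: continuous_at_imp_continuous_on DERIV_isCont)
qed (use radii in simp)

lemma bdd_lipschitz_clamp_parameter: "bdd_lipschitz clamp_parameter"
  unfolding clamp_parameter_def[abs_def]
  by (rule bdd_lipschitz_clamp[where \<phi>' = "\<lambda>_. 1"]) (use parameters in auto)

lemma field_lipschitz: obtains L where "L-lipschitz_on UNIV field"
proof -
  have fst: "1-lipschitz_on UNIV (\<lambda>x :: real \<times> real \<times> real. fst x)"
    and fst_snd: "1-lipschitz_on UNIV (\<lambda>x :: real \<times> real \<times> real. fst (snd x))"
    and snd_snd: "1-lipschitz_on UNIV (\<lambda>x :: real \<times> real \<times> real. snd (snd x))"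
    by (rule lipschitz_onI; simp add: dist_fst_le order_trans[OF dist_fst_le dist_snd_le]
        order_trans[OF dist_snd_le dist_snd_le])+
  note bdd_lipschitz_intros = bdd_lipschitz_diff bdd_lipschitz_mult bdd_lipschitz_const
    bdd_lipschitz_compose[OF bdd_lipschitz_sin fst] bdd_lipschitz_compose[OF bdd_lipschitz_cos fst]
    bdd_lipschitz_compose[OF bdd_lipschitz_inverse_clamp_radius fst_snd]
    bdd_lipschitz_compose[OF bdd_lipschitz_feedback_clamp_radius fst_snd]
    bdd_lipschitz_compose[OF bdd_lipschitz_clamp_parameter snd_snd]
  define \<eta> where "\<eta> = (\<lambda>x :: real \<times> real \<times> real. sin (fst x) * (1 / clamp_radius (fst (snd x))))"
  have "bdd_lipschitz \<eta>" unfolding \<eta>_def by (intro bdd_lipschitz_intros)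
  then have "bdd_lipschitz (\<lambda>x. 3/2 * \<eta> x * (1 - \<eta> x * (clamp_parameter (snd (snd x)) *
      feedback (clamp_radius (fst (snd x)))) - \<eta> x * cos (fst x)))"
    by (intro bdd_lipschitz_intros)
  moreover have "3/2 * \<eta> x * (1 - \<eta> x * (clamp_parameter (snd (snd x)) *
      feedback (clamp_radius (fst (snd x)))) - \<eta> x * cos (fst x)) = fst (field x)" for x
    by (simp add: field_def split_beta excess_at_def \<eta>_def algebra_simps)
  ultimately have "bdd_lipschitz (\<lambda>x. fst (field x))" by (simp only:)
  then obtain L where "L-lipschitz_on UNIV (\<lambda>x. fst (field x))" by (rule bdd_lipschitzE)
  moreover obtain C where "C-lipschitz_on UNIV (\<lambda>x :: real \<times> real \<times> real. cos (fst x))"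
    by (rule bdd_lipschitzE[OF bdd_lipschitz_compose[OF bdd_lipschitz_cos fst]])
  ultimately have "(sqrt (L\<^sup>2 + (sqrt (C\<^sup>2 + 0\<^sup>2))\<^sup>2))-lipschitz_on UNIV
      (\<lambda>x. (fst (field x), cos (fst x), 0 :: real))"
    by (intro lipschitz_on_Pair lipschitz_on_constant)
  moreover have "(\<lambda>x. (fst (field x), cos (fst x), 0)) = field" by (auto simp: field_def)
  ultimately have "(sqrt (L\<^sup>2 + (sqrt (C\<^sup>2 + 0\<^sup>2))\<^sup>2))-lipschitz_on UNIV field" by (simp only:)
  then show thesis by (rule that)
qed

definition flow :: "real \<Rightarrow> real \<Rightarrow> real \<times> real \<times> real" where
  "flow \<beta> = (SOME x. x 0 = (\<theta>0 \<beta>, r0, \<beta>) \<and> ode_solution field x)"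

definition angle :: "real \<Rightarrow> real \<Rightarrow> real" where "angle \<beta> t = fst (flow \<beta> t)"

definition radius :: "real \<Rightarrow> real \<Rightarrow> real" where "radius \<beta> t = fst (snd (flow \<beta> t))"

definition eta :: "real \<Rightarrow> real \<Rightarrow> real" where "eta \<beta> t = sin (angle \<beta> t) / clamp_radius (radius \<beta> t)"

definition excess :: "real \<Rightarrow> real \<Rightarrow> real" where "excess \<beta> t = excess_at \<beta> (angle \<beta> t) (radius \<beta> t)"

lemma flow_0: "flow \<beta> 0 = (\<theta>0 \<beta>, r0, \<beta>)" and flow_solution: "ode_solution field (flow \<beta>)"
proof -
  obtain L where "L-lipschitz_on UNIV field" by (rule field_lipschitz)
  then have "\<exists>x. x 0 = (\<theta>0 \<beta>, r0, \<beta>) \<and> ode_solution field x"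
    using ode_solution_exists by metis
  from someI_ex[OF this] show "flow \<beta> 0 = (\<theta>0 \<beta>, r0, \<beta>)" "ode_solution field (flow \<beta>)"
    unfolding flow_def by auto
qed

lemma flow_meets_initial:
  assumes "ode_solution field x" "0 \<le> t" "flow \<beta> t = x t"
  shows "x 0 = (\<theta>0 \<beta>, r0, \<beta>)"
proof -
  obtain L where "L-lipschitz_on UNIV field" by (rule field_lipschitz)
  from ode_solution_backward_unique[OF this flow_solution assms] show ?thesis by (simp add: flow_0)
qed

lemma flow_continuous: "continuous_on ({\<beta>1..\<beta>2} \<times> {0..}) (\<lambda>(\<beta>, t). flow \<beta> t)"
proof -
  obtain L where "L-lipschitz_on UNIV field" by (rule field_lipschitz)
  then show ?thesis
    by (rule ode_solution_family_continuous_on)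
      (simp_all add: flow_solution flow_0 continuous_intros initial_continuous)
qed

lemma angle_continuous: "continuous_on ({\<beta>1..\<beta>2} \<times> {0..}) (\<lambda>(\<beta>, t). angle \<beta> t)"
  and radius_continuous: "continuous_on ({\<beta>1..\<beta>2} \<times> {0..}) (\<lambda>(\<beta>, t). radius \<beta> t)"
  using continuous_on_fst[OF flow_continuous] continuous_on_fst[OF continuous_on_snd[OF flow_continuous]]
  by (simp_all add: angle_def radius_def split_beta)

lemma excess_continuous: "continuous_on ({\<beta>1..\<beta>2} \<times> {0..}) (\<lambda>(\<beta>, t). excess \<beta> t)"
  using angle_continuous radius_continuous
  unfolding excess_def excess_at_def split_beta
  by (intro continuous_intros clamp_radius_continuous
      continuous_on_compose2[OF feedback_continuous_on[of UNIV]]) (auto simp: clamp_radius_nonzero)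

lemma flow_derivative_within:
  "0 \<le> t \<Longrightarrow> (flow \<beta> has_vector_derivative field (flow \<beta> t)) (at t within {0..})"
  by (rule ode_solution_derivative_within[OF flow_solution])

lemma flow_parameter:
  assumes "0 \<le> t"
  shows "snd (snd (flow \<beta> t)) = \<beta>"
proof -
  have "((\<lambda>t. snd (snd (flow \<beta> t))) has_vector_derivative 0) (at s within {0..})" if "s \<in> {0..}" for s
  proof -
    have "((\<lambda>t. snd (snd (flow \<beta> t))) has_vector_derivative snd (snd (field (flow \<beta> s)))) (at s within {0..})"
      using that by (intro bounded_linear.has_vector_derivative[OF bounded_linear_snd] flow_derivative_within) simp
    then show ?thesis by (simp add: field_def split_beta)
  qed
  then obtain c where "\<And>s. s \<in> {0..} \<Longrightarrow> snd (snd (flow \<beta> s)) = c"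
    by (rule has_vector_derivative_zero_constant[OF convex_real_interval(1)]) blast+
  then show ?thesis using assms by (metis atLeast_iff flow_0 order_refl snd_conv)
qed

lemma flow_eq: "0 \<le> t \<Longrightarrow> flow \<beta> t = (angle \<beta> t, radius \<beta> t, \<beta>)"
  using flow_parameter[of t \<beta>] by (simp add: angle_def radius_def prod_eq_iff)

lemma angle_0: "angle \<beta> 0 = \<theta>0 \<beta>" and radius_0: "radius \<beta> 0 = r0"
  by (simp_all add: angle_def radius_def flow_0)

lemma eta_0: "eta \<beta> 0 = sin (\<theta>0 \<beta>) / r0"
  using radii by (simp add: eta_def angle_0 radius_0 clamp_radius_id)

lemma radius_derivative_within:
  assumes "0 \<le> t"
  shows "(radius \<beta> has_real_derivative cos (angle \<beta> t)) (at t within {0..})"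
proof -
  have "(radius \<beta> has_vector_derivative fst (snd (field (flow \<beta> t)))) (at t within {0..})"
    unfolding radius_def[abs_def]
    by (intro bounded_linear.has_vector_derivative[OF bounded_linear_fst]
        bounded_linear.has_vector_derivative[OF bounded_linear_snd] flow_derivative_within assms)
  then show ?thesis
    by (simp add: field_def flow_eq[OF assms] has_real_derivative_iff_has_vector_derivative)
qed

lemma radius_derivative: "0 < t \<Longrightarrow> (radius \<beta> has_real_derivative cos (angle \<beta> t)) (at t)"
  using radius_derivative_within[of t \<beta>] by (simp add: at_within_atLeast)

lemma radius_continuous_on: "continuous_on {0..} (radius \<beta>)"
  by (rule DERIV_continuous_on) (auto intro: radius_derivative_within)

context
  fixes \<beta> assumes \<beta>: "\<beta> \<in> {\<beta>1..\<beta>2}"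
begin

lemma parameter_pos: "0 < \<beta>"
  using \<beta> parameters by simp

lemma excess_eq: "excess \<beta> t = eta \<beta> t * (\<beta> * feedback (clamp_radius (radius \<beta> t)) + cos (angle \<beta> t)) - 1"
  by (simp add: excess_def excess_at_def eta_def)

lemma angle_derivative_within:
  assumes "0 \<le> t"
  shows "(angle \<beta> has_real_derivative - (3/2 * eta \<beta> t * excess \<beta> t)) (at t within {0..})"
proof -
  have "(angle \<beta> has_vector_derivative fst (field (flow \<beta> t))) (at t within {0..})"
    unfolding angle_def[abs_def]
    by (intro bounded_linear.has_vector_derivative[OF bounded_linear_fst] flow_derivative_within assms)
  then show ?thesis
    by (simp add: field_def flow_eq[OF assms] eta_def excess_def clamp_parameter_id[OF \<beta>]
        has_real_derivative_iff_has_vector_derivative)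
qed

lemma angle_derivative: "0 < t \<Longrightarrow> (angle \<beta> has_real_derivative - (3/2 * eta \<beta> t * excess \<beta> t)) (at t)"
  using angle_derivative_within[of t] by (simp add: at_within_atLeast)

lemma angle_continuous_on: "continuous_on {0..} (angle \<beta>)"
  by (rule DERIV_continuous_on) (auto intro: angle_derivative_within)

lemma cos_angle_continuous_on: "continuous_on {0..} (\<lambda>t. cos (angle \<beta> t))"
  by (intro continuous_intros angle_continuous_on)

lemma eta_continuous_on: "continuous_on {0..} (eta \<beta>)"
  unfolding eta_def[abs_def]
  by (intro continuous_intros clamp_radius_continuous angle_continuous_on radius_continuous_on)
    (simp add: clamp_radius_nonzero)

lemma excess_continuous_on: "continuous_on {0..} (excess \<beta>)"
  using continuous_on_section[OF excess_continuous \<beta>] .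

lemma angle_neq_equilibrium:
  assumes "0 \<le> t" "sin a = 0" "\<theta>0 \<beta> \<noteq> a"
  shows "angle \<beta> t \<noteq> a"
proof
  assume "angle \<beta> t = a"
  define y where "y = (\<lambda>s. (a, radius \<beta> t + cos a * (s - t), \<beta>))"
  have "(y has_vector_derivative field (y s)) (at s within {0..})" for s
  proof -
    have "(y has_vector_derivative (0, cos a, 0)) (at s within {0..})"
      unfolding y_def by (auto intro!: derivative_eq_intros has_vector_derivative_Pair
          simp: has_real_derivative_iff_has_vector_derivative[symmetric])
    then show ?thesis by (simp add: y_def field_def \<open>sin a = 0\<close>)
  qed
  then have "ode_solution field y" by (simp add: ode_solution_def)
  moreover have "flow \<beta> t = y t" using \<open>angle \<beta> t = a\<close> by (simp add: y_def flow_eq[OF \<open>0 \<le> t\<close>])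
  ultimately have "y 0 = (\<theta>0 \<beta>, r0, \<beta>)" using \<open>0 \<le> t\<close> by (intro flow_meets_initial)
  then show False using \<open>\<theta>0 \<beta> \<noteq> a\<close> by (simp add: y_def)
qed

lemma angle_range:
  assumes "0 \<le> t"
  shows "0 < angle \<beta> t" "angle \<beta> t < pi"
proof -
  have initial: "0 < \<theta>0 \<beta>" "\<theta>0 \<beta> < pi" using initial_angle[OF \<beta>] pi_gt_zero by auto
  have cont: "continuous_on {0..t} (angle \<beta>)" using angle_continuous_on by (rule continuous_on_subset) auto
  show "0 < angle \<beta> t"
  proof (rule ccontr)
    assume "\<not> 0 < angle \<beta> t"
    then obtain s where "0 \<le> s" "angle \<beta> s = 0"
      using IVT2'[of "angle \<beta>" t 0 0] cont assms initial angle_0 by auto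
    then show False using angle_neq_equilibrium[of s 0] initial by auto
  qed
  show "angle \<beta> t < pi"
  proof (rule ccontr)
    assume "\<not> angle \<beta> t < pi"
    then obtain s where "0 \<le> s" "angle \<beta> s = pi"
      using IVT'[of "angle \<beta>" 0 pi t] cont assms initial angle_0 by auto
    then show False using angle_neq_equilibrium[of s pi] initial by auto
  qed
qed

lemma sin_angle_pos: "0 \<le> t \<Longrightarrow> 0 < sin (angle \<beta> t)"
  using angle_range[of t] by (intro sin_gt_zero)

lemma eta_pos: "0 \<le> t \<Longrightarrow> 0 < eta \<beta> t"
  by (simp add: eta_def sin_angle_pos clamp_radius_pos)

definition descending :: "real \<Rightarrow> bool" where
  "descending t \<longleftrightarrow> 0 \<le> t \<and> (\<forall>u\<in>{0..t}. excess \<beta> u \<le> 0 \<and> 0 \<le> cos (angle \<beta> u))"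

lemma descendingD: "descending t \<Longrightarrow> 0 \<le> t \<and> excess \<beta> t \<le> 0 \<and> 0 \<le> cos (angle \<beta> t)"
  by (auto simp: descending_def)

lemma descending_mono: "descending t \<Longrightarrow> 0 \<le> u \<Longrightarrow> u \<le> t \<Longrightarrow> descending u"
  by (auto simp: descending_def)

lemma descending_radius_mono:
  assumes "descending t" "0 \<le> u" "u \<le> t"
  shows "radius \<beta> u \<le> radius \<beta> t"
proof (rule DERIV_nonneg_imp_increasing_open[OF \<open>u \<le> t\<close>, where f = "radius \<beta>"])
  show "continuous_on {u..t} (radius \<beta>)"
    using radius_continuous_on by (rule continuous_on_subset) (use assms in auto)
  fix s assume s: "u < s" "s < t"
  then have "0 \<le> cos (angle \<beta> s)" using descendingD[OF descending_mono[OF assms(1), of s]] assms(2) by simp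
  then show "\<exists>y. (radius \<beta> has_real_derivative y) (at s) \<and> 0 \<le> y"
    using radius_derivative[of s \<beta>] s assms(2) by auto
qed

lemma descending_angle_mono:
  assumes "descending t" "0 \<le> u" "u \<le> t"
  shows "angle \<beta> u \<le> angle \<beta> t"
proof (rule DERIV_nonneg_imp_increasing_open[OF \<open>u \<le> t\<close>, where f = "angle \<beta>"])
  show "continuous_on {u..t} (angle \<beta>)"
    using angle_continuous_on by (rule continuous_on_subset) (use assms in auto)
  fix s assume s: "u < s" "s < t"
  then have "excess \<beta> s \<le> 0" using descendingD[OF descending_mono[OF assms(1), of s]] assms(2) by simp
  then have "0 \<le> - (3/2 * eta \<beta> s * excess \<beta> s)"
    using eta_pos[of s] s assms(2) by (simp add: mult_nonneg_nonpos)
  then show "\<exists>y. (angle \<beta> has_real_derivative y) (at s) \<and> 0 \<le> y"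
    using angle_derivative[of s] s assms(2) by auto
qed

lemma descending_sin_angle_ge:
  assumes "descending t"
  shows "sin (\<theta>0 \<beta>) \<le> sin (angle \<beta> t)"
proof -
  have t: "0 \<le> t" "0 \<le> cos (angle \<beta> t)" using descendingD[OF assms] by auto
  have "angle \<beta> t \<le> pi/2"
  proof (rule ccontr)
    assume "\<not> angle \<beta> t \<le> pi/2"
    then have "cos (angle \<beta> t) < 0" using angle_range[OF t(1)] by (intro cos_lt_zero_pi) auto
    then show False using t(2) by simp
  qed
  moreover have "\<theta>0 \<beta> \<le> angle \<beta> t"
    using descending_angle_mono[OF assms, of 0] t(1) by (simp add: angle_0)
  ultimately show ?thesis using initial_angle[OF \<beta>] by (intro sin_monotone_2pi_le) auto
qed

lemma descending_radius_bounds: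
  assumes "descending t"
  shows "r0 \<le> radius \<beta> t" "radius \<beta> t < R"
proof -
  have t: "0 \<le> t" "excess \<beta> t \<le> 0" "0 \<le> cos (angle \<beta> t)" using descendingD[OF assms] by auto
  show "r0 \<le> radius \<beta> t"
    using descending_radius_mono[OF assms, of 0] t(1) by (simp add: radius_0)
  show "radius \<beta> t < R"
  proof (rule ccontr)
    assume "\<not> radius \<beta> t < R"
    then have clamp: "clamp_radius (radius \<beta> t) = R" using radii by (simp add: clamp_radius_def)
    have "1 < sin (\<theta>0 \<beta>) / R * (\<beta> * feedback R)" by (rule R_large[OF \<beta>])
    also have "\<dots> \<le> sin (angle \<beta> t) / R * (\<beta> * feedback R)"
      using descending_sin_angle_ge[OF assms] radii parameter_pos feedback_pos[of R]
      by (intro mult_right_mono divide_right_mono) auto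
    also have "\<dots> = eta \<beta> t * (\<beta> * feedback R)" by (simp add: eta_def clamp)
    also have "\<dots> \<le> eta \<beta> t * (\<beta> * feedback R + cos (angle \<beta> t))"
      using t(3) eta_pos[OF t(1)] by (intro mult_left_mono) auto
    also have "\<dots> \<le> 1" using t(2) by (simp add: excess_eq clamp)
    finally show False by simp
  qed
qed

lemma descending_radius_pos: "descending t \<Longrightarrow> 0 < radius \<beta> t"
  using descending_radius_bounds(1) radii(1) by force

lemma descending_clamp_radius: "descending t \<Longrightarrow> clamp_radius (radius \<beta> t) = radius \<beta> t"
  using descending_radius_bounds by (intro clamp_radius_id) (auto intro: less_imp_le)

lemma descending_eta_eq: "descending t \<Longrightarrow> eta \<beta> t = sin (angle \<beta> t) / radius \<beta> t"
  by (simp add: eta_def descending_clamp_radius)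

lemma descending_excess_eq:
  "descending t \<Longrightarrow> excess \<beta> t = eta \<beta> t * (\<beta> * feedback (radius \<beta> t) + cos (angle \<beta> t)) - 1"
  by (simp add: excess_eq descending_clamp_radius)

lemma descending_clamp_radius_derivative:
  assumes "descending t" "0 < t"
  shows "((\<lambda>t. clamp_radius (radius \<beta> t)) has_real_derivative cos (angle \<beta> t)) (at t)"
proof -
  have "(clamp_radius has_real_derivative 1) (at (radius \<beta> t))"
    by (rule has_field_derivative_transform_within_open[OF DERIV_ident open_greaterThanLessThan[of "r0 / 2" R]])
      (use descending_radius_bounds[OF assms(1)] radii in \<open>auto simp: clamp_radius_def\<close>)
  from DERIV_chain2[OF this radius_derivative[OF assms(2)]] show ?thesis by simp
qed

lemma eta_derivative:
  assumes t: "descending t" "0 < t"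
  shows "(eta \<beta> has_real_derivative
    cos (angle \<beta> t) * eta \<beta> t * (1 - 3 * (excess \<beta> t + 1)) / (2 * radius \<beta> t)) (at t)"
proof -
  define s where "s = sin (angle \<beta> t)"
  define c where "c = cos (angle \<beta> t)"
  define r where "r = radius \<beta> t"
  have r: "0 < r" using descending_radius_pos[OF t(1)] by (simp add: r_def)
  have eta: "eta \<beta> t = s / r" by (simp add: s_def r_def descending_eta_eq[OF t(1)])
  have "((\<lambda>t. sin (angle \<beta> t)) has_real_derivative c * - (3/2 * (s / r) * excess \<beta> t)) (at t)"
    using angle_derivative[OF t(2)] by (auto intro!: derivative_eq_intros simp: eta c_def)
  from DERIV_divide[OF this descending_clamp_radius_derivative[OF t]]
  have "(eta \<beta> has_real_derivative (c * - (3/2 * (s / r) * excess \<beta> t) * r - s * c) / (r * r)) (at t)"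
    using r by (simp add: eta_def[abs_def] descending_clamp_radius[OF t(1)] s_def c_def r_def)
  also have "(c * - (3/2 * (s / r) * excess \<beta> t) * r - s * c) / (r * r)
      = c * (s / r) * (1 - 3 * (excess \<beta> t + 1)) / (2 * r)"
    using r by (simp add: field_simps)
  finally show ?thesis by (simp add: eta c_def r_def)
qed

text \<open>As long as \<open>excess \<le> 0\<close>, convexity makes \<open>slope\<close> nondecreasing. So if \<open>slope \<le> 0\<close> at the first
  zero of \<open>excess\<close>, then \<open>excess' \<le> damping excess\<close> up to that point, which keeps \<open>excess\<close> negative.\<close>

definition slope :: "real \<Rightarrow> real" where
  "slope t = \<beta> * (radius \<beta> t * deriv feedback (radius \<beta> t) - feedback (radius \<beta> t)) - cos (angle \<beta> t)"

definition damping :: "real \<Rightarrow> real" where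
  "damping t = 3/2 * (sin (angle \<beta> t) ^ 3 / (radius \<beta> t)\<^sup>2 - cos (angle \<beta> t) / radius \<beta> t * (excess \<beta> t + 1))"

lemma slope_damping_decomposition:
  fixes s c r E F F' :: real
  assumes r: "0 < r" and s: "0 < s" and E: "F + c = r * (E + 1) / s"
  shows "c * (s / r) * (1 - 3 * (E + 1)) / (2 * r) * (F + c) + (F' * c + - s * - (3/2 * (s / r) * E)) * (s / r)
    = c * s / r\<^sup>2 * (r * F' - F - c) + 3/2 * (s ^ 3 / r\<^sup>2 - c / r * (E + 1)) * E"
proof -
  have "c * (s / r) * (1 - 3 * (E + 1)) / (2 * r) * (F + c)
      = - (c * s / r\<^sup>2 * (F + c)) - 3/2 * (c / r * (E + 1)) * E"
    unfolding E using r s by (simp add: field_simps power2_eq_square)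
  moreover have "(F' * c + - s * - (3/2 * (s / r) * E)) * (s / r)
      = c * s / r\<^sup>2 * (r * F') + 3/2 * (s ^ 3 / r\<^sup>2) * E"
    using r by (simp add: field_simps power2_eq_square power3_eq_cube)
  moreover have "c * s / r\<^sup>2 * (r * F' - F - c) = c * s / r\<^sup>2 * (r * F') - c * s / r\<^sup>2 * (F + c)"
    by (simp only: diff_diff_eq right_diff_distrib)
  ultimately show ?thesis by (simp only: left_diff_distrib right_diff_distrib)
qed

lemma excess_derivative:
  assumes t: "descending t" "0 < t"
  shows "(excess \<beta> has_real_derivative
    cos (angle \<beta> t) * sin (angle \<beta> t) / (radius \<beta> t)\<^sup>2 * slope t + damping t * excess \<beta> t) (at t)"
proof -
  define s where "s = sin (angle \<beta> t)"
  define c where "c = cos (angle \<beta> t)"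
  define r where "r = radius \<beta> t"
  define E where "E = excess \<beta> t"
  define F where "F = \<beta> * feedback r"
  define F' where "F' = \<beta> * deriv feedback r"
  define \<theta>' where "\<theta>' = - (3/2 * (s / r) * E)"
  have r: "0 < r" and clamp: "clamp_radius (radius \<beta> t) = r"
    using descending_radius_pos[OF t(1)] descending_clamp_radius[OF t(1)] by (auto simp: r_def)
  have s: "0 < s" using sin_angle_pos[of t] t(2) by (simp add: s_def)
  have eta: "eta \<beta> t = s / r" by (simp add: s_def r_def descending_eta_eq[OF t(1)])
  have E: "F + c = r * (E + 1) / s"
    using descending_excess_eq[OF t(1)] r s by (simp add: eta E_def F_def c_def r_def[symmetric] field_simps)
  have "((\<lambda>t. cos (angle \<beta> t)) has_real_derivative - s * \<theta>') (at t)"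
    using angle_derivative[OF t(2)] by (auto intro!: derivative_eq_intros simp: eta E_def \<theta>'_def s_def)
  moreover have "((\<lambda>t. \<beta> * feedback (clamp_radius (radius \<beta> t))) has_real_derivative F' * c) (at t)"
    using DERIV_cmult[OF DERIV_chain2[OF feedback_has_derivative descending_clamp_radius_derivative[OF t]], of \<beta>]
    by (simp add: F'_def c_def clamp mult.assoc)
  ultimately have "((\<lambda>t. \<beta> * feedback (clamp_radius (radius \<beta> t)) + cos (angle \<beta> t))
      has_real_derivative F' * c + - s * \<theta>') (at t)" by (intro DERIV_add)
  from DERIV_diff[OF DERIV_mult[OF eta_derivative[OF t] this] DERIV_const[of 1]]
  have "(excess \<beta> has_real_derivative
      c * eta \<beta> t * (1 - 3 * (E + 1)) / (2 * r) * (\<beta> * feedback (clamp_radius (radius \<beta> t)) + cos (angle \<beta> t))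
      + (F' * c + - s * \<theta>') * eta \<beta> t - 0) (at t)"
    by (simp only: excess_eq[abs_def, symmetric] c_def r_def E_def)
  then have "(excess \<beta> has_real_derivative
      c * (s / r) * (1 - 3 * (E + 1)) / (2 * r) * (F + c) + (F' * c + - s * \<theta>') * (s / r)) (at t)"
    by (simp add: eta clamp F_def c_def)
  also have "c * (s / r) * (1 - 3 * (E + 1)) / (2 * r) * (F + c) + (F' * c + - s * \<theta>') * (s / r)
      = c * s / r\<^sup>2 * (r * F' - F - c) + 3/2 * (s ^ 3 / r\<^sup>2 - c / r * (E + 1)) * E"
    unfolding \<theta>'_def by (rule slope_damping_decomposition[OF r s E])
  finally show ?thesis
    by (simp add: slope_def damping_def s_def c_def r_def E_def F_def F'_def algebra_simps)
qed

lemma slope_derivative: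
  assumes "0 < t"
  shows "(slope has_real_derivative \<beta> * (radius \<beta> t * deriv (deriv feedback) (radius \<beta> t) * cos (angle \<beta> t))
    - 3/2 * sin (angle \<beta> t) * eta \<beta> t * excess \<beta> t) (at t)"
proof -
  note radius' = radius_derivative[OF assms, of \<beta>]
  note feedback' = DERIV_chain2[OF feedback_has_derivative radius']
    DERIV_chain2[OF feedback_deriv_has_derivative radius']
  show ?thesis unfolding slope_def[abs_def]
    by (rule derivative_eq_intros feedback' radius' angle_derivative[OF assms] refl)+
      (simp add: algebra_simps)
qed

lemma slope_mono:
  assumes "descending t" "0 < u" "u \<le> t"
  shows "slope u \<le> slope t"
proof (rule DERIV_nonneg_imp_nondecreasing[OF \<open>u \<le> t\<close>])
  fix s assume "u \<le> s" "s \<le> t"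
  then have s: "descending s" "0 < s" using assms descending_mono by auto
  have "0 \<le> \<beta> * (radius \<beta> s * deriv (deriv feedback) (radius \<beta> s) * cos (angle \<beta> s))"
    using parameter_pos descending_radius_pos[OF s(1)] feedback_deriv2_pos[of "radius \<beta> s"] descendingD[OF s(1)]
    by (intro mult_nonneg_nonneg) auto
  moreover have "3/2 * sin (angle \<beta> s) * eta \<beta> s * excess \<beta> s \<le> 0"
    using sin_angle_pos[of s] eta_pos[of s] descendingD[OF s(1)] s(2) by (intro mult_nonneg_nonpos) auto
  ultimately have "0 \<le> \<beta> * (radius \<beta> s * deriv (deriv feedback) (radius \<beta> s) * cos (angle \<beta> s))
      - 3/2 * sin (angle \<beta> s) * eta \<beta> s * excess \<beta> s" by linarith
  then show "\<exists>y. (slope has_real_derivative y) (at s) \<and> 0 \<le> y"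
    using slope_derivative[OF s(2)] by blast
qed

lemma damping_ge:
  assumes "descending t"
  shows "- (3 / (2 * r0)) \<le> damping t"
proof -
  have t: "0 \<le> t" "excess \<beta> t \<le> 0" "0 \<le> cos (angle \<beta> t)" "r0 \<le> radius \<beta> t"
    using descendingD[OF assms] descending_radius_bounds[OF assms] by auto
  have "0 \<le> excess \<beta> t + 1"
    using descending_excess_eq[OF assms] eta_pos[OF t(1)] parameter_pos t(3)
      feedback_pos[OF descending_radius_pos[OF assms]] by simp
  then have "cos (angle \<beta> t) / radius \<beta> t * (excess \<beta> t + 1) \<le> 1 / r0 * 1"
    using t radii(1) by (intro mult_mono' frac_le) auto
  moreover have "0 \<le> sin (angle \<beta> t) ^ 3 / (radius \<beta> t)\<^sup>2" using sin_angle_pos[OF t(1)] by simp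
  ultimately show ?thesis by (simp add: damping_def)
qed

lemma slope_pos_at_first_zero:
  assumes t: "descending t" "0 < t" and zero: "excess \<beta> t = 0"
    and before: "\<And>u. 0 \<le> u \<Longrightarrow> u < t \<Longrightarrow> excess \<beta> u < 0"
  shows "0 < slope t"
proof (rule ccontr)
  assume "\<not> 0 < slope t"
  define a where "a = t / 2"
  have a: "0 < a" "a < t" using t(2) by (auto simp: a_def)
  have "excess \<beta> t \<le> exp (- (3 / (2 * r0)) * (t - a)) * excess \<beta> a"
  proof (rule linear_growth_bound)
    show "continuous_on {a..t} (excess \<beta>)"
      using excess_continuous_on by (rule continuous_on_subset) (use a in auto)
    fix u assume u: "a < u" "u < t"
    then have u': "descending u" "0 < u" using t(1) a descending_mono by auto
    show "(excess \<beta> has_real_derivative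
        cos (angle \<beta> u) * sin (angle \<beta> u) / (radius \<beta> u)\<^sup>2 * slope u + damping u * excess \<beta> u) (at u)"
      by (rule excess_derivative[OF u'])
    have "slope u \<le> 0" using slope_mono[OF t(1) u'(2)] u \<open>\<not> 0 < slope t\<close> by simp
    then have "cos (angle \<beta> u) * sin (angle \<beta> u) / (radius \<beta> u)\<^sup>2 * slope u \<le> 0"
      using descendingD[OF u'(1)] sin_angle_pos[of u] u'(2)
      by (intro mult_nonneg_nonpos divide_nonneg_nonneg mult_nonneg_nonneg) auto
    moreover have "damping u * excess \<beta> u \<le> - (3 / (2 * r0)) * excess \<beta> u"
      using damping_ge[OF u'(1)] descendingD[OF u'(1)] by (intro mult_right_mono_neg) auto
    ultimately show "cos (angle \<beta> u) * sin (angle \<beta> u) / (radius \<beta> u)\<^sup>2 * slope u + damping u * excess \<beta> u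
        \<le> - (3 / (2 * r0)) * excess \<beta> u" by linarith
  qed (use a in simp)
  also have "\<dots> < 0" using before[of a] a by (simp add: mult_pos_neg)
  finally show False using zero by simp
qed

lemma excess_transversal: "transversal (\<lambda>t. - excess \<beta> t) (\<lambda>t. cos (angle \<beta> t))"
  unfolding transversal_def
proof (intro allI impI)
  fix t assume "0 < t" and before: "\<forall>u\<in>{0..<t}. 0 < - excess \<beta> u \<and> 0 < cos (angle \<beta> u)"
    and zero: "- excess \<beta> t = 0" and "0 < cos (angle \<beta> t)"
  have "excess \<beta> u \<le> 0 \<and> 0 \<le> cos (angle \<beta> u)" if "u \<in> {0..t}" for u
    using before[rule_format, of u] zero \<open>0 < cos (angle \<beta> t)\<close> that by (cases "u = t") auto
  then have "descending t" using \<open>0 < t\<close> by (simp add: descending_def)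
  then have slope_term: "0 < cos (angle \<beta> t) * sin (angle \<beta> t) / (radius \<beta> t)\<^sup>2 * slope t"
    using before zero \<open>0 < cos (angle \<beta> t)\<close> \<open>0 < t\<close> slope_pos_at_first_zero[of t] sin_angle_pos[of t]
      descending_radius_pos[of t]
    by (intro mult_pos_pos divide_pos_pos) auto
  have "(excess \<beta> has_real_derivative
      cos (angle \<beta> t) * sin (angle \<beta> t) / (radius \<beta> t)\<^sup>2 * slope t) (at t)"
    using excess_derivative[OF \<open>descending t\<close> \<open>0 < t\<close>] zero by simp
  from DERIV_minus[OF this] show "\<exists>D<0. ((\<lambda>t. - excess \<beta> t) has_real_derivative D) (at t)"
    using slope_term neg_less_0_iff_less by blast
qed

lemma cos_angle_transversal: "transversal (\<lambda>t. cos (angle \<beta> t)) (\<lambda>t. - excess \<beta> t)"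
  unfolding transversal_def
proof (intro allI impI)
  fix t assume "0 < t" "0 < - excess \<beta> t"
  have "((\<lambda>t. cos (angle \<beta> t)) has_real_derivative 3/2 * sin (angle \<beta> t) * eta \<beta> t * excess \<beta> t) (at t)"
    using angle_derivative[OF \<open>0 < t\<close>] by (auto intro!: derivative_eq_intros)
  moreover have "3/2 * sin (angle \<beta> t) * eta \<beta> t * excess \<beta> t < 0"
    using sin_angle_pos[of t] eta_pos[of t] \<open>0 < t\<close> \<open>0 < - excess \<beta> t\<close> by (intro mult_pos_neg) auto
  ultimately show "\<exists>D<0. ((\<lambda>t. cos (angle \<beta> t)) has_real_derivative D) (at t)" by blast
qed

lemma excess_0: "excess \<beta> 0 < 0"
proof -
  have "clamp_radius r0 = r0" using radii by (intro clamp_radius_id) auto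
  moreover have "sqrt (1 - (cos (\<theta>0 \<beta>))\<^sup>2) = sin (\<theta>0 \<beta>)"
    using sin_angle_pos[of 0] by (simp add: angle_0 sin_squared_eq[symmetric])
  ultimately show ?thesis
    using initial_excess[OF \<beta>]
    by (simp add: excess_def excess_at_def toy_excess_def angle_0 radius_0 feedback_def mult.assoc)
qed

lemma no_equilibrium:
  assumes "0 < t" "- excess \<beta> t = 0"
  shows "cos (angle \<beta> t) \<noteq> 0"
proof
  assume "cos (angle \<beta> t) = 0"
  then have "field (flow \<beta> t) = 0"
    using assms
    by (simp add: field_def flow_eq clamp_parameter_id[OF \<beta>] excess_def zero_prod_def)
  then have "ode_solution field (\<lambda>_. flow \<beta> t)" by (simp add: ode_solution_def)
  from flow_meets_initial[OF this, of t \<beta>] have "angle \<beta> t = \<theta>0 \<beta>" using assms(1) by (simp add: angle_def)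
  then show False using \<open>cos (angle \<beta> t) = 0\<close> initial_cos[OF \<beta>] by simp
qed

end

end

context toy_shooting
begin

text \<open>Where \<open>cos \<theta> = 3/5\<close>, \<open>excess < 0\<close> would force both \<open>r > 12/25\<close> and \<open>(4/5) \<beta>2 feedback(r) < r\<close>.\<close>

lemma \<beta>2_cos_not_first: "\<not> crosses_first (\<lambda>t. cos (angle \<beta>2 t)) (\<lambda>t. - excess \<beta>2 t)"
proof
  assume "crosses_first (\<lambda>t. cos (angle \<beta>2 t)) (\<lambda>t. - excess \<beta>2 t)"
  then obtain t where t: "0 \<le> t" "cos (angle \<beta>2 t) < 0" "\<And>u. u \<in> {0..t} \<Longrightarrow> excess \<beta>2 u < 0"
    by (auto simp: crosses_first_def)
  have \<beta>2: "\<beta>2 \<in> {\<beta>1..\<beta>2}" using parameters by simp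
  have "continuous_on {0..t} (\<lambda>t. cos (angle \<beta>2 t))"
    using cos_angle_continuous_on[OF \<beta>2] by (rule continuous_on_subset) auto
  then obtain u where u: "0 \<le> u" "u \<le> t" "cos (angle \<beta>2 u) = 3/5"
    using IVT2'[of "\<lambda>t. cos (angle \<beta>2 t)" t "3/5" 0] initial_cos[OF \<beta>2] angle_0 t by auto
  define c where "c = clamp_radius (radius \<beta>2 u)"
  have "0 < c" by (simp add: c_def clamp_radius_pos)
  have "(sin (angle \<beta>2 u))\<^sup>2 = (4/5)\<^sup>2"
    unfolding sin_squared_eq u(3) by (simp add: power2_eq_square)
  then have sin: "sin (angle \<beta>2 u) = 4/5" using sin_angle_pos[OF \<beta>2 u(1)] by (simp add: power2_eq_iff)
  have "excess \<beta>2 u = 4/5 / c * (\<beta>2 * feedback c + 3/5) - 1"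
    unfolding excess_eq[OF \<beta>2] eta_def c_def sin u(3) ..
  then have "4/5 / c * (\<beta>2 * feedback c + 3/5) < 1" using t(3)[of u] u by simp
  then have small: "4/5 * (\<beta>2 * feedback c) + 12/25 < c" using \<open>0 < c\<close> by (simp add: field_simps)
  moreover have "0 < \<beta>2 * feedback c" using parameter_pos[OF \<beta>2] feedback_pos[OF \<open>0 < c\<close>] by simp
  ultimately have "12/25 < c" by linarith
  then have "feedback (12/25) / (12/25) \<le> feedback c / c" by (intro feedback_ratio_mono) auto
  then have "4/5 * (\<beta>2 * (feedback (12/25) / (12/25))) \<le> 4/5 * (\<beta>2 * (feedback c / c))"
    using parameter_pos[OF \<beta>2] by (intro mult_left_mono) auto
  then have "1 \<le> 4/5 * (\<beta>2 * feedback c) / c" using \<beta>2_large by simp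
  then have "c \<le> 4/5 * (\<beta>2 * feedback c)" using \<open>0 < c\<close> by (simp only: le_divide_eq_1_pos)
  then show False using small by simp
qed

lemma \<beta>1_mem: "\<beta>1 \<in> {\<beta>1..\<beta>2}"
  using parameters by simp

text \<open>For \<open>\<beta> = \<beta>1\<close>, \<open>7/24\<close> is a lower barrier for \<open>\<eta>\<close> while \<open>r \<le> 5\<close>; since \<open>r \<eta> = sin \<theta> \<le> 1\<close>, the
  radius never reaches \<open>5\<close>. Moreover \<open>3/8\<close> is an upper barrier for \<open>\<eta> \<rho>\<close>.\<close>

lemma \<beta>1_feedback_small:
  assumes "0 < x" "x \<le> 5"
  shows "0 \<le> \<beta>1 * feedback x" "\<beta>1 * feedback x \<le> 1/7" "\<beta>1 * feedback x / x \<le> 1/35"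
proof -
  show "0 \<le> \<beta>1 * feedback x" using parameters feedback_pos[OF assms(1)] by simp
  have "\<beta>1 * feedback x \<le> \<beta>1 * feedback 5"
    using parameters feedback_mono[OF assms] by (intro mult_left_mono) auto
  then show "\<beta>1 * feedback x \<le> 1/7" using \<beta>1_small by linarith
  have "\<beta>1 * (feedback x / x) \<le> \<beta>1 * (feedback 5 / 5)"
    using parameters feedback_ratio_mono[OF assms] by (intro mult_left_mono) auto
  moreover have "\<beta>1 * (feedback 5 / 5) \<le> 1/35" using \<beta>1_small by simp
  ultimately show "\<beta>1 * feedback x / x \<le> 1/35" by (simp only: times_divide_eq_right)
qed

lemma \<beta>1_eta_ge:
  assumes t: "descending \<beta>1 t" and small: "radius \<beta>1 t \<le> 5"
  shows "7/24 \<le> eta \<beta>1 t"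
proof -
  have "- eta \<beta>1 t \<le> - (7/24)"
  proof (rule barrier_le[where a = 0 and b = t and y = "\<lambda>t. - eta \<beta>1 t"])
    show "0 \<le> t" using descendingD[OF \<beta>1_mem t] by simp
    show "continuous_on {0..t} (\<lambda>t. - eta \<beta>1 t)"
      by (intro continuous_intros continuous_on_subset[OF eta_continuous_on[OF \<beta>1_mem]]) auto
    show "- eta \<beta>1 0 \<le> - (7/24)" using initial_eta[OF \<beta>1_mem] by (simp add: eta_0)
    fix u assume u: "0 < u" "u < t"
    then have du: "descending \<beta>1 u" using descending_mono[OF \<beta>1_mem t] by simp
    show "((\<lambda>t. - eta \<beta>1 t) has_real_derivative
        - (cos (angle \<beta>1 u) * eta \<beta>1 u * (1 - 3 * (excess \<beta>1 u + 1)) / (2 * radius \<beta>1 u))) (at u)"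
      by (rule DERIV_minus[OF eta_derivative[OF \<beta>1_mem du u(1)]])
    assume "- (7/24) < - eta \<beta>1 u"
    then have eta: "0 \<le> eta \<beta>1 u" "eta \<beta>1 u \<le> 7/24" using eta_pos[OF \<beta>1_mem, of u] u by auto
    have r: "0 < radius \<beta>1 u" "radius \<beta>1 u \<le> 5"
      using descending_radius_pos[OF \<beta>1_mem du] descending_radius_mono[OF \<beta>1_mem t, of u] u small by auto
    have "excess \<beta>1 u + 1 = eta \<beta>1 u * (\<beta>1 * feedback (radius \<beta>1 u) + cos (angle \<beta>1 u))"
      using descending_excess_eq[OF \<beta>1_mem du] by simp
    also have "\<dots> \<le> 7/24 * (1/7 + 1)"
      using eta \<beta>1_feedback_small[OF r] descendingD[OF \<beta>1_mem du] by (intro mult_mono add_mono) auto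
    finally have "0 \<le> 1 - 3 * (excess \<beta>1 u + 1)" by simp
    then show "- (cos (angle \<beta>1 u) * eta \<beta>1 u * (1 - 3 * (excess \<beta>1 u + 1)) / (2 * radius \<beta>1 u)) \<le> 0"
      using eta(1) r(1) descendingD[OF \<beta>1_mem du] by simp
  qed
  then show ?thesis by simp
qed

lemma \<beta>1_radius_less:
  assumes t: "descending \<beta>1 t"
  shows "radius \<beta>1 t < 5"
proof (rule ccontr)
  assume "\<not> radius \<beta>1 t < 5"
  moreover have "continuous_on {0..t} (radius \<beta>1)" using radius_continuous_on by (rule continuous_on_subset) auto
  ultimately obtain u where u: "0 \<le> u" "u \<le> t" "radius \<beta>1 u = 5"
    using IVT'[of "radius \<beta>1" 0 5 t] radius_0 radii descendingD[OF \<beta>1_mem t] by auto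
  then have du: "descending \<beta>1 u" using descending_mono[OF \<beta>1_mem t] by simp
  have "7/24 \<le> eta \<beta>1 u" using \<beta>1_eta_ge[OF du] u(3) by simp
  also have "eta \<beta>1 u = sin (angle \<beta>1 u) / 5" unfolding descending_eta_eq[OF \<beta>1_mem du] u(3) ..
  finally show False using sin_le_one[of "angle \<beta>1 u"] by linarith
qed

lemma \<beta>1_eta_cos_le:
  assumes t: "descending \<beta>1 t"
  shows "eta \<beta>1 t * cos (angle \<beta>1 t) \<le> 3/8"
proof (rule barrier_le[where a = 0 and b = t and y = "\<lambda>t. eta \<beta>1 t * cos (angle \<beta>1 t)"])
  show "0 \<le> t" using descendingD[OF \<beta>1_mem t] by simp
  show "continuous_on {0..t} (\<lambda>t. eta \<beta>1 t * cos (angle \<beta>1 t))"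
    by (intro continuous_on_mult continuous_on_subset[OF eta_continuous_on[OF \<beta>1_mem]]
        continuous_on_subset[OF cos_angle_continuous_on[OF \<beta>1_mem]]) auto
  have "eta \<beta>1 0 * cos (angle \<beta>1 0) \<le> 3/8 * 1"
    using initial_eta[OF \<beta>1_mem] initial_cos[OF \<beta>1_mem] by (intro mult_mono) (auto simp: eta_0 angle_0)
  then show "eta \<beta>1 0 * cos (angle \<beta>1 0) \<le> 3/8" by simp
  fix u assume u: "0 < u" "u < t"
  then have du: "descending \<beta>1 u" using descending_mono[OF \<beta>1_mem t] by simp
  define \<eta>' where "\<eta>' = cos (angle \<beta>1 u) * eta \<beta>1 u * (1 - 3 * (excess \<beta>1 u + 1)) / (2 * radius \<beta>1 u)"
  have pos: "0 < eta \<beta>1 u" "0 < sin (angle \<beta>1 u)" "0 < radius \<beta>1 u" "radius \<beta>1 u \<le> 5"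
    using eta_pos[OF \<beta>1_mem] sin_angle_pos[OF \<beta>1_mem] descending_radius_pos[OF \<beta>1_mem du]
      \<beta>1_radius_less[OF du] u by (auto intro: less_imp_le)
  have down: "excess \<beta>1 u \<le> 0" "0 \<le> cos (angle \<beta>1 u)" using descendingD[OF \<beta>1_mem du] by auto
  have "((\<lambda>t. cos (angle \<beta>1 t)) has_real_derivative
      - sin (angle \<beta>1 u) * - (3/2 * eta \<beta>1 u * excess \<beta>1 u)) (at u)"
    using angle_derivative[OF \<beta>1_mem u(1)] by (auto intro!: derivative_eq_intros)
  from DERIV_mult[OF eta_derivative[OF \<beta>1_mem du u(1)] this]
  show "((\<lambda>t. eta \<beta>1 t * cos (angle \<beta>1 t)) has_real_derivative
      \<eta>' * cos (angle \<beta>1 u) + 3/2 * sin (angle \<beta>1 u) * (eta \<beta>1 u)\<^sup>2 * excess \<beta>1 u) (at u)"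
    by (simp add: \<eta>'_def power2_eq_square mult_ac)
  assume "3/8 < eta \<beta>1 u * cos (angle \<beta>1 u)"
  also have "\<dots> \<le> eta \<beta>1 u * (\<beta>1 * feedback (radius \<beta>1 u) + cos (angle \<beta>1 u))"
    using pos \<beta>1_feedback_small(1)[OF pos(3,4)] by (intro mult_left_mono) auto
  also have "\<dots> = excess \<beta>1 u + 1" by (simp add: descending_excess_eq[OF \<beta>1_mem du])
  finally have "1 - 3 * (excess \<beta>1 u + 1) \<le> 0" by simp
  then have "\<eta>' \<le> 0"
    unfolding \<eta>'_def using pos down by (intro divide_nonpos_pos mult_nonneg_nonpos mult_nonneg_nonneg) auto
  then have "\<eta>' * cos (angle \<beta>1 u) \<le> 0" using down by (intro mult_nonpos_nonneg)
  moreover have "3/2 * sin (angle \<beta>1 u) * (eta \<beta>1 u)\<^sup>2 * excess \<beta>1 u \<le> 0"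
    using pos down by (intro mult_nonneg_nonpos) auto
  ultimately show "\<eta>' * cos (angle \<beta>1 u) + 3/2 * sin (angle \<beta>1 u) * (eta \<beta>1 u)\<^sup>2 * excess \<beta>1 u \<le> 0"
    by linarith
qed

lemma \<beta>1_excess_neg:
  assumes t: "descending \<beta>1 t"
  shows "excess \<beta>1 t < 0"
proof -
  have r: "0 < radius \<beta>1 t" "radius \<beta>1 t \<le> 5"
    using descending_radius_pos[OF \<beta>1_mem t] \<beta>1_radius_less[OF t] by auto
  have "eta \<beta>1 t * (\<beta>1 * feedback (radius \<beta>1 t))
      = sin (angle \<beta>1 t) * (\<beta>1 * feedback (radius \<beta>1 t) / radius \<beta>1 t)"
    by (simp add: descending_eta_eq[OF \<beta>1_mem t])
  also have "\<dots> \<le> 1 * (1/35)"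
    using \<beta>1_feedback_small[OF r] r by (intro mult_mono divide_nonneg_pos) auto
  finally show ?thesis
    using \<beta>1_eta_cos_le[OF t] unfolding descending_excess_eq[OF \<beta>1_mem t] distrib_left by linarith
qed

lemma \<beta>1_excess_not_first: "\<not> crosses_first (\<lambda>t. - excess \<beta>1 t) (\<lambda>t. cos (angle \<beta>1 t))"
proof
  assume "crosses_first (\<lambda>t. - excess \<beta>1 t) (\<lambda>t. cos (angle \<beta>1 t))"
  then obtain t where t: "0 \<le> t" "- excess \<beta>1 t \<le> 0" "\<And>u. u \<in> {0..t} \<Longrightarrow> 0 < cos (angle \<beta>1 u)"
    by (auto simp: crosses_first_def less_imp_le)
  have "continuous_on {0..t} (\<lambda>t. - excess \<beta>1 t)"
    by (intro continuous_intros continuous_on_subset[OF excess_continuous_on[OF \<beta>1_mem]]) auto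
  then obtain s where s: "0 < s" "s \<le> t" "- excess \<beta>1 s = 0"
    and before: "\<And>u. 0 \<le> u \<Longrightarrow> u < s \<Longrightarrow> 0 < - excess \<beta>1 u"
    by (rule first_zero) (use t(1,2) excess_0[OF \<beta>1_mem] in auto)
  have "excess \<beta>1 u \<le> 0" if "u \<in> {0..s}" for u
    using before[of u] s(3) that by (cases "u = s") auto
  then have "descending \<beta>1 s"
    using t(3) s by (auto simp: descending_def[OF \<beta>1_mem] intro!: less_imp_le)
  then show False using \<beta>1_excess_neg[of s] s(3) by simp
qed

lemma shooting_parameter:
  obtains \<beta> where "\<beta> \<in> {\<beta>1..\<beta>2}" "\<And>t. 0 \<le> t \<Longrightarrow> excess \<beta> t < 0 \<and> 0 < cos (angle \<beta> t)"
proof (rule shooting[of "{\<beta>1..\<beta>2}" "\<lambda>\<beta> t. - excess \<beta> t" "\<lambda>\<beta> t. cos (angle \<beta> t)" \<beta>1 \<beta>2])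
  show "continuous_on ({\<beta>1..\<beta>2} \<times> {0..}) (\<lambda>(\<beta>, t). - excess \<beta> t)"
    "continuous_on ({\<beta>1..\<beta>2} \<times> {0..}) (\<lambda>(\<beta>, t). cos (angle \<beta> t))"
    using continuous_on_minus[OF excess_continuous] continuous_on_cos[OF angle_continuous]
    by (simp_all add: split_beta)
  show "0 < - excess \<beta> 0 \<and> 0 < cos (angle \<beta> 0)" if "\<beta> \<in> {\<beta>1..\<beta>2}" for \<beta>
    using excess_0[OF that] initial_cos[OF that] by (simp add: angle_0)
  show "transversal (\<lambda>t. - excess \<beta> t) (\<lambda>t. cos (angle \<beta> t)) \<and>
      transversal (\<lambda>t. cos (angle \<beta> t)) (\<lambda>t. - excess \<beta> t)" if "\<beta> \<in> {\<beta>1..\<beta>2}" for \<beta>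
    using excess_transversal[OF that] cos_angle_transversal[OF that] ..
  show "cos (angle \<beta> t) \<noteq> 0" if "\<beta> \<in> {\<beta>1..\<beta>2}" "0 < t" "- excess \<beta> t = 0" for \<beta> t
    by (rule no_equilibrium[OF that])
qed (use that parameters \<beta>1_excess_not_first \<beta>2_cos_not_first in auto)

end

section \<open>Existence\<close>

definition toy_descent_on ::
  "(real \<Rightarrow> real) \<Rightarrow> real \<Rightarrow> (real \<Rightarrow> real) \<Rightarrow> (real \<Rightarrow> real) \<Rightarrow> real set \<Rightarrow> bool" where
  "toy_descent_on g \<beta> \<rho> r S \<longleftrightarrow> (\<forall>s\<in>S. 0 < \<rho> s \<and> \<rho> s < 1 \<and> 0 < r s \<and> toy_rhs g \<beta> (\<rho> s) (r s) < 0 \<and>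
     (\<rho> has_real_derivative toy_rhs g \<beta> (\<rho> s) (r s)) (at s within S) \<and>
     (r has_real_derivative \<rho> s) (at s within S))"

lemma toy_descent_onD:
  assumes "toy_descent_on g \<beta> \<rho> r S" "s \<in> S"
  shows "0 < \<rho> s" "\<rho> s < 1" "0 < r s" "toy_rhs g \<beta> (\<rho> s) (r s) < 0"
    "(\<rho> has_real_derivative toy_rhs g \<beta> (\<rho> s) (r s)) (at s within S)"
    "(r has_real_derivative \<rho> s) (at s within S)"
  using assms by (auto simp: toy_descent_on_def)

lemma toy_descent_on_shift:
  assumes "toy_descent_on g \<beta> \<rho> r {0..}"
  shows "toy_descent_on g \<beta> (\<lambda>s. \<rho> (s - c)) (\<lambda>s. r (s - c)) {c..}"
proof -
  have shift: "((\<lambda>s. f (s - c)) has_real_derivative D) (at s within {c..})"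
    if "(f has_real_derivative D) (at (s - c) within {0..})" "c \<le> s" for f D s
  proof -
    have "(f \<circ> (\<lambda>s. s - c) has_real_derivative D * 1) (at s within {c..})"
    proof (rule DERIV_image_chain)
      have "(\<lambda>s. s - c) ` {c..} = {0..}" by (auto simp: image_iff intro!: bexI[of _ "_ + c"])
      then show "(f has_real_derivative D) (at (s - c) within (\<lambda>s. s - c) ` {c..})" using that(1) by simp
    qed (auto intro!: derivative_eq_intros)
    then show ?thesis by (simp add: o_def)
  qed
  have nonneg: "s - c \<in> {0..}" if "s \<in> {c..}" for s using that by simp
  show ?thesis
    unfolding toy_descent_on_def
    using toy_descent_onD[OF assms nonneg] by (auto intro: shift)
qed

lemma has_real_derivative_glue:
  fixes f h :: "real \<Rightarrow> real"
  assumes f: "\<And>s. s \<in> {a<..c} \<Longrightarrow> (f has_real_derivative f' s) (at s within {a<..c})"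
    and h: "\<And>s. s \<in> {c..} \<Longrightarrow> (h has_real_derivative h' s) (at s within {c..})"
    and "a < c" and match: "f c = h c" "f' c = h' c" and "a < s"
  shows "((\<lambda>s. if s \<le> c then f s else h s) has_real_derivative (if s \<le> c then f' s else h' s))
    (at s within {a<..})"
proof -
  have closures: "closure {a<..c} \<inter> closure {c<..} = {c}" using \<open>a < c\<close> by auto
  have "((\<lambda>s. if s \<in> {a<..c} then f s else h s) has_vector_derivative
      (if s \<in> {a<..c} then f' s else h' s)) (at s within {a<..})"
  proof (rule has_vector_derivative_If_within_closures[where T = "{c<..}"])
    have unions: "{a<..c} \<union> {c} = {a<..c}" "{c<..} \<union> {c} = {c..}" using \<open>a < c\<close> by auto
    show "s \<in> {a<..c} \<union> (closure {a<..c} \<inter> closure {c<..}) \<Longrightarrow>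
        (f has_vector_derivative f' s) (at s within {a<..c} \<union> (closure {a<..c} \<inter> closure {c<..}))"
      unfolding closures unions has_real_derivative_iff_has_vector_derivative[symmetric] by (rule f)
    show "s \<in> {c<..} \<union> (closure {a<..c} \<inter> closure {c<..}) \<Longrightarrow>
        (h has_vector_derivative h' s) (at s within {c<..} \<union> (closure {a<..c} \<inter> closure {c<..}))"
      unfolding closures unions has_real_derivative_iff_has_vector_derivative[symmetric] by (rule h)
    have "s = c" if "s \<in> closure {a<..c}" "s \<in> closure {c<..}" using closures that by blast
    then show "s \<in> closure {a<..c} \<Longrightarrow> s \<in> closure {c<..} \<Longrightarrow> f s = h s"
      "s \<in> closure {a<..c} \<Longrightarrow> s \<in> closure {c<..} \<Longrightarrow> f' s = h' s" using match by blast+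
  qed (use \<open>a < c\<close> \<open>a < s\<close> in auto)
  then show ?thesis
    unfolding has_real_derivative_iff_has_vector_derivative
    using \<open>a < s\<close> by (auto intro: has_vector_derivative_transform[rotated 2])
qed

lemma toy_descent_on_glue:
  assumes inner: "toy_descent_on g \<beta> \<rho>1 r1 {0<..c}" and outer: "toy_descent_on g \<beta> \<rho>2 r2 {c..}"
    and "0 < c" and match: "\<rho>1 c = \<rho>2 c" "r1 c = r2 c"
  shows "toy_descent_on g \<beta> (\<lambda>s. if s \<le> c then \<rho>1 s else \<rho>2 s) (\<lambda>s. if s \<le> c then r1 s else r2 s) {0<..}"
proof -
  define \<rho> where "\<rho> = (\<lambda>s. if s \<le> c then \<rho>1 s else \<rho>2 s)"
  define r where "r = (\<lambda>s. if s \<le> c then r1 s else r2 s)"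
  have "toy_descent_on g \<beta> \<rho> r {0<..}"
    unfolding toy_descent_on_def
  proof (intro ballI conjI)
    fix s :: real assume "s \<in> {0<..}"
    then have s: "0 < s" by simp
    show "0 < \<rho> s" "\<rho> s < 1" "0 < r s" "toy_rhs g \<beta> (\<rho> s) (r s) < 0"
      using toy_descent_onD(1-4)[OF inner, of s] toy_descent_onD(1-4)[OF outer, of s] s
      by (auto simp: \<rho>_def r_def)
    have "(\<rho> has_real_derivative (if s \<le> c then toy_rhs g \<beta> (\<rho>1 s) (r1 s) else toy_rhs g \<beta> (\<rho>2 s) (r2 s)))
        (at s within {0<..})"
      unfolding \<rho>_def
      by (rule has_real_derivative_glue[OF toy_descent_onD(5)[OF inner] toy_descent_onD(5)[OF outer] \<open>0 < c\<close>])
        (simp_all add: match s)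
    then show "(\<rho> has_real_derivative toy_rhs g \<beta> (\<rho> s) (r s)) (at s within {0<..})"
      by (cases "s \<le> c") (simp_all add: \<rho>_def r_def)
    show "(r has_real_derivative \<rho> s) (at s within {0<..})"
      unfolding \<rho>_def r_def
      by (rule has_real_derivative_glue[OF toy_descent_onD(6)[OF inner] toy_descent_onD(6)[OF outer] \<open>0 < c\<close>])
        (simp_all add: match s)
  qed
  then show ?thesis by (simp add: \<rho>_def r_def)
qed

lemma tendsto_glue_at_top:
  fixes f h :: "real \<Rightarrow> 'a::topological_space"
  assumes "(h \<longlongrightarrow> y) at_top"
  shows "((\<lambda>s. if s \<le> c then f s else h (s - c)) \<longlongrightarrow> y) at_top"
proof (rule Lim_transform_eventually)
  show "((\<lambda>s. h (s - c)) \<longlongrightarrow> y) at_top"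
    using filterlim_tendsto_add_at_top[OF tendsto_const[of "- c"] filterlim_ident]
    by (intro filterlim_compose[OF assms]) simp
  show "\<forall>\<^sub>F s in at_top. h (s - c) = (if s \<le> c then f s else h (s - c))"
    using eventually_gt_at_top[of c] by eventually_elim simp
qed

context toy_shooting
begin

context
  fixes \<beta> assumes \<beta>: "\<beta> \<in> {\<beta>1..\<beta>2}" and below: "\<And>t. 0 \<le> t \<Longrightarrow> excess \<beta> t < 0 \<and> 0 < cos (angle \<beta> t)"
begin

lemma always_descending: "0 \<le> t \<Longrightarrow> descending \<beta> t"
  using below by (auto simp: descending_def[OF \<beta>] less_imp_le)

lemma flow_toy_descent: "toy_descent_on g \<beta> (\<lambda>t. cos (angle \<beta> t)) (radius \<beta>) {0..}"
  unfolding toy_descent_on_def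
proof (intro ballI conjI)
  fix t :: real assume "t \<in> {0..}"
  then have t: "0 \<le> t" by simp
  have r: "0 < radius \<beta> t" "clamp_radius (radius \<beta> t) = radius \<beta> t"
    using descending_radius_pos[OF \<beta>] descending_clamp_radius[OF \<beta>] always_descending[OF t] by auto
  have sin: "0 < sin (angle \<beta> t)" "sqrt (1 - (cos (angle \<beta> t))\<^sup>2) = sin (angle \<beta> t)"
    using sin_angle_pos[OF \<beta> t] by (auto simp: sin_squared_eq[symmetric])
  have "toy_excess g \<beta> (cos (angle \<beta> t)) (radius \<beta> t) = excess \<beta> t"
    by (simp add: toy_excess_def sin(2) excess_def excess_at_def r(2) feedback_def mult.assoc)
  then have rhs: "toy_rhs g \<beta> (cos (angle \<beta> t)) (radius \<beta> t)
      = 3/2 * (sin (angle \<beta> t))\<^sup>2 / radius \<beta> t * excess \<beta> t"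
    by (simp add: toy_rhs_eq_excess sin_squared_eq)
  show "0 < cos (angle \<beta> t)" "0 < radius \<beta> t" using below[OF t] r(1) by auto
  have "(cos (angle \<beta> t))\<^sup>2 < 1\<^sup>2" using sin(1) by (simp add: cos_squared_eq)
  then show "cos (angle \<beta> t) < 1" by (rule power2_less_imp_less) simp
  show "toy_rhs g \<beta> (cos (angle \<beta> t)) (radius \<beta> t) < 0"
    unfolding rhs using sin(1) r(1) below[OF t] by (intro mult_pos_neg divide_pos_pos) auto
  have "((\<lambda>t. cos (angle \<beta> t)) has_real_derivative
      - sin (angle \<beta> t) * - (3/2 * eta \<beta> t * excess \<beta> t)) (at t within {0..})"
    using angle_derivative_within[OF \<beta> t] by (auto intro!: derivative_eq_intros)
  then show "((\<lambda>t. cos (angle \<beta> t)) has_real_derivative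
      toy_rhs g \<beta> (cos (angle \<beta> t)) (radius \<beta> t)) (at t within {0..})"
    by (simp add: rhs eta_def r(2) power2_eq_square mult_ac)
  show "(radius \<beta> has_real_derivative cos (angle \<beta> t)) (at t within {0..})"
    by (rule radius_derivative_within[OF t])
qed

lemma flow_limits:
  obtains l where "((\<lambda>t. cos (angle \<beta> t)) \<longlongrightarrow> 0) at_top" "0 < l" "(radius \<beta> \<longlongrightarrow> l) at_top"
proof -
  obtain l where l: "(radius \<beta> \<longlongrightarrow> l) at_top" "\<And>t. 0 \<le> t \<Longrightarrow> radius \<beta> t \<le> l"
    by (rule mono_bounded_tendsto_at_top[of 0 "radius \<beta>" R])
      (use descending_radius_mono[OF \<beta> always_descending] descending_radius_bounds(2)[OF \<beta> always_descending]
        that in \<open>auto intro: less_imp_le\<close>)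
  have "0 < l" using l(2)[of 0] radius_0 radii by simp
  have "((\<lambda>t. cos (angle \<beta> t)) \<longlongrightarrow> 0) at_top"
  proof (rule antimono_derivative_tendsto_0[OF radius_continuous_on radius_derivative])
    show "cos (angle \<beta> t) \<le> cos (angle \<beta> s)" if "0 \<le> s" "s \<le> t" for s t
      using descending_angle_mono[OF \<beta> always_descending that(1,2)] angle_range[OF \<beta>] that
      by (intro cos_monotone_0_pi_le) (auto intro: less_imp_le)
  qed (use below l(2) in \<open>auto intro: less_imp_le\<close>)
  then show thesis using that \<open>0 < l\<close> l(1) by blast
qed

end

end

lemma positive_speed_solution:
  fixes \<Phi> :: "real \<Rightarrow> real"
  assumes lipschitz: "L-lipschitz_on UNIV \<Phi>" and "0 < m" and speed: "\<And>x. m \<le> \<Phi> x" and "0 < x0"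
  obtains q c where "0 < c" "q c = x0" "(q \<longlongrightarrow> 0) (at_right 0)"
    "\<And>s. 0 < s \<Longrightarrow> (q has_real_derivative \<Phi> (q s)) (at s)"
    "\<And>s. 0 < s \<Longrightarrow> s \<le> c \<Longrightarrow> 0 < q s \<and> q s \<le> x0"
proof -
  obtain q where q: "q 0 = 0" "ode_solution \<Phi> q" by (rule ode_solution_exists[OF lipschitz])
  have q_deriv: "(q has_real_derivative \<Phi> (q s)) (at s)" if "0 < s" for s
    using ode_solution_derivative[OF q(2) that] by (simp add: has_real_derivative_iff_has_vector_derivative)
  have q_cont: "continuous_on {0..} q" by (rule ode_solution_continuous_on[OF q(2)])
  have growth: "q a - m * a \<le> q b - m * b" if "0 \<le> a" "a \<le> b" for a b
  proof (rule DERIV_nonneg_imp_increasing_open[OF that(2), where f = "\<lambda>s. q s - m * s"])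
    show "continuous_on {a..b} (\<lambda>s. q s - m * s)"
      by (intro continuous_intros continuous_on_subset[OF q_cont]) (use that in auto)
    fix s assume "a < s" "s < b"
    then have "((\<lambda>s. q s - m * s) has_real_derivative \<Phi> (q s) - m) (at s)"
      using q_deriv[of s] that by (auto intro!: derivative_eq_intros)
    then show "\<exists>y. ((\<lambda>s. q s - m * s) has_real_derivative y) (at s) \<and> 0 \<le> y"
      using speed[of "q s"] by (intro exI[of _ "\<Phi> (q s) - m"]) auto
  qed
  have "continuous_on {0..x0 / m} q" using q_cont by (rule continuous_on_subset) auto
  then obtain c where c: "0 \<le> c" "q c = x0"
    using IVT'[of q 0 x0 "x0 / m"] growth[of 0 "x0 / m"] q(1) \<open>0 < x0\<close> \<open>0 < m\<close> by auto
  have "c \<noteq> 0" using c(2) q(1) \<open>0 < x0\<close> by auto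
  show thesis
  proof (rule that)
    show "0 < c" "q c = x0" using c \<open>c \<noteq> 0\<close> by auto
    have "(q \<longlongrightarrow> q 0) (at 0 within {0..})" using q_cont by (simp add: continuous_on_def)
    then show "(q \<longlongrightarrow> 0) (at_right 0)" unfolding q(1) by (rule tendsto_within_subset) auto
    show "(q has_real_derivative \<Phi> (q s)) (at s)" if "0 < s" for s by (rule q_deriv[OF that])
    show "0 < q s \<and> q s \<le> x0" if "0 < s" "s \<le> c" for s
    proof
      have "0 < m * s" using \<open>0 < m\<close> that by simp
      then show "0 < q s" using growth[of 0 s] q(1) that by simp
      have "m * s \<le> m * c" using \<open>0 < m\<close> that by simp
      then show "q s \<le> x0" using growth[of s c] c(2) that by simp
    qed
  qed
qed

context tip_equation
begin

lemma
  assumes \<beta>: "\<beta> \<in> {0..B}" and x: "0 < x" "x\<^sup>2 < \<delta>"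
  shows sqrt_tip_rho: "sqrt (1 - (tip_rho \<beta> (x\<^sup>2))\<^sup>2) / x = tip_eta \<beta> (x\<^sup>2)"
    and toy_excess_tip: "toy_excess g \<beta> (tip_rho \<beta> (x\<^sup>2)) x = tip_excess \<beta> (x\<^sup>2)"
proof -
  have v: "\<bar>x\<^sup>2\<bar> < \<delta>" using x(2) by simp
  have "sqrt (x\<^sup>2 * (tip_eta \<beta> (x\<^sup>2))\<^sup>2) = x * tip_eta \<beta> (x\<^sup>2)"
    using x(1) tip_eta_bounds[OF \<beta> v] by (simp add: real_sqrt_mult)
  then show eta: "sqrt (1 - (tip_rho \<beta> (x\<^sup>2))\<^sup>2) / x = tip_eta \<beta> (x\<^sup>2)"
    using x(1) by (simp add: tip_rho_power2[OF \<beta> v])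
  show "toy_excess g \<beta> (tip_rho \<beta> (x\<^sup>2)) x = tip_excess \<beta> (x\<^sup>2)"
    by (simp add: toy_excess_def eta tip_excess_def)
qed

lemma
  assumes \<beta>: "\<beta> \<in> {0..B}" and x: "0 < x" "x\<^sup>2 < \<delta>"
  shows tip_rho_toy_rhs: "deriv (tip_rho \<beta>) (x\<^sup>2) * (2 * x * tip_rho \<beta> (x\<^sup>2)) = toy_rhs g \<beta> (tip_rho \<beta> (x\<^sup>2)) x"
    and toy_rhs_tip_neg: "toy_rhs g \<beta> (tip_rho \<beta> (x\<^sup>2)) x < 0"
proof -
  have v: "\<bar>x\<^sup>2\<bar> < \<delta>" using x(2) by simp
  have rhs: "toy_rhs g \<beta> (tip_rho \<beta> (x\<^sup>2)) x = 3/2 * x * (tip_eta \<beta> (x\<^sup>2))\<^sup>2 * tip_excess \<beta> (x\<^sup>2)"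
    unfolding toy_rhs_eq_excess toy_excess_tip[OF assms] tip_rho_power2[OF \<beta> v]
    using x(1) by (simp add: power2_eq_square)
  have "deriv (tip_rho \<beta>) (x\<^sup>2) * (2 * x * tip_rho \<beta> (x\<^sup>2))
      = x * (2 * tip_rho \<beta> (x\<^sup>2) * deriv (tip_rho \<beta>) (x\<^sup>2))" by simp
  then show "deriv (tip_rho \<beta>) (x\<^sup>2) * (2 * x * tip_rho \<beta> (x\<^sup>2)) = toy_rhs g \<beta> (tip_rho \<beta> (x\<^sup>2)) x"
    unfolding rhs tip_rho_derivative[OF \<beta> v] by simp
  have "0 < tip_eta \<beta> (x\<^sup>2)" using tip_eta_bounds[OF \<beta> v] by simp
  then show "toy_rhs g \<beta> (tip_rho \<beta> (x\<^sup>2)) x < 0"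
    unfolding rhs using x(1) tip_excess_neg[OF \<beta> v] by (intro mult_pos_neg mult_pos_pos) auto
qed

lemma tip_rho_less_1:
  assumes \<beta>: "\<beta> \<in> {0..B}" and v: "0 < v" "v < \<delta>"
  shows "tip_rho \<beta> v < 1"
proof -
  have "0 < v * (tip_eta \<beta> v)\<^sup>2" using v tip_eta_bounds[OF \<beta>, of v] by simp
  then have "(tip_rho \<beta> v)\<^sup>2 < 1\<^sup>2" using tip_rho_power2[OF \<beta>, of v] v by simp
  then show ?thesis by (rule power2_less_imp_less) simp
qed

lemma tip_speed_lipschitz:
  assumes \<beta>: "\<beta> \<in> {0..B}" and x0: "0 < x0" "x0\<^sup>2 < \<delta>"
  shows "bdd_lipschitz (\<lambda>x. tip_rho \<beta> ((max 0 (min x0 x))\<^sup>2))"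
proof (rule bdd_lipschitz_clamp[where \<phi> = "\<lambda>x. tip_rho \<beta> (x\<^sup>2)"])
  have range: "x\<^sup>2 \<in> {-\<delta><..<\<delta>}" if "x \<in> {0..x0}" for x
  proof -
    have "x\<^sup>2 \<le> x0\<^sup>2" using that by (intro power_mono) auto
    then show ?thesis using x0(2) radius_pos zero_le_power2[of x] unfolding greaterThanLessThan_iff by linarith
  qed
  show "((\<lambda>x. tip_rho \<beta> (x\<^sup>2)) has_real_derivative deriv (tip_rho \<beta>) (x\<^sup>2) * (2 * x)) (at x within {0..x0})"
    if "x \<in> {0..x0}" for x
    by (rule has_field_derivative_at_within,
        rule DERIV_chain2[where f = "tip_rho \<beta>" and g = "\<lambda>x. x\<^sup>2",
          OF real_analytic_on_has_derivative[OF tip_rho_analytic[OF \<beta>] range[OF that]]])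
      (auto intro!: derivative_eq_intros)
  have "continuous_on {-\<delta><..<\<delta>} (deriv (tip_rho \<beta>))"
    by (intro real_analytic_on_continuous_on real_analytic_on_deriv tip_rho_analytic \<beta>)
  then have "continuous_on {0..x0} (\<lambda>x. deriv (tip_rho \<beta>) (x\<^sup>2))"
    by (rule continuous_on_compose2) (use range in \<open>auto intro!: continuous_intros\<close>)
  then show "continuous_on {0..x0} (\<lambda>x. deriv (tip_rho \<beta>) (x\<^sup>2) * (2 * x))" by (intro continuous_intros)
qed (use x0 in simp)

lemma tip_rho_composed_derivative:
  assumes \<beta>: "\<beta> \<in> {0..B}" and q: "0 < q s" "(q s)\<^sup>2 < \<delta>"
    and q_deriv: "(q has_real_derivative tip_rho \<beta> ((q s)\<^sup>2)) (at s)"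
  shows "((\<lambda>s. tip_rho \<beta> ((q s)\<^sup>2)) has_real_derivative toy_rhs g \<beta> (tip_rho \<beta> ((q s)\<^sup>2)) (q s)) (at s)"
  unfolding tip_rho_toy_rhs[OF \<beta> q, symmetric]
proof (rule DERIV_chain2[where f = "tip_rho \<beta>" and g = "\<lambda>s. (q s)\<^sup>2"])
  have "(q s)\<^sup>2 \<in> {-\<delta><..<\<delta>}" using q(2) radius_pos less_le_trans[of "-\<delta>" 0 "(q s)\<^sup>2"] by simp
  then show "(tip_rho \<beta> has_real_derivative deriv (tip_rho \<beta>) ((q s)\<^sup>2)) (at ((q s)\<^sup>2))"
    by (rule real_analytic_on_has_derivative[OF tip_rho_analytic[OF \<beta>]])
  show "((\<lambda>s. (q s)\<^sup>2) has_real_derivative 2 * q s * tip_rho \<beta> ((q s)\<^sup>2)) (at s)"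
    using q_deriv by (auto intro!: derivative_eq_intros)
qed

lemma inner_descent:
  assumes \<beta>: "\<beta> \<in> {0..B}" and x0: "0 < x0" "x0\<^sup>2 < \<delta>"
  obtains q c where "0 < c" "q c = x0" "(q \<longlongrightarrow> 0) (at_right 0)"
    "\<And>s. 0 < s \<Longrightarrow> s \<le> c \<Longrightarrow> 0 < q s \<and> (q s)\<^sup>2 < \<delta>"
    "toy_descent_on g \<beta> (\<lambda>s. tip_rho \<beta> ((q s)\<^sup>2)) q {0<..c}"
proof -
  define \<Phi> where "\<Phi> = (\<lambda>x. tip_rho \<beta> ((max 0 (min x0 x))\<^sup>2))"
  obtain L where lipschitz: "L-lipschitz_on UNIV \<Phi>"
    unfolding \<Phi>_def by (rule bdd_lipschitzE[OF tip_speed_lipschitz[OF assms]])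
  have speed: "95/96 \<le> \<Phi> x" for x
  proof -
    have "(max 0 (min x0 x))\<^sup>2 \<le> x0\<^sup>2" using x0(1) by (intro power_mono) auto
    then show ?thesis unfolding \<Phi>_def using x0(2) by (intro tip_rho_ge[OF \<beta>]) simp
  qed
  obtain q c where c: "0 < c" "q c = x0" "(q \<longlongrightarrow> 0) (at_right 0)"
    and q': "\<And>s. 0 < s \<Longrightarrow> (q has_real_derivative \<Phi> (q s)) (at s)"
    and q: "\<And>s. 0 < s \<Longrightarrow> s \<le> c \<Longrightarrow> 0 < q s \<and> q s \<le> x0"
    by (rule positive_speed_solution[OF lipschitz _ speed x0(1)]) (simp, rule that)
  have q2: "0 < q s \<and> (q s)\<^sup>2 < \<delta>" if "0 < s" "s \<le> c" for s
  proof -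
    have "(q s)\<^sup>2 \<le> x0\<^sup>2" using q[OF that] by (intro power_mono) auto
    also have "\<dots> < \<delta>" by (rule x0(2))
    finally show ?thesis using q[OF that] by simp
  qed
  have "toy_descent_on g \<beta> (\<lambda>s. tip_rho \<beta> ((q s)\<^sup>2)) q {0<..c}"
    unfolding toy_descent_on_def
  proof (intro ballI conjI)
    fix s assume "s \<in> {0<..c}"
    then have s: "0 < s" "s \<le> c" by auto
    have v: "0 < q s" "(q s)\<^sup>2 < \<delta>" "\<bar>(q s)\<^sup>2\<bar> < \<delta>" using q2[OF s] by auto
    show "0 < tip_rho \<beta> ((q s)\<^sup>2)" using tip_rho_ge[OF \<beta> v(3)] by simp
    show "tip_rho \<beta> ((q s)\<^sup>2) < 1" using tip_rho_less_1[OF \<beta> _ v(2)] v(1) by simp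
    show "0 < q s" "toy_rhs g \<beta> (tip_rho \<beta> ((q s)\<^sup>2)) (q s) < 0"
      using v(1) toy_rhs_tip_neg[OF \<beta> v(1,2)] by auto
    have q_deriv: "(q has_real_derivative tip_rho \<beta> ((q s)\<^sup>2)) (at s)"
      using q'[OF s(1)] q[OF s] by (simp add: \<Phi>_def)
    then show "(q has_real_derivative tip_rho \<beta> ((q s)\<^sup>2)) (at s within {0<..c})"
      by (rule has_field_derivative_at_within)
    show "((\<lambda>s. tip_rho \<beta> ((q s)\<^sup>2)) has_real_derivative
        toy_rhs g \<beta> (tip_rho \<beta> ((q s)\<^sup>2)) (q s)) (at s within {0<..c})"
      by (rule has_field_derivative_at_within[OF tip_rho_composed_derivative[OF \<beta> v(1,2) q_deriv]])
  qed
  then show thesis using c q2 that by blast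
qed

definition tip_radius :: real where "tip_radius = sqrt (\<delta> / 2)"

definition tip_angle :: "real \<Rightarrow> real" where
  "tip_angle \<beta> = arcsin (tip_radius * tip_eta \<beta> (tip_radius\<^sup>2))"

lemma tip_radius: "0 < tip_radius" "tip_radius\<^sup>2 < \<delta>" "tip_radius < 1"
  using radius_pos radius_le by (auto simp: tip_radius_def)

lemma
  assumes \<beta>: "\<beta> \<in> {0..B}"
  shows tip_angle_bounds: "0 < tip_angle \<beta>" "tip_angle \<beta> < pi/2"
    and sin_tip_angle: "sin (tip_angle \<beta>) / tip_radius = tip_eta \<beta> (tip_radius\<^sup>2)"
    and cos_tip_angle: "cos (tip_angle \<beta>) = tip_rho \<beta> (tip_radius\<^sup>2)"
proof -
  define y where "y = tip_radius * tip_eta \<beta> (tip_radius\<^sup>2)"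
  have v: "\<bar>tip_radius\<^sup>2\<bar> < \<delta>" using tip_radius(2) by simp
  have "y \<le> 1 * (3/8)"
    unfolding y_def using tip_eta_bounds[OF \<beta> v] tip_radius by (intro mult_mono) auto
  then have y: "0 < y" "y < 1" using tip_eta_bounds[OF \<beta> v] tip_radius(1) by (auto simp: y_def)
  show "0 < tip_angle \<beta>" "tip_angle \<beta> < pi/2"
    using y arcsin_less_mono[of 0 y] arcsin_less_mono[of y 1] by (auto simp: tip_angle_def y_def[symmetric])
  show "sin (tip_angle \<beta>) / tip_radius = tip_eta \<beta> (tip_radius\<^sup>2)"
    using y tip_radius(1) by (simp add: tip_angle_def y_def[symmetric]) (simp add: y_def)
  have "cos (tip_angle \<beta>) = sqrt (1 - y\<^sup>2)"
    unfolding tip_angle_def y_def[symmetric] using y by (intro cos_arcsin) auto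
  also have "\<dots> = tip_rho \<beta> (tip_radius\<^sup>2)"
    by (simp add: tip_rho_eq[OF \<beta> v] y_def power_mult_distrib)
  finally show "cos (tip_angle \<beta>) = tip_rho \<beta> (tip_radius\<^sup>2)" .
qed

lemma tip_angle_continuous_on: "continuous_on {0..B} tip_angle"
  unfolding tip_angle_def[abs_def]
proof (rule continuous_on_arcsin)
  have v: "\<bar>tip_radius\<^sup>2\<bar> < \<delta>" using tip_radius(2) by simp
  have "2-lipschitz_on {0..B} (\<lambda>\<beta>. tip_eta \<beta> (tip_radius\<^sup>2))"
    using tip_eta_lipschitz[OF _ _ v] by (intro lipschitz_onI) (auto simp: dist_real_def)
  then show "continuous_on {0..B} (\<lambda>\<beta>. tip_radius * tip_eta \<beta> (tip_radius\<^sup>2))"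
    by (intro continuous_intros lipschitz_on_continuous_on)
  show "\<forall>\<beta>\<in>{0..B}. -1 \<le> tip_radius * tip_eta \<beta> (tip_radius\<^sup>2) \<and> tip_radius * tip_eta \<beta> (tip_radius\<^sup>2) \<le> 1"
  proof
    fix \<beta> assume "\<beta> \<in> {0..B}"
    then have "7/24 \<le> tip_eta \<beta> (tip_radius\<^sup>2)" "tip_eta \<beta> (tip_radius\<^sup>2) \<le> 3/8"
      using tip_eta_bounds[OF _ v] by auto
    moreover from this have "tip_radius * tip_eta \<beta> (tip_radius\<^sup>2) \<le> 1 * (3/8)"
      using tip_radius by (intro mult_mono) auto
    moreover have "0 \<le> tip_radius * tip_eta \<beta> (tip_radius\<^sup>2)" using calculation tip_radius(1) by simp
    ultimately show "-1 \<le> tip_radius * tip_eta \<beta> (tip_radius\<^sup>2) \<and> tip_radius * tip_eta \<beta> (tip_radius\<^sup>2) \<le> 1"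
      by linarith
  qed
qed

lemma toy_shooting_from_tip:
  assumes g: "toy_nonlinearity g" and lim: "filterlim (\<lambda>v. v * g (v\<^sup>2)) at_top at_top"
    and parameters: "0 < \<beta>1" "\<beta>1 \<le> B"
    and small: "\<beta>1 * toy_nonlinearity.feedback g 5 \<le> 1/7"
    and large: "12/25 \<le> 4/5 * (B * toy_nonlinearity.feedback g (12/25))"
  obtains R where "toy_shooting g tip_radius R \<beta>1 B tip_angle"
proof -
  interpret toy_nonlinearity g by (rule g)
  define K where "K = 1 / (tip_radius * (7/24) * \<beta>1)"
  have "\<forall>\<^sub>F v in at_top. K < v * g (v\<^sup>2)" using lim by (simp add: filterlim_at_top_dense)
  then have "\<forall>\<^sub>F v in at_top. K < v * g (v\<^sup>2) \<and> 1 < v"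
    using eventually_gt_at_top[of 1] by (rule eventually_conj)
  then obtain R where R: "K < R * g (R\<^sup>2)" "1 < R"
    using eventually_happens'[OF trivial_limit_at_top_linorder] by blast
  have v: "\<bar>tip_radius\<^sup>2\<bar> < \<delta>" using tip_radius(2) by simp
  have "toy_shooting g tip_radius R \<beta>1 B tip_angle"
  proof
    show "0 < tip_radius" "tip_radius < 5" "tip_radius < R" using tip_radius R by auto
    show "continuous_on {\<beta>1..B} tip_angle"
      using tip_angle_continuous_on by (rule continuous_on_subset) (use parameters in auto)
    fix \<beta> assume \<beta>1: "\<beta> \<in> {\<beta>1..B}"
    then have \<beta>: "\<beta> \<in> {0..B}" using parameters by auto
    note tip = tip_angle_bounds[OF \<beta>] sin_tip_angle[OF \<beta>] cos_tip_angle[OF \<beta>]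
      and bounds = tip_eta_bounds[OF \<beta> v]
    show "0 < tip_angle \<beta> \<and> tip_angle \<beta> < pi/2" using tip by simp
    show "3/5 < cos (tip_angle \<beta>)" using tip_rho_ge[OF \<beta> v] by (simp add: tip)
    show "7/24 \<le> sin (tip_angle \<beta>) / tip_radius \<and> sin (tip_angle \<beta>) / tip_radius \<le> 3/8"
      using bounds by (simp add: tip)
    show "toy_excess g \<beta> (cos (tip_angle \<beta>)) tip_radius < 0"
      using tip_excess_neg[OF \<beta> v] by (simp add: tip toy_excess_tip[OF \<beta> tip_radius(1,2)])
    have "1 = tip_radius * (7/24) * (\<beta>1 * K)" using tip_radius parameters by (simp add: K_def)
    also have "\<dots> < tip_radius * (7/24) * (\<beta>1 * (R * g (R\<^sup>2)))"
      using R tip_radius parameters by (intro mult_strict_left_mono) auto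
    also have "\<dots> \<le> tip_radius * tip_eta \<beta> (tip_radius\<^sup>2) * (\<beta> * (R * g (R\<^sup>2)))"
      using bounds \<beta>1 parameters tip_radius R(2) g_pos[of "R\<^sup>2"] by (intro mult_mono) auto
    also have "\<dots> = sin (tip_angle \<beta>) / R * (\<beta> * feedback R)"
      using tip(3) tip_radius(1) R(2) by (simp add: feedback_def field_simps power2_eq_square)
    finally show "1 < sin (tip_angle \<beta>) / R * (\<beta> * feedback R)" .
  qed (use parameters small large in auto)
  then show thesis by (rule that)
qed

lemma tip_limits:
  fixes \<rho> r :: "real \<Rightarrow> real"
  assumes \<beta>: "\<beta> \<in> {0..B}" and r_limit: "(r \<longlongrightarrow> 0) (at_right 0)" and "0 < c"
    and tip: "\<And>s. 0 < s \<Longrightarrow> s < c \<Longrightarrow> 0 < r s \<and> (r s)\<^sup>2 < \<delta> \<and> \<rho> s = tip_rho \<beta> ((r s)\<^sup>2)"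
  shows "(\<rho> \<longlongrightarrow> 1) (at_right 0)" and "((\<lambda>s. sqrt (1 - (\<rho> s)\<^sup>2) / r s) \<longlongrightarrow> 1/3) (at_right 0)"
proof -
  have v_limit: "((\<lambda>s. (r s)\<^sup>2) \<longlongrightarrow> 0) (at_right 0)" using tendsto_power[OF r_limit, of 2] by simp
  have "\<bar>0\<bar> < \<delta>" using radius_pos by simp
  have "tip_rho \<beta> 0 = 1" using tip_rho_eq[OF \<beta> \<open>\<bar>0\<bar> < \<delta>\<close>] by simp
  have "isCont (tip_rho \<beta>) 0"
    using radius_pos by (intro DERIV_isCont[OF real_analytic_on_has_derivative[OF tip_rho_analytic[OF \<beta>]]]) simp
  from isCont_tendsto_compose[OF this v_limit]
  show "(\<rho> \<longlongrightarrow> 1) (at_right 0)"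
    unfolding \<open>tip_rho \<beta> 0 = 1\<close>
    by (rule Lim_transform_eventually) (rule eventually_at_right_interval[OF \<open>0 < c\<close>], simp add: tip)
  from isCont_tendsto_compose[OF DERIV_isCont[OF tip_eta_has_derivative[OF \<beta> \<open>\<bar>0\<bar> < \<delta>\<close>]] v_limit]
  show "((\<lambda>s. sqrt (1 - (\<rho> s)\<^sup>2) / r s) \<longlongrightarrow> 1/3) (at_right 0)"
    unfolding tip_eta_0[OF \<beta>]
    by (rule Lim_transform_eventually)
      (rule eventually_at_right_interval[OF \<open>0 < c\<close>], simp add: tip sqrt_tip_rho[OF \<beta>])
qed

lemma toy_steady_tip_growth_from_descent:
  assumes \<beta>: "\<beta> \<in> {0..B}" and descent: "toy_descent_on g \<beta> \<rho> r {0<..}"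
    and c: "0 < c" "(r c)\<^sup>2 < \<delta>"
    and tip: "\<And>s. 0 < s \<Longrightarrow> s < c \<Longrightarrow> (r s)\<^sup>2 < \<delta> \<and> \<rho> s = tip_rho \<beta> ((r s)\<^sup>2)"
    and r_limit: "(r \<longlongrightarrow> 0) (at_right 0)"
    and limits: "(\<rho> \<longlongrightarrow> 0) at_top" "0 < l" "(r \<longlongrightarrow> l) at_top"
  shows "toy_steady_tip_growth g \<beta> \<rho> r"
proof -
  have solution: "0 < \<rho> s" "-1 < \<rho> s" "\<rho> s < 1" "0 < r s"
    "(\<rho> has_real_derivative toy_rhs g \<beta> (\<rho> s) (r s)) (at s)" "(r has_real_derivative \<rho> s) (at s)"
    and rhs_neg: "toy_rhs g \<beta> (\<rho> s) (r s) < 0" if "0 < s" for s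
    using toy_descent_onD[OF descent, of s] that by (simp_all add: at_within_open[of s "{0<..}"])
  have decreasing: "deriv \<rho> s < 0" if "0 < s" for s
    unfolding DERIV_imp_deriv[OF solution(5)[OF that]] by (rule rhs_neg[OF that])
  have "real_analytic_on (tip_rho \<beta>) {- ((r c)\<^sup>2)<..<(r c)\<^sup>2}"
    using tip_rho_analytic[OF \<beta>] by (rule real_analytic_on_subset) (use c(2) in auto)
  moreover have "0 < tip_rho \<beta> v" if "v \<in> {- ((r c)\<^sup>2)<..<(r c)\<^sup>2}" for v
    using tip_rho_ge[OF \<beta>, of v] that c(2) by (simp add: abs_less_iff)
  ultimately have profile: "\<exists>s0>0. \<exists>G. real_analytic_on G {- ((r s0)\<^sup>2)<..<(r s0)\<^sup>2}
      \<and> (\<forall>v\<in>{- ((r s0)\<^sup>2)<..<(r s0)\<^sup>2}. 0 < G v) \<and> (\<forall>s\<in>{0<..<s0}. \<rho> s = G ((r s)\<^sup>2))"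
    using c(1) tip by (intro exI[of _ c] conjI exI[of _ "tip_rho \<beta>"]) auto
  have "(\<rho> \<longlongrightarrow> 1) (at_right 0)" and "((\<lambda>s. sqrt (1 - (\<rho> s)\<^sup>2) / r s) \<longlongrightarrow> 1/3) (at_right 0)"
    by (rule tip_limits[OF \<beta> r_limit c(1)]; simp add: solution(4) tip)+
  then have "(\<rho> \<longlongrightarrow> 1) (at_right 0)"
    "\<exists>\<eta>0>0. ((\<lambda>s. sqrt (1 - (\<rho> s)\<^sup>2) / r s) \<longlongrightarrow> \<eta>0) (at_right 0)"
    by (auto intro: exI[of _ "1/3"])
  moreover have "\<forall>s>0. -1 < \<rho> s \<and> \<rho> s < 1 \<and> 0 < r s \<and>
      (\<rho> has_real_derivative toy_rhs g \<beta> (\<rho> s) (r s)) (at s) \<and> (r has_real_derivative \<rho> s) (at s)"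
    using solution by simp
  moreover have "\<forall>s>0. deriv \<rho> s < 0 \<and> 0 < \<rho> s" using solution(1) decreasing by simp
  moreover have "\<exists>r_inf>0. (r \<longlongrightarrow> r_inf) at_top" using limits(2,3) by blast
  ultimately show ?thesis
    unfolding toy_steady_tip_growth_def by (intro conjI r_limit profile limits(1))
qed

lemma toy_steady_tip_growth_extend:
  assumes \<beta>: "\<beta> \<in> {0..B}" and x0: "0 < x0" "x0\<^sup>2 < \<delta>"
    and outer: "toy_descent_on g \<beta> \<rho>' r' {0..}" and start: "\<rho>' 0 = tip_rho \<beta> (x0\<^sup>2)" "r' 0 = x0"
    and limits: "(\<rho>' \<longlongrightarrow> 0) at_top" "0 < l" "(r' \<longlongrightarrow> l) at_top"
  obtains \<rho> r where "toy_steady_tip_growth g \<beta> \<rho> r"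
proof -
  obtain q c where c: "0 < c" "q c = x0" "(q \<longlongrightarrow> 0) (at_right 0)"
    and q: "\<And>s. 0 < s \<Longrightarrow> s \<le> c \<Longrightarrow> 0 < q s \<and> (q s)\<^sup>2 < \<delta>"
    and inner: "toy_descent_on g \<beta> (\<lambda>s. tip_rho \<beta> ((q s)\<^sup>2)) q {0<..c}"
    by (rule inner_descent[OF \<beta> x0]) (rule that)
  define \<rho> where "\<rho> = (\<lambda>s. if s \<le> c then tip_rho \<beta> ((q s)\<^sup>2) else \<rho>' (s - c))"
  define r where "r = (\<lambda>s. if s \<le> c then q s else r' (s - c))"
  have "toy_steady_tip_growth g \<beta> \<rho> r"
  proof (rule toy_steady_tip_growth_from_descent[OF \<beta> _ c(1) _ _ _ _ limits(2)])
    show "toy_descent_on g \<beta> \<rho> r {0<..}"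
      unfolding \<rho>_def r_def
      by (intro toy_descent_on_glue inner toy_descent_on_shift outer c(1)) (simp_all add: start c(2))
    show "(r c)\<^sup>2 < \<delta>" using c(2) x0(2) by (simp add: r_def)
    show "(r s)\<^sup>2 < \<delta> \<and> \<rho> s = tip_rho \<beta> ((r s)\<^sup>2)" if "0 < s" "s < c" for s
      using q[of s] that by (simp add: \<rho>_def r_def)
    show "(r \<longlongrightarrow> 0) (at_right 0)"
      by (rule Lim_transform_eventually[OF c(3)])
        (rule eventually_at_right_interval[OF c(1)], simp add: r_def)
    show "(\<rho> \<longlongrightarrow> 0) at_top" "(r \<longlongrightarrow> l) at_top"
      unfolding \<rho>_def r_def by (intro tendsto_glue_at_top limits)+
  qed
  then show thesis by (rule that)
qed

end

lemma (in toy_nonlinearity) shooting_endpoints: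
  obtains \<beta>1 \<beta>2 where "0 < \<beta>1" "\<beta>1 \<le> \<beta>2" "1 \<le> \<beta>2"
    "\<beta>1 * feedback 5 \<le> 1/7" "12/25 \<le> 4/5 * (\<beta>2 * feedback (12/25))"
proof -
  define \<beta>1 where "\<beta>1 = 1 / (7 * feedback 5)"
  define \<beta>2 where "\<beta>2 = max (max 1 \<beta>1) (3/5 / feedback (12/25))"
  have pos: "0 < feedback 5" "0 < feedback (12/25)" by (simp_all add: feedback_pos)
  have "3/5 / feedback (12/25) * feedback (12/25) \<le> \<beta>2 * feedback (12/25)"
    using pos(2) by (intro mult_right_mono) (auto simp: \<beta>2_def)
  then have "12/25 \<le> 4/5 * (\<beta>2 * feedback (12/25))" using pos(2) by simp
  moreover have "0 < \<beta>1" "\<beta>1 * feedback 5 \<le> 1/7" using pos(1) by (auto simp: \<beta>1_def)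
  moreover have "\<beta>1 \<le> \<beta>2" "1 \<le> \<beta>2" by (auto simp: \<beta>2_def)
  ultimately show thesis using that by blast
qed

theorem toy_steady_tip_growth_exists:
  assumes "toy_nonlinearity g" "filterlim (\<lambda>v. v * g (v\<^sup>2)) at_top at_top"
  obtains \<beta> \<rho> r where "0 < \<beta>" "toy_steady_tip_growth g \<beta> \<rho> r"
proof -
  interpret toy_nonlinearity g by fact
  obtain \<beta>1 \<beta>2 where parameters: "0 < \<beta>1" "\<beta>1 \<le> \<beta>2" "1 \<le> \<beta>2"
    and endpoints: "\<beta>1 * feedback 5 \<le> 1/7" "12/25 \<le> 4/5 * (\<beta>2 * feedback (12/25))"
    by (rule shooting_endpoints)
  obtain \<gamma> \<delta> where "tip_equation g \<gamma> \<delta> \<beta>2"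
    by (rule tip_equation_exists[OF analytic UNIV_I parameters(3)])
  then interpret tip_equation g \<gamma> \<delta> \<beta>2 .
  obtain R where "toy_shooting g tip_radius R \<beta>1 \<beta>2 tip_angle"
    by (rule toy_shooting_from_tip[OF assms parameters(1,2) endpoints])
  then interpret toy_shooting g tip_radius R \<beta>1 \<beta>2 tip_angle .
  obtain \<beta> where \<beta>: "\<beta> \<in> {\<beta>1..\<beta>2}" and below: "\<And>t. 0 \<le> t \<Longrightarrow> excess \<beta> t < 0 \<and> 0 < cos (angle \<beta> t)"
    by (rule shooting_parameter) (rule that)
  obtain l where limits: "((\<lambda>t. cos (angle \<beta> t)) \<longlongrightarrow> 0) at_top" "0 < l" "(radius \<beta> \<longlongrightarrow> l) at_top"
    by (rule flow_limits[OF \<beta> below])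
  have "\<beta> \<in> {0..\<beta>2}" "0 < \<beta>" using \<beta> parameters by auto
  obtain \<rho> r where "toy_steady_tip_growth g \<beta> \<rho> r"
    by (rule toy_steady_tip_growth_extend[OF \<open>\<beta> \<in> {0..\<beta>2}\<close> tip_radius(1,2)
          flow_toy_descent[OF \<beta> below] _ _ limits])
      (simp_all add: angle_0 radius_0 cos_tip_angle[OF \<open>\<beta> \<in> {0..\<beta>2}\<close>])
  then show thesis using that \<open>0 < \<beta>\<close> by blast
qed

theorem theorem3p1:
  fixes g :: "real \<Rightarrow> real"
  assumes analytic: "real_analytic_on g UNIV"
    and pos: "\<And>v. v > 0 \<Longrightarrow> g v > 0"
    and mono: "\<And>v. v > 0 \<Longrightarrow> deriv g v \<ge> 0"
    and convex: "\<And>v. v > 0 \<Longrightarrow> deriv (deriv (\<lambda>v. v^2 * g (v^2))) v > 0"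
    and lim: "filterlim (\<lambda>v. v * g (v^2)) at_top at_top"
  shows "\<exists>\<beta>>0. \<exists>\<rho> r. toy_steady_tip_growth g \<beta> \<rho> r \<and>
           (\<forall>\<rho>' r'. toy_steady_tip_growth g \<beta> \<rho>' r' \<longrightarrow>
              (\<forall>s>0. \<rho>' s = \<rho> s \<and> r' s = r s))"
proof -
  interpret toy_nonlinearity g by unfold_locales (fact analytic pos mono convex)+
  obtain \<beta> \<rho> r where "0 < \<beta>" and growth: "toy_steady_tip_growth g \<beta> \<rho> r"
    by (rule toy_steady_tip_growth_exists[OF toy_nonlinearity_axioms lim])
  moreover have "isCont g v" for v by (rule DERIV_isCont[OF g_has_derivative])
  then have "\<rho>' s = \<rho> s \<and> r' s = r s"
    if "toy_steady_tip_growth g \<beta> \<rho>' r'" "s > 0" for \<rho>' r' s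
    using toy_steady_tip_growth_unique[OF that(1) growth] that(2) by blast
  ultimately show ?thesis by blast
qed

end
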